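(* Let $n\ge 1$ be an integer, $\Omega=\{x\in\mathbb{R}^n : x_n\ge 0\}$, $\partial\Omega=\{x\in\mathbb{R}^n: x_n=0\}$, $T_{\max}>0$, and let $u:[0,T_{\max}]\times\Omega\to\mathbb{R}$ be a smooth function (up to the boundary) satisfying $\frac{\partial u}{\partial t}=\Delta u$ in $\Omega$ and $u(0,x)=0$ for all $x\in\Omega$. Assume that for each multi-index $\gamma\in\mathbb{N}^n$ there exists $C>0$ such that $|D^\gamma u(t,x)|\le Ce^{C|x|}$ for all $t\in[0,T_{\max}]$ and $x\in\Omega$. Define, for $t\in[0,T_{\max}]$ and $x\in\partial\Omega$, the boundary temperature $g(t,x)=u(t,x)$ and the boundary flux $q(t,x)=-\frac{\partial u}{\partial x_n}(t,x)$. Then for all $t\in(0,T_{\max}]$ and $x\in\partial\Omega$, $$q(t,x)=\frac{g(t,x)}{\sqrt{\pi t}}+\int_0^t\frac{g(t,x)-g(s,x)}{\sqrt{4\pi}\,(t-s)^{3/2}}\,ds-\int_0^t\int_{\partial\Omega}(g(s,y)-g(s,x))\,\frac{\exp\left(-\frac{|x-y|^2}{4(t-s)}\right)}{(t-s)(4\pi(t-s))^{n/2}}\,dy\,ds.$$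
   Context: $D^\gamma$ denotes the spatial partial derivative with respect to the multi-index $\gamma=(\gamma_1,\dots,\gamma_n)$. The measure $dy$ on $\partial\Omega\cong\mathbb{R}^{n-1}$ is $(n-1)$-dimensional Lebesgue measure (for $n=1$, $\partial\Omega$ is a single point with unit mass). The double integral is an iterated integral, with the spatial integration performed first. *)

theory Defs
  imports "HOL-Analysis.Analysis"
begin

text \<open>
  Points of \<open>n\<close>-dimensional space are elements of \<^typ>\<open>real ^ 'n\<close> for a finite linearly ordered
  index type \<open>'n\<close> with \<open>n = CARD('n)\<close>. The largest index plays the role of the index \<open>n\<close> of
  the coordinate \<open>x\<^sub>n\<close>; the order also fixes the order of differentiation in \<open>D\<^sup>\<gamma>\<close>.
\<close>

definition last_idx :: "'n::{finite,linorder}"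
  where "last_idx = Max UNIV"

definition half_space :: "(real ^ 'n::{finite,linorder}) set"
  where "half_space = {x. x $ last_idx \<ge> 0}"

definition half_space_bdry :: "(real ^ 'n::{finite,linorder}) set"
  where "half_space_bdry = {x. x $ last_idx = 0}"

text \<open>
  Derivative of \<open>f : S \<rightarrow> \<real>\<close> in direction \<open>e\<close>. It only uses the values of \<open>f\<close> on \<open>S\<close>, so it is
  one-sided at those points of \<open>S\<close> from which only \<open>+e\<close> or only \<open>-e\<close> points into \<open>S\<close>.
\<close>

definition dir_deriv_within ::
    "'a::real_normed_vector set \<Rightarrow> 'a \<Rightarrow> ('a \<Rightarrow> real) \<Rightarrow> 'a \<Rightarrow> real"
  where "dir_deriv_within S e f x =
    vector_derivative (\<lambda>h. f (x + h *\<^sub>R e)) (at 0 within {h. x + h *\<^sub>R e \<in> S})"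

definition dir_differentiable_within ::
    "'a::real_normed_vector set \<Rightarrow> 'a \<Rightarrow> ('a \<Rightarrow> real) \<Rightarrow> 'a \<Rightarrow> bool"
  where "dir_differentiable_within S e f x \<longleftrightarrow>
    (\<lambda>h. f (x + h *\<^sub>R e)) differentiable (at 0 within {h. x + h *\<^sub>R e \<in> S})"

text \<open>
  \<open>C\<^sup>k\<close> and \<open>C\<^sup>\<infinity>\<close> regularity up to the boundary: all iterated partial derivatives exist (one-sided
  at the boundary where necessary) and are continuous on the whole of \<open>S\<close>. Intended for convex \<open>S\<close>
  such that every line parallel to an axis that meets \<open>S\<close> does so in a nondegenerate interval.
\<close>

primrec Ck_on :: "nat \<Rightarrow> 'a::euclidean_space set \<Rightarrow> ('a \<Rightarrow> real) \<Rightarrow> bool"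
  where
    "Ck_on 0 S f \<longleftrightarrow> continuous_on S f"
  | "Ck_on (Suc k) S f \<longleftrightarrow> continuous_on S f \<and>
       (\<forall>e\<in>Basis. (\<forall>x\<in>S. dir_differentiable_within S e f x) \<and> Ck_on k S (dir_deriv_within S e f))"

definition smooth_on :: "'a::euclidean_space set \<Rightarrow> ('a \<Rightarrow> real) \<Rightarrow> bool"
  where "smooth_on S f \<longleftrightarrow> (\<forall>k. Ck_on k S f)"

definition partial ::
    "'n::{finite,linorder} \<Rightarrow> (real ^ 'n::{finite,linorder} \<Rightarrow> real) \<Rightarrow> real ^ 'n::{finite,linorder} \<Rightarrow> real"
  where "partial i = dir_deriv_within half_space (axis i 1)"

text \<open>\<open>D\<^sup>\<gamma> = \<partial>\<^sub>1\<^bsup>\<gamma> 1\<^esup> \<circ> \<dots> \<circ> \<partial>\<^sub>n\<^bsup>\<gamma> n\<^esup>\<close>\<close>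

definition multi_partial ::
    "('n::{finite,linorder} \<Rightarrow> nat) \<Rightarrow> (real ^ 'n::{finite,linorder} \<Rightarrow> real) \<Rightarrow> real ^ 'n::{finite,linorder} \<Rightarrow> real"
  where "multi_partial \<gamma> = foldr (\<lambda>i. partial i ^^ \<gamma> i) (sorted_list_of_set UNIV)"

definition laplacian :: "(real ^ 'n::{finite,linorder} \<Rightarrow> real) \<Rightarrow> real ^ 'n::{finite,linorder} \<Rightarrow> real"
  where "laplacian f x = (\<Sum>i\<in>UNIV. partial i (partial i f) x)"

text \<open>
  \<open>(n - 1)\<close>-dimensional Lebesgue measure on the boundary hyperplane, as the image of the product
  measure in the coordinates other than the last one. If \<open>n = 1\<close>, the product has no factors and
  is a unit point mass, so the result is the unit point mass at the origin.
\<close>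

definition bdry_lborel :: "(real ^ 'n::{finite,linorder}) measure"
  where "bdry_lborel =
    distr (\<Pi>\<^sub>M i\<in>UNIV - {last_idx}. lborel) borel (\<lambda>w. \<chi> i. if i = last_idx then 0 else w i)"

end

theory Submission
  imports Defs "HOL-Probability.Probability"
begin

text \<open>
  Fix \<open>t\<close> and a boundary point \<open>x\<close>, put \<open>r = sqrt (2 * (t - s))\<close> and let \<open>Y = (Z, \<rho>)\<close> have
  independent coordinates, standard normal along the boundary (\<open>Z\<close>) and Rayleigh distributed in
  the normal direction (\<open>\<rho>\<close>). Gaussian integration by parts in each coordinate and the heat
  equation give \<open>d/ds (E u(s, x + r Y) / r) = E u(s, x + r (Z, 0)) / r\<^sup>3\<close>. Integrated over \<open>[0, s]\<close>
  pathwise, with Fubini instead of differentiation under the expectation, this expresses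
  \<open>E u(s, x + r Y) / r\<close> by boundary values only. As \<open>s\<close> tends to \<open>t\<close>, the difference quotient
  \<open>(E u(s, x + r Y) - u(t, x)) / r\<close> tends to \<open>sqrt (pi / 2)\<close> times the normal derivative, and
  splitting \<open>E u(s, x + r (Z, 0))\<close> into \<open>u(t, x)\<close>, \<open>u(s, x) - u(t, x)\<close> and the tangential increment,
  which is \<open>O(r\<^sup>2)\<close> because its first order term averages out, makes all integrals converge.
\<close>

subsection \<open>Derivatives from continuous partial derivatives\<close>

text \<open>The weight (t - s)^(-3/2) is not integrable up to s = t, so in general neither the
  boundary mean of u nor the constant u(t, x) can be integrated against it separately on [0, t].
  Everything is therefore compared on [0, s] with s < t. There the constant contributes u(t, x)
  times kappa / r(s) - kappa / r(0) with kappa = sqrt (2 / pi). The part that diverges as s tends to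
  t turns the half-space mean into a difference quotient, and the part at 0 is the term u(t, x) /
  sqrt (pi t). The choice r^2 = 2 (t - s) gives r r' = -1; this is what lets the Laplacian from the
  time derivative cancel against the second derivatives produced by integration by parts. The
  constant kappa is the reciprocal of the Rayleigh mean sqrt (pi / 2), so the normal derivative
  comes out with coefficient 1.\<close>

lemma has_field_derivative_shift_within:
  fixes f :: "real \<Rightarrow> real"
  assumes "((\<lambda>h. f (a + h)) has_field_derivative D) (at 0 within {h. a + h \<in> A})"
  shows "(f has_field_derivative D) (at a within A)"
proof -
  have "(\<lambda>y. y - a) ` A = {h. a + h \<in> A}"
    by (auto simp: image_iff) (metis add_diff_cancel_left')
  then have "((\<lambda>h. f (a + h)) has_field_derivative D) (at (a - a) within (\<lambda>y. y - a) ` A)"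
    using assms by simp
  then have "((\<lambda>h. f (a + h)) \<circ> (\<lambda>y. y - a) has_field_derivative D * 1) (at a within A)"
    by (rule DERIV_image_chain) (auto intro!: derivative_eq_intros)
  then show ?thesis by (simp add: o_def)
qed

text \<open>The mean value inequality for f (y + h b) - h c: subtracting the linear term turns
  closeness of the derivative to c into a first order estimate. Convexity keeps the whole segment in
  \<open>S\<close>.\<close>

lemma increment_bound_along_line:
  fixes f :: "'a::euclidean_space \<Rightarrow> real"
  assumes S: "convex S" "y \<in> S" "y + d *\<^sub>R b \<in> S"
    and D: "\<And>z. z \<in> S \<Longrightarrow>
      ((\<lambda>h. f (z + h *\<^sub>R b)) has_field_derivative D z) (at 0 within {h. z + h *\<^sub>R b \<in> S})"
    and bound: "\<And>h. h \<in> closed_segment 0 d \<Longrightarrow> \<bar>D (y + h *\<^sub>R b) - c\<bar> \<le> e"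
  shows "\<bar>f (y + d *\<^sub>R b) - f y - d * c\<bar> \<le> e * \<bar>d\<bar>"
proof -
  have in_S: "y + h *\<^sub>R b \<in> S" if h: "h \<in> closed_segment 0 d" for h
  proof -
    from h obtain r where r: "0 \<le> r" "r \<le> 1" "h = r * d"
      by (auto simp: in_segment)
    have "y + h *\<^sub>R b = (1 - r) *\<^sub>R y + r *\<^sub>R (y + d *\<^sub>R b)"
      by (simp add: r algebra_simps)
    then show ?thesis
      using S r by (auto intro: convexD_alt)
  qed
  define p where "p = (\<lambda>h. f (y + h *\<^sub>R b) - h * c)"
  have p': "(p has_field_derivative D (y + h *\<^sub>R b) - c) (at h within closed_segment 0 d)"
    if h: "h \<in> closed_segment 0 d" for h
  proof -
    have "((\<lambda>h. f (y + h *\<^sub>R b)) has_field_derivative D (y + h *\<^sub>R b)) (at h within {h. y + h *\<^sub>R b \<in> S})"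
      by (rule has_field_derivative_shift_within)
         (use D[OF in_S[OF h]] in \<open>simp add: algebra_simps\<close>)
    then have "((\<lambda>h. f (y + h *\<^sub>R b)) has_field_derivative D (y + h *\<^sub>R b)) (at h within closed_segment 0 d)"
      by (rule DERIV_subset) (use in_S in auto)
    then show ?thesis
      unfolding p_def by (auto intro!: derivative_eq_intros)
  qed
  have "norm (p d - p 0) \<le> e * norm (d - 0)"
    by (rule field_differentiable_bound[OF convex_closed_segment p'])
       (use bound in auto)
  then show ?thesis
    by (simp add: p_def algebra_simps)
qed

text \<open>From x to y one coordinate is changed at a time, and each change is a one-dimensional
  increment. \<open>mix\<close> keeps the intermediate points in \<open>S\<close>; it holds for a
  time interval times a half-space, so boundary points with one-sided derivatives are
  covered.\<close>

lemma has_derivative_of_continuous_partials: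
  fixes f :: "'a::euclidean_space \<Rightarrow> real"
  assumes S: "convex S"
    and mix: "\<And>y z b. y \<in> S \<Longrightarrow> z \<in> S \<Longrightarrow> b \<in> Basis \<Longrightarrow> y + ((z - y) \<bullet> b) *\<^sub>R b \<in> S"
    and D: "\<And>b z. b \<in> Basis \<Longrightarrow> z \<in> S \<Longrightarrow>
      ((\<lambda>h. f (z + h *\<^sub>R b)) has_field_derivative D b z) (at 0 within {h. z + h *\<^sub>R b \<in> S})"
    and cont: "\<And>b. b \<in> Basis \<Longrightarrow> continuous_on S (D b)"
    and x: "x \<in> S"
  shows "(f has_derivative (\<lambda>h. \<Sum>b\<in>Basis. (h \<bullet> b) * D b x)) (at x within S)"
proof -
  have near: "\<exists>d>0. \<forall>y\<in>S. norm (y - x) < d \<longrightarrow> \<bar>D b y - D b x\<bar> \<le> e" 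
    if "e > 0" "b \<in> Basis" for e b
    using cont[OF that(2)] x that(1) unfolding continuous_on_iff dist_norm
    by (metis less_imp_le norm_conv_dist real_norm_def)
  have "\<exists>d>0. \<forall>y\<in>S. norm (y - x) < d \<longrightarrow>
      norm (f y - f x - (\<Sum>b\<in>Basis. ((y - x) \<bullet> b) * D b x)) \<le> e * norm (y - x)" if "e > 0" for e
  proof -
    \<comment> \<open>Each of the \<open>DIM('a)\<close> increments may contribute at most
      \<open>e'\<close> times \<open>norm (y - x)\<close>.\<close>
    define e' where "e' = e / DIM('a)"
    have e': "e' > 0" using that by (simp add: e'_def)
    obtain d where d: "\<And>b. b \<in> Basis \<Longrightarrow> d b > 0"
        "\<And>b y. b \<in> Basis \<Longrightarrow> y \<in> S \<Longrightarrow> norm (y - x) < d b \<Longrightarrow> \<bar>D b y - D b x\<bar> \<le> e'"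
      using near[OF e'] by metis
    \<comment> \<open>Intermediate points, and the segments between them, stay within the l1 norm of
      y - x from x, which is at most the dimension times the Euclidean norm.\<close>
    define r where "r = Min (d ` Basis) / DIM('a)"
    have r: "r > 0" unfolding r_def using d(1) by (simp add: divide_pos_pos)
    have "norm (f y - f x - (\<Sum>b\<in>Basis. ((y - x) \<bullet> b) * D b x)) \<le> e * norm (y - x)"
      if y: "y \<in> S" "norm (y - x) < r" for y
    proof -
      \<comment> \<open>\<open>Y B\<close> has the coordinates of y in the directions in
        \<open>B\<close> and those of x in the others.\<close>
      define Y where "Y B = x + (\<Sum>b\<in>B. ((y - x) \<bullet> b) *\<^sub>R b)" for B
      have Y_inner: "Y B \<bullet> b = x \<bullet> b" if "B \<subseteq> Basis" "b \<in> Basis" "b \<notin> B" for B b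
      proof -
        have "(\<Sum>c\<in>B. ((y - x) \<bullet> c) *\<^sub>R c) \<bullet> b = 0"
          unfolding inner_sum_left using that by (intro sum.neutral) (auto simp: inner_not_same_Basis subset_iff, metis inner_not_same_Basis)
        then show ?thesis by (simp add: Y_def inner_add_left)
      qed
      have Y_insert: "Y (insert b B) = Y B + ((y - x) \<bullet> b) *\<^sub>R b"
        if "b \<notin> B" "finite B" for b B
        using that by (simp add: Y_def algebra_simps)
      have "finite B \<Longrightarrow> B \<subseteq> Basis \<Longrightarrow> Y B \<in> S \<and>
          \<bar>f (Y B) - f x - (\<Sum>b\<in>B. ((y - x) \<bullet> b) * D b x)\<bar> \<le> (\<Sum>b\<in>B. e' * \<bar>(y - x) \<bullet> b\<bar>)" for B
      proof (induction rule: finite_induct)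
        case empty
        then show ?case using x by (simp add: Y_def)
      next
        case (insert b B)
        then have b: "b \<in> Basis" "B \<subseteq> Basis" by auto
        let ?d = "(y - x) \<bullet> b"
        have d_eq: "(y - Y B) \<bullet> b = ?d"
          using Y_inner[OF b(2,1)] insert by (simp add: inner_diff_left)
        have YB: "Y B \<in> S" using insert b by auto
        have Yi: "Y (insert b B) = Y B + ?d *\<^sub>R b" using insert Y_insert by auto
        have in_S: "Y B + ?d *\<^sub>R b \<in> S"
          using mix[OF YB y(1) b(1)] d_eq by simp
        have "\<bar>f (Y B + ?d *\<^sub>R b) - f (Y B) - ?d * D b x\<bar> \<le> e' * \<bar>?d\<bar>"
        proof (rule increment_bound_along_line[OF S YB in_S D[OF b(1)]])
          fix h assume h: "h \<in> closed_segment 0 ?d"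
          then obtain s where s: "0 \<le> s" "s \<le> 1" "h = s * ?d"
            by (auto simp: in_segment)
          have "Y B + h *\<^sub>R b = (1 - s) *\<^sub>R Y B + s *\<^sub>R (Y B + ?d *\<^sub>R b)"
            by (simp add: s algebra_simps)
          then have hS: "Y B + h *\<^sub>R b \<in> S"
            using S YB in_S s by (auto intro: convexD_alt)
          have h_le: "\<bar>h\<bar> \<le> \<bar>?d\<bar>" using s by (simp add: abs_mult mult_left_le_one_le)
          have "norm (Y B + h *\<^sub>R b - x) = norm ((\<Sum>c\<in>B. ((y - x) \<bullet> c) *\<^sub>R c) + h *\<^sub>R b)"
            by (simp add: Y_def)
          also have "\<dots> \<le> norm (\<Sum>c\<in>B. ((y - x) \<bullet> c) *\<^sub>R c) + norm (h *\<^sub>R b)"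
            by (rule norm_triangle_ineq)
          also have "\<dots> \<le> (\<Sum>c\<in>B. norm (((y - x) \<bullet> c) *\<^sub>R c)) + norm (h *\<^sub>R b)"
            by (intro add_mono norm_sum order_refl)
          also have "\<dots> \<le> (\<Sum>c\<in>B. \<bar>(y - x) \<bullet> c\<bar>) + \<bar>?d\<bar>"
            using b h_le by (intro add_mono sum_mono) (auto simp: norm_Basis subset_iff)
          also have "\<dots> = (\<Sum>c\<in>insert b B. \<bar>(y - x) \<bullet> c\<bar>)"
            using insert by simp
          also have "\<dots> \<le> (\<Sum>c\<in>Basis. \<bar>(y - x) \<bullet> c\<bar>)"
            using b by (intro sum_mono2) auto
          also have "\<dots> \<le> (\<Sum>c\<in>(Basis::'a set). norm (y - x))"
            by (intro sum_mono) (auto simp: Basis_le_norm)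
          also have "\<dots> = DIM('a) * norm (y - x)" by simp
          also have "\<dots> < DIM('a) * r" using y by (intro mult_strict_left_mono) auto
          also have "\<dots> = Min (d ` Basis)" by (simp add: r_def)
          also have "\<dots> \<le> d b" using b by simp
          finally show "\<bar>D b (Y B + h *\<^sub>R b) - D b x\<bar> \<le> e'"
            using d(2)[OF b(1) hS] by simp
        qed
        moreover have "\<bar>f (Y B) - f x - (\<Sum>b\<in>B. ((y - x) \<bullet> b) * D b x)\<bar> \<le> (\<Sum>b\<in>B. e' * \<bar>(y - x) \<bullet> b\<bar>)"
          using insert b by auto
        ultimately show ?case
          using in_S insert(1,2) unfolding Yi by simp
      qed
      from this[OF finite_Basis order_refl]
      have "\<bar>f (Y Basis) - f x - (\<Sum>b\<in>Basis. ((y - x) \<bullet> b) * D b x)\<bar> \<le> (\<Sum>b\<in>Basis. e' * \<bar>(y - x) \<bullet> b\<bar>)"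
        by auto
      also have "\<dots> \<le> (\<Sum>b\<in>(Basis::'a set). e' * norm (y - x))"
        using e' by (intro sum_mono mult_left_mono) (auto simp: Basis_le_norm)
      also have "\<dots> = e * norm (y - x)" by (simp add: e'_def)
      finally show ?thesis by (simp add: Y_def euclidean_representation)
    qed
    with r show ?thesis by blast
  qed
  moreover have "bounded_linear (\<lambda>h. \<Sum>b\<in>Basis. (h \<bullet> b) * D b x)"
    by (intro bounded_linear_sum bounded_linear_mult_const bounded_linear_inner_left)
  ultimately show ?thesis
    unfolding has_derivative_within_alt by blast
qed

subsection \<open>Integration by parts in one variable\<close>

text \<open>Completing the square, (|y| / 2 - K)^2 >= 0, at the cost of half the Gaussian exponent;
  what remains is a multiple of a normal density, hence integrable.\<close>

lemma exp_abs_times_gauss_le: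
  fixes K y :: real
  shows "exp (K * \<bar>y\<bar>) * exp (- y\<^sup>2 / 2) \<le> exp (K\<^sup>2) * exp (- y\<^sup>2 / 4)"
proof -
  have "0 \<le> (\<bar>y\<bar> / 2 - K)\<^sup>2" by simp
  then have "K * \<bar>y\<bar> + - y\<^sup>2 / 2 \<le> K\<^sup>2 + - y\<^sup>2 / 4"
    by (simp add: power2_eq_square algebra_simps)
  then show ?thesis by (simp flip: exp_add)
qed

text \<open>The same square with K + 1 in place of K leaves a spare factor exp (- |y|), used for
  limits at infinity.\<close>

lemma exp_abs_times_gauss_le_exp:
  fixes K y :: real
  shows "exp (K * \<bar>y\<bar>) * exp (- y\<^sup>2 / 2) \<le> exp ((K + 1)\<^sup>2) * exp (- \<bar>y\<bar>)"
proof -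
  have "0 \<le> (\<bar>y\<bar> / 2 - (K + 1))\<^sup>2" by simp
  then have "\<bar>y\<bar> + K * \<bar>y\<bar> \<le> (K + 1)\<^sup>2 + y\<^sup>2 / 4"
    by (simp add: power2_diff power_divide algebra_simps)
  moreover have "y\<^sup>2 / 4 \<le> y\<^sup>2 / 2" by simp
  ultimately have "K * \<bar>y\<bar> + - y\<^sup>2 / 2 \<le> (K + 1)\<^sup>2 + - \<bar>y\<bar>"
    by linarith
  then show ?thesis by (simp flip: exp_add)
qed

lemma integrable_exp_abs_times_gauss:
  "integrable lborel (\<lambda>y::real. exp (K * \<bar>y\<bar>) * exp (- y\<^sup>2 / 2))"
proof (rule Bochner_Integration.integrable_bound)
  have "integrable lborel (\<lambda>y. exp (K\<^sup>2) * sqrt (4 * pi) * normal_density 0 (sqrt 2) y)"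
    by (intro integrable_mult_right integrable_normal_density) simp
  then show "integrable lborel (\<lambda>y::real. exp (K\<^sup>2) * exp (- y\<^sup>2 / 4))"
    by (simp add: normal_density_def)
qed (use exp_abs_times_gauss_le in \<open>auto intro!: AE_I2\<close>)

lemma integrable_gauss_times:
  fixes f :: "real \<Rightarrow> real"
  assumes "f \<in> borel_measurable borel" and "\<And>y. \<bar>f y\<bar> \<le> C * exp (K * \<bar>y\<bar>)"
  shows "integrable lborel (\<lambda>y. f y * exp (- y\<^sup>2 / 2))"
proof (rule Bochner_Integration.integrable_bound)
  show "integrable lborel (\<lambda>y::real. C * (exp (K * \<bar>y\<bar>) * exp (- y\<^sup>2 / 2)))"
    by (intro integrable_mult_right integrable_exp_abs_times_gauss)
  show "AE y in lborel. norm (f y * exp (- y\<^sup>2 / 2)) \<le> norm (C * (exp (K * \<bar>y\<bar>) * exp (- y\<^sup>2 / 2)))"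
  proof (rule AE_I2)
    fix y
    have "norm (f y * exp (- y\<^sup>2 / 2)) = \<bar>f y\<bar> * exp (- y\<^sup>2 / 2)"
      by (simp add: abs_mult)
    also have "\<dots> \<le> (C * exp (K * \<bar>y\<bar>)) * exp (- y\<^sup>2 / 2)"
      using assms(2) by (intro mult_right_mono) auto
    also have "\<dots> \<le> norm (C * (exp (K * \<bar>y\<bar>) * exp (- y\<^sup>2 / 2)))"
      by (simp add: mult.assoc)
    finally show "norm (f y * exp (- y\<^sup>2 / 2)) \<le> norm (C * (exp (K * \<bar>y\<bar>) * exp (- y\<^sup>2 / 2)))" .
  qed
qed (use assms(1) in simp)

text \<open>The bound is required only eventually, so that functions controlled on a half-line are
  covered as well.\<close>

lemma gauss_times_tendsto_0:
  fixes f :: "real \<Rightarrow> real"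
  assumes bound: "eventually (\<lambda>y. \<bar>f y\<bar> \<le> C * exp (K * \<bar>y\<bar>)) F" and F: "F = at_top \<or> F = at_bot"
  shows "((\<lambda>y. f y * exp (- y\<^sup>2 / 2)) \<longlongrightarrow> 0) F"
proof (rule Lim_null_comparison)
  have "((\<lambda>y::real. exp (- \<bar>y\<bar>)) \<longlongrightarrow> 0) F"
    using F
  proof
    assume F: "F = at_top"
    have "((\<lambda>y::real. exp (- y)) \<longlongrightarrow> 0) at_top"
      by (rule filterlim_compose[OF exp_at_bot]) (simp add: filterlim_uminus_at_bot_at_top)
    then show ?thesis
      unfolding F by (rule Lim_transform_eventually)
        (auto intro!: eventually_mono[OF eventually_gt_at_top[of 0]])
  next
    assume F: "F = at_bot"
    show ?thesis
      unfolding F using exp_at_bot by (rule Lim_transform_eventually)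
        (auto intro!: eventually_mono[OF eventually_le_at_bot[of 0]])
  qed
  then show "((\<lambda>y::real. \<bar>C\<bar> * (exp ((K + 1)\<^sup>2) * exp (- \<bar>y\<bar>))) \<longlongrightarrow> 0) F"
    by (intro tendsto_mult_right_zero)
  show "\<forall>\<^sub>F y in F. norm (f y * exp (- y\<^sup>2 / 2)) \<le> \<bar>C\<bar> * (exp ((K + 1)\<^sup>2) * exp (- \<bar>y\<bar>))"
    using bound
  proof eventually_elim
    fix y assume "\<bar>f y\<bar> \<le> C * exp (K * \<bar>y\<bar>)"
    also have "\<dots> \<le> \<bar>C\<bar> * exp (K * \<bar>y\<bar>)"
      by (intro mult_right_mono) auto
    finally have "\<bar>f y\<bar> * exp (- y\<^sup>2 / 2) \<le> \<bar>C\<bar> * exp (K * \<bar>y\<bar>) * exp (- y\<^sup>2 / 2)"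
      by (intro mult_right_mono) auto
    also have "\<dots> \<le> \<bar>C\<bar> * (exp ((K + 1)\<^sup>2) * exp (- \<bar>y\<bar>))"
      unfolding mult.assoc by (intro mult_left_mono exp_abs_times_gauss_le_exp) auto
    finally show "norm (f y * exp (- y\<^sup>2 / 2)) \<le> \<bar>C\<bar> * (exp ((K + 1)\<^sup>2) * exp (- \<bar>y\<bar>))"
      by (simp add: abs_mult)
  qed
qed

text \<open>Since |y| <= exp |y|, a factor y raises the exponential rate by one.\<close>

lemma abs_times_exp_le:
  fixes K y :: real
  assumes "\<bar>a\<bar> \<le> C * exp (K * \<bar>y\<bar>)"
  shows "\<bar>y * a\<bar> \<le> C * exp ((K + 1) * \<bar>y\<bar>)"
proof -
  have "\<bar>y\<bar> \<le> exp \<bar>y\<bar>" using exp_ge_add_one_self[of "\<bar>y\<bar>"] by linarith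
  then have "\<bar>y\<bar> * \<bar>a\<bar> \<le> exp \<bar>y\<bar> * (C * exp (K * \<bar>y\<bar>))"
    by (intro mult_mono assms) auto
  also have "\<dots> = C * exp ((K + 1) * \<bar>y\<bar>)"
    by (simp add: distrib_right exp_add)
  finally show ?thesis by (simp add: abs_mult)
qed

lemma exp_growth_mono:
  fixes K L y :: real
  assumes "\<bar>a\<bar> \<le> C * exp (K * \<bar>y\<bar>)" "K \<le> L"
  shows "\<bar>a\<bar> \<le> C * exp (L * \<bar>y\<bar>)"
proof -
  have "C * exp (K * \<bar>y\<bar>) \<ge> 0" using assms(1) abs_ge_zero order_trans by blast
  then have "C \<ge> 0" by (simp add: zero_le_mult_iff)
  then have "C * exp (K * \<bar>y\<bar>) \<le> C * exp (L * \<bar>y\<bar>)"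
    using assms(2) by (intro mult_left_mono) (auto intro: mult_right_mono)
  with assms(1) show ?thesis by simp
qed

text \<open>Stein's identity: up to normalization, - v(y) exp (- y^2 / 2) is an antiderivative of
  the integrand, and it vanishes at both ends.\<close>

lemma gaussian_integration_by_parts:
  fixes v v' :: "real \<Rightarrow> real"
  assumes v: "\<And>y. (v has_real_derivative v' y) (at y)"
    and v': "continuous_on UNIV v'"
    and bounds: "\<And>y. \<bar>v y\<bar> \<le> C * exp (K * \<bar>y\<bar>)" "\<And>y. \<bar>v' y\<bar> \<le> C * exp (K * \<bar>y\<bar>)"
  shows "(\<integral>y. std_normal_density y * (y * v y - v' y) \<partial>lborel) = 0"
proof -
  have cont: "continuous_on UNIV v"
    using v by (auto intro!: DERIV_continuous_on)
  have m[measurable]: "v \<in> borel_measurable borel" "v' \<in> borel_measurable borel"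
    using v' cont by (auto intro: borel_measurable_continuous_onI)
  let ?f = "\<lambda>y. (y * v y - v' y) * exp (- y\<^sup>2 / 2)"
  have int: "integrable lborel ?f"
  proof (rule integrable_gauss_times)
    fix y
    show "\<bar>y * v y - v' y\<bar> \<le> (2 * C) * exp ((K + 1) * \<bar>y\<bar>)"
      using abs_times_exp_le[OF bounds(1)[of y]] exp_growth_mono[OF bounds(2)[of y], of "K + 1"]
      by (simp add: abs_le_iff)
  qed simp
  have "(LBINT y=-\<infinity>..\<infinity>. ?f y) = 0 - 0"
  proof (rule interval_integral_FTC_integrable[where F = "\<lambda>y. - v y * exp (- y\<^sup>2 / 2)"])
    show "((\<lambda>y. - v y * exp (- y\<^sup>2 / 2)) has_vector_derivative ?f y) (at y)" for y
      unfolding has_real_derivative_iff_has_vector_derivative[symmetric]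
      by (auto intro!: derivative_eq_intros v simp: algebra_simps)
    show "isCont ?f y" for y
      using cont v' by (auto intro!: continuous_intros simp: continuous_on_eq_continuous_at)
    show "set_integrable lborel (einterval (-\<infinity>) \<infinity>) ?f"
      using int by (simp add: set_integrable_def)
    show "(((\<lambda>y. - v y * exp (- y\<^sup>2 / 2)) \<circ> real_of_ereal) \<longlongrightarrow> 0) (at_right (-\<infinity>))"
      unfolding ereal_tendsto_simps
      by (rule gauss_times_tendsto_0[where C = C and K = K]) (use bounds in \<open>auto intro!: always_eventually\<close>)
    show "(((\<lambda>y. - v y * exp (- y\<^sup>2 / 2)) \<circ> real_of_ereal) \<longlongrightarrow> 0) (at_left \<infinity>)"
      unfolding ereal_tendsto_simps
      by (rule gauss_times_tendsto_0[where C = C and K = K]) (use bounds in \<open>auto intro!: always_eventually\<close>)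
  qed simp
  then have "(\<integral>y. ?f y \<partial>lborel) = 0"
    by (simp add: interval_lebesgue_integral_def set_lebesgue_integral_def)
  moreover have "(\<lambda>y. std_normal_density y * (y * v y - v' y)) = (\<lambda>y. 1 / sqrt (2 * pi) * ?f y)"
    by (simp add: std_normal_density_def fun_eq_iff)
  ultimately show ?thesis by (simp only: integral_mult_right_zero mult_zero_right)
qed

text \<open>The antiderivative is (v - y v') exp (- y^2 / 2). It vanishes at infinity, and its value
  v(0) at the origin is what brings boundary values into the argument. Derivatives are asked for
  only at y > 0; continuity supplies the limit at 0.\<close>

lemma rayleigh_integration_by_parts:
  fixes v v1 v2 :: "real \<Rightarrow> real"
  assumes v: "\<And>y. y > 0 \<Longrightarrow> (v has_real_derivative v1 y) (at y)"
    and v1: "\<And>y. y > 0 \<Longrightarrow> (v1 has_real_derivative v2 y) (at y)"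
    and cont: "continuous_on {0..} v" "continuous_on {0..} v1" "continuous_on {0..} v2"
    and bounds: "\<And>y. y \<ge> 0 \<Longrightarrow> \<bar>v y\<bar> \<le> C * exp (K * \<bar>y\<bar>)" "\<And>y. y \<ge> 0 \<Longrightarrow> \<bar>v1 y\<bar> \<le> C * exp (K * \<bar>y\<bar>)"
      "\<And>y. y \<ge> 0 \<Longrightarrow> \<bar>v2 y\<bar> \<le> C * exp (K * \<bar>y\<bar>)"
  shows "(\<integral>y. (indicator {0<..} y * (y * exp (- y\<^sup>2 / 2))) * (y * v1 y - v2 y - v y) \<partial>lborel) = - v 0"
proof -
  let ?f = "\<lambda>y. (y * (y * v1 y - v2 y - v y)) * exp (- y\<^sup>2 / 2)"
  let ?F = "\<lambda>y. (v y - y * v1 y) * exp (- y\<^sup>2 / 2)"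
  have C0: "C \<ge> 0" using bounds(1)[of 0] by auto
  have int: "integrable lborel (\<lambda>y. (indicator {0<..} y * (y * (y * v1 y - v2 y - v y))) * exp (- y\<^sup>2 / 2))"
  proof (rule integrable_gauss_times)
    fix y :: real
    have "\<bar>y * (y * v1 y - v2 y - v y)\<bar> \<le> (3 * C) * exp ((K + 1 + 1) * \<bar>y\<bar>)" if y: "y > 0"
      using abs_times_exp_le[OF bounds(2)[of y]] exp_growth_mono[OF bounds(1)[of y], of "K + 1"] 
        exp_growth_mono[OF bounds(3)[of y], of "K + 1"] y
      by (intro abs_times_exp_le) (simp add: abs_le_iff)
    then show "\<bar>indicator {0<..} y * (y * (y * v1 y - v2 y - v y))\<bar> \<le> (3 * C) * exp ((K + 1 + 1) * \<bar>y\<bar>)"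
      using C0 by (auto simp: indicator_def)
    \<comment> \<open>Continuity is given on the closed half-line only, so measurability is obtained
      there and then cut down to y > 0.\<close>
    have "(\<lambda>y. indicator {0..} y *\<^sub>R (y * (y * v1 y - v2 y - v y))) \<in> borel_measurable borel"
      using cont by (intro borel_measurable_continuous_on_indicator continuous_intros) auto
    then have "(\<lambda>y. indicator {0<..} y * (indicator {0..} y *\<^sub>R (y * (y * v1 y - v2 y - v y)))) \<in> borel_measurable borel"
      by measurable
    then show "(\<lambda>y. indicator {0<..} y * (y * (y * v1 y - v2 y - v y))) \<in> borel_measurable borel"
      by (rule measurable_cong[THEN iffD1, rotated]) (auto simp: indicator_def)
  qed
  have "(LBINT y=ereal 0..\<infinity>. ?f y) = 0 - v 0"
  proof (rule interval_integral_FTC_integrable[where F = ?F])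
    show "(?F has_vector_derivative ?f y) (at y)" if "ereal 0 < ereal y" for y
      unfolding has_real_derivative_iff_has_vector_derivative[symmetric] using that
      by (auto intro!: derivative_eq_intros v v1 simp: algebra_simps)
    have c: "isCont v y" "isCont v1 y" "isCont v2 y" if "0 < y" for y
      using cont that by (auto intro!: continuous_on_interior)
    show "isCont ?f y" if "ereal 0 < ereal y" for y
      using c[of y] that by (auto intro!: continuous_intros)
    show "set_integrable lborel (einterval (ereal 0) \<infinity>) ?f"
      using int by (simp add: set_integrable_def mult.assoc)
    have "continuous_on {0..} ?F"
      using cont by (intro continuous_intros) auto
    then have "(?F \<longlongrightarrow> ?F 0) (at 0 within {0..})"
      unfolding continuous_on_def by blast
    then show "((?F \<circ> real_of_ereal) \<longlongrightarrow> v 0) (at_right (ereal 0))"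
      unfolding ereal_tendsto_simps by (simp add: at_within_Ici_at_right)
    show "((?F \<circ> real_of_ereal) \<longlongrightarrow> 0) (at_left \<infinity>)"
      unfolding ereal_tendsto_simps
    proof (rule gauss_times_tendsto_0)
      show "\<forall>\<^sub>F y in at_top. \<bar>v y - y * v1 y\<bar> \<le> (2 * C) * exp ((K + 1) * \<bar>y\<bar>)"
        using eventually_ge_at_top[of 0]
      proof eventually_elim
        case (elim y)
        then show ?case
          using abs_times_exp_le[OF bounds(2)[of y]] exp_growth_mono[OF bounds(1)[of y], of "K + 1"]
          by (simp add: abs_le_iff)
      qed
    qed simp
  qed simp
  then have "(LBINT y:{0<..}. ?f y) = - v 0"
    by (simp add: interval_integral_to_infinity_eq)
  then show ?thesis
    by (simp add: set_lebesgue_integral_def mult_ac)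
qed

subsection \<open>The sample space\<close>

text \<open>The last coordinate is Rayleigh distributed because, at time \<open>\<tau>\<close>, the normal derivative of the
  Dirichlet heat kernel of the half-line is \<open>1 / sqrt (pi * \<tau>)\<close> times the density of \<open>sqrt (2 * \<tau>)\<close>
  times a Rayleigh variable.\<close>

definition coord_density :: "'n::{finite,linorder} \<Rightarrow> real \<Rightarrow> real" where
  "coord_density i y =
    (if i = last_idx then indicator {0<..} y * (y * exp (- y\<^sup>2 / 2)) else std_normal_density y)"

definition coord_measure :: "'n::{finite,linorder} \<Rightarrow> real measure" where
  "coord_measure i = density lborel (\<lambda>y. ennreal (coord_density i y))"

definition sample :: "('n::{finite,linorder} \<Rightarrow> real) measure" where
  "sample = Pi\<^sub>M UNIV coord_measure"

lemma coord_density_nonneg: "0 \<le> coord_density i y"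
  by (auto simp: coord_density_def indicator_def)

lemma borel_measurable_coord_density[measurable]: "coord_density i \<in> borel_measurable borel"
  unfolding coord_density_def by measurable

lemma sets_coord_measure[measurable_cong, simp]: "sets (coord_measure i) = sets borel"
  by (simp add: coord_measure_def)

lemma space_coord_measure[simp]: "space (coord_measure i) = UNIV"
  by (simp add: coord_measure_def)

lemma integral_coord_measure:
  fixes f :: "real \<Rightarrow> real"
  assumes [measurable]: "f \<in> borel_measurable borel"
  shows "(\<integral>y. f y \<partial>coord_measure i) = (\<integral>y. coord_density i y * f y \<partial>lborel)"
  unfolding coord_measure_def by (subst integral_density) (auto simp: coord_density_nonneg)

lemma integrable_coord_measure:
  fixes f :: "real \<Rightarrow> real"
  assumes [measurable]: "f \<in> borel_measurable borel"
  shows "integrable (coord_measure i) f \<longleftrightarrow> integrable lborel (\<lambda>y. coord_density i y * f y)"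
  unfolding coord_measure_def by (subst integrable_density) (auto simp: coord_density_nonneg)

text \<open>Finite exponential moments of every rate are what makes exponential growth of u
  compatible with taking expectations.\<close>

lemma integrable_exp_abs_coord: "integrable (coord_measure i) (\<lambda>y. exp (K * \<bar>y\<bar>))"
proof (subst integrable_coord_measure)
  show "integrable lborel (\<lambda>y. coord_density i y * exp (K * \<bar>y\<bar>))"
  proof (cases "i = last_idx")
    case True
    have "integrable lborel (\<lambda>y. (indicator {0<..} y * (y * exp (K * \<bar>y\<bar>))) * exp (- y\<^sup>2 / 2))"
    proof (rule integrable_gauss_times)
      fix y :: real
      have "\<bar>y * exp (K * \<bar>y\<bar>)\<bar> \<le> 1 * exp ((K + 1) * \<bar>y\<bar>)"
        by (rule abs_times_exp_le) simp
      then show "\<bar>indicator {0<..} y * (y * exp (K * \<bar>y\<bar>))\<bar> \<le> 1 * exp ((K + 1) * \<bar>y\<bar>)"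
        by (auto simp: indicator_def)
    qed simp
    then show ?thesis
      using True by (simp add: coord_density_def mult_ac)
  next
    case False
    have "integrable lborel (\<lambda>y. 1 / sqrt (2 * pi) * (exp (K * \<bar>y\<bar>) * exp (- y\<^sup>2 / 2)))"
      by (intro integrable_mult_right integrable_exp_abs_times_gauss)
    then show ?thesis
      using False by (simp add: coord_density_def std_normal_density_def mult_ac)
  qed
qed simp

lemma prob_space_coord_measure: "prob_space (coord_measure i)"
proof (cases "i = last_idx")
  case True
  \<comment> \<open>For v = 1 the integration by parts formula computes minus the total
    mass.\<close>
  have "(\<integral>y. (indicator {0<..} y * (y * exp (- y\<^sup>2 / 2))) * (y * 0 - 0 - 1) \<partial>lborel) = - (1::real)"
    by (rule rayleigh_integration_by_parts[where C = 1 and K = 0]) auto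
  then have "(\<integral>y. coord_density i y \<partial>lborel) = 1"
    using True by (simp add: coord_density_def)
  moreover have "integrable lborel (coord_density i)"
    using integrable_exp_abs_coord[of i 0] by (simp add: integrable_coord_measure)
  ultimately show ?thesis
    by (intro prob_spaceI)
       (simp add: coord_measure_def emeasure_density nn_integral_eq_integral coord_density_nonneg)
next
  case False
  then show ?thesis
    using prob_space_normal_density[of 1 0] by (simp add: coord_measure_def coord_density_def)
qed

text \<open>On the half-line, y times the Rayleigh density is sqrt (2 pi) times y^2 times the
  standard normal density, and by symmetry half of the unit variance comes from there.\<close>

lemma integral_abs_last_coord: "(\<integral>y. \<bar>y\<bar> \<partial>coord_measure last_idx) = sqrt (pi / 2)"
proof -
  have sq: "has_bochner_integral lborel (\<lambda>y. std_normal_density y * y\<^sup>2) 1"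
    using std_normal_moment_even[of 1] by simp
  define c where "c = (\<integral>y. indicator {0..} y *\<^sub>R (std_normal_density y * y\<^sup>2) \<partial>lborel)"
  have "integrable lborel (\<lambda>y. indicator {0..} y *\<^sub>R (std_normal_density y * y\<^sup>2))"
    using sq by (intro integrable_mult_indicator) (auto simp: has_bochner_integral_iff)
  then have "has_bochner_integral lborel (\<lambda>y. indicator {0..} y *\<^sub>R (std_normal_density y * y\<^sup>2)) c"
    by (simp add: has_bochner_integral_iff c_def)
  then have "has_bochner_integral lborel (\<lambda>y. std_normal_density y * y\<^sup>2) (2 * c)"
    using has_bochner_integral_even_function[of "\<lambda>y. std_normal_density y * y\<^sup>2" c]
    by (simp add: std_normal_density_def)
  then have c: "c = 1 / 2"
    using sq by (auto dest: has_bochner_integral_eq)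
  have "(\<integral>y. \<bar>y\<bar> \<partial>coord_measure last_idx) =
      (\<integral>y. sqrt (2 * pi) * (indicator {0..} y *\<^sub>R (std_normal_density y * y\<^sup>2)) \<partial>lborel)"
    by (subst integral_coord_measure)
       (auto intro!: Bochner_Integration.integral_cong
         simp: coord_density_def std_normal_density_def indicator_def power2_eq_square)
  also have "\<dots> = sqrt (2 * pi) / 2"
    using c by (simp add: c_def)
  also have "\<dots> = sqrt (pi / 2)"
    by (simp add: real_sqrt_mult real_sqrt_divide field_simps)
  finally show ?thesis .
qed

lemma coord_integration_by_parts:
  fixes v v' :: "real \<Rightarrow> real"
  assumes "i \<noteq> last_idx"
    and v: "\<And>y. (v has_real_derivative v' y) (at y)"
    and v': "continuous_on UNIV v'"
    and bounds: "\<And>y. \<bar>v y\<bar> \<le> C * exp (K * \<bar>y\<bar>)" "\<And>y. \<bar>v' y\<bar> \<le> C * exp (K * \<bar>y\<bar>)"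
  shows "(\<integral>y. (y * v y - v' y) \<partial>coord_measure i) = 0"
proof -
  have "continuous_on UNIV v"
    using v by (auto intro!: DERIV_continuous_on)
  then have [measurable]: "v \<in> borel_measurable borel" "v' \<in> borel_measurable borel"
    using v' by (auto intro: borel_measurable_continuous_onI)
  show ?thesis
    using gaussian_integration_by_parts[OF v v' bounds] assms(1)
    by (simp add: integral_coord_measure coord_density_def)
qed

text \<open>The absolute values match those in \<open>half_pt\<close>; composing with them gives
  functions that are continuous on the whole line, hence measurable.\<close>

lemma last_coord_integration_by_parts:
  fixes v v1 v2 :: "real \<Rightarrow> real"
  assumes v: "\<And>y. y > 0 \<Longrightarrow> (v has_real_derivative v1 y) (at y)"
    and v1: "\<And>y. y > 0 \<Longrightarrow> (v1 has_real_derivative v2 y) (at y)"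
    and cont: "continuous_on {0..} v" "continuous_on {0..} v1" "continuous_on {0..} v2"
    and bounds: "\<And>y. y \<ge> 0 \<Longrightarrow> \<bar>v y\<bar> \<le> C * exp (K * \<bar>y\<bar>)" "\<And>y. y \<ge> 0 \<Longrightarrow> \<bar>v1 y\<bar> \<le> C * exp (K * \<bar>y\<bar>)"
      "\<And>y. y \<ge> 0 \<Longrightarrow> \<bar>v2 y\<bar> \<le> C * exp (K * \<bar>y\<bar>)"
  shows "(\<integral>y. (\<bar>y\<bar> * v1 \<bar>y\<bar> - v2 \<bar>y\<bar> - v \<bar>y\<bar>) \<partial>coord_measure last_idx) = - v 0"
proof -
  have [measurable]: "(\<lambda>y. w \<bar>y\<bar>) \<in> borel_measurable borel" if "continuous_on {0..} w" for w :: "real \<Rightarrow> real"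
    by (rule borel_measurable_continuous_onI, rule continuous_on_compose2[OF that])
       (auto intro!: continuous_intros)
  note [measurable] = this[OF cont(1)] this[OF cont(2)] this[OF cont(3)]
  have "(\<integral>y. (\<bar>y\<bar> * v1 \<bar>y\<bar> - v2 \<bar>y\<bar> - v \<bar>y\<bar>) \<partial>coord_measure last_idx) =
     (\<integral>y. (indicator {0<..} y * (y * exp (- y\<^sup>2 / 2))) * (y * v1 y - v2 y - v y) \<partial>lborel)"
    by (subst integral_coord_measure)
       (auto intro!: Bochner_Integration.integral_cong simp: coord_density_def indicator_def)
  also have "\<dots> = - v 0"
    by (rule rayleigh_integration_by_parts[OF v v1 cont bounds])
  finally show ?thesis .
qed

section \<open>Product structure of the sample space and integrable majorants on it\<close>

interpretation coord: product_prob_space coord_measure UNIV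
  by (simp add: product_prob_space_def product_prob_space_axioms_def product_sigma_finite_def
        prob_space_coord_measure prob_space_imp_sigma_finite)

lemma prob_space_sample: "prob_space sample"
  unfolding sample_def by (rule coord.P.prob_space_axioms)

lemma measurable_sample_coord[measurable]: "(\<lambda>\<omega>. \<omega> i) \<in> borel_measurable sample"
  unfolding sample_def using measurable_component_singleton[of i UNIV coord_measure]
  by (simp cong: measurable_cong_sets)

lemma space_sample[simp]: "space sample = UNIV"
  by (simp add: sample_def space_PiM)

text \<open>Fubini with coordinate i innermost: the one-dimensional integration by parts formulas
  then apply with the other coordinates frozen.\<close>

lemma integral_sample_coord:
  fixes f :: "('n::{finite,linorder} \<Rightarrow> real) \<Rightarrow> real"
  assumes "integrable sample f"
  shows "integral\<^sup>L sample f =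
    (\<integral>\<omega>. (\<integral>y. f (fun_upd \<omega> i y) \<partial>coord_measure i) \<partial>Pi\<^sub>M (UNIV - {i}) coord_measure)"
proof -
  have i: "insert i (UNIV - {i}) = UNIV" by auto
  show ?thesis
    using coord.product_integral_insert[of "UNIV - {i}" i f] assms unfolding sample_def i by simp
qed

text \<open>As a product it is integrable by independence; as the exponential of an l1 norm it
  dominates, for K >= 0, the exponential of K times the norm of \<open>half_pt\<close> and of
  \<open>bdry_pt\<close>. The majorants on the sample space are multiples of such weights.\<close>

definition weight :: "real \<Rightarrow> ('n::finite \<Rightarrow> real) \<Rightarrow> real" where
  "weight K \<omega> = (\<Prod>i\<in>UNIV. exp (K * \<bar>\<omega> i\<bar>))"

lemma weight_eq_exp: "weight K \<omega> = exp (K * (\<Sum>i\<in>UNIV. \<bar>\<omega> i\<bar>))"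
  by (simp add: weight_def exp_sum sum_distrib_left)

lemma integrable_weight: "integrable sample (weight K)"
  unfolding sample_def weight_def
  by (rule coord.product_integrable_prod) (auto intro: integrable_exp_abs_coord)

lemma weight_pos: "weight K \<omega> > 0"
  by (simp add: weight_eq_exp)

lemma weight_mono: "K \<le> L \<Longrightarrow> weight K \<omega> \<le> weight L \<omega>"
  by (auto simp: weight_eq_exp intro!: mult_right_mono sum_nonneg)

lemma weight_mult: "weight K \<omega> * weight L \<omega> = weight (K + L) \<omega>"
  by (simp add: weight_eq_exp distrib_right exp_add)

lemma abs_coord_le_weight: "\<bar>\<omega> i\<bar> \<le> weight 1 \<omega>"
proof -
  have "\<bar>\<omega> i\<bar> \<le> (\<Sum>i\<in>UNIV. \<bar>\<omega> i\<bar>)" by (rule member_le_sum) auto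
  also have "\<dots> \<le> weight 1 \<omega>"
    using exp_ge_add_one_self[of "\<Sum>i\<in>UNIV. \<bar>\<omega> i\<bar>"] unfolding weight_eq_exp mult_1 by linarith
  finally show ?thesis .
qed

text \<open>The last coordinate is positive almost surely; the absolute value makes \<open>half_pt \<omega>\<close> lie in the
  half-space for every \<open>\<omega>\<close>.\<close>

definition half_pt :: "('n::{finite,linorder} \<Rightarrow> real) \<Rightarrow> real ^ 'n::{finite,linorder}" where
  "half_pt \<omega> = (\<chi> i. if i = last_idx then \<bar>\<omega> i\<bar> else \<omega> i)"

definition bdry_pt :: "('n::{finite,linorder} \<Rightarrow> real) \<Rightarrow> real ^ 'n::{finite,linorder}" where
  "bdry_pt \<omega> = (\<chi> i. if i = last_idx then 0 else \<omega> i)"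

lemma borel_measurable_vec_lambda:
  assumes "\<And>i. (\<lambda>x. f x i) \<in> borel_measurable M"
  shows "(\<lambda>x. (\<chi> i. f x i) :: real ^ 'n) \<in> borel_measurable M"
  by (subst borel_measurable_euclidean_space) (auto simp: Basis_vec_def inner_axis assms)

lemma measurable_half_pt[measurable]: "half_pt \<in> borel_measurable sample"
  unfolding half_pt_def by (rule borel_measurable_vec_lambda) simp

lemma measurable_bdry_pt[measurable]: "bdry_pt \<in> borel_measurable sample"
  unfolding bdry_pt_def by (rule borel_measurable_vec_lambda) simp

lemma norm_half_pt_le: "norm (half_pt \<omega>) \<le> (\<Sum>i\<in>UNIV. \<bar>\<omega> i\<bar>)"
  by (rule order_trans[OF norm_le_l1_cart]) (auto intro!: sum_mono simp: half_pt_def)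

lemma norm_bdry_pt_le: "norm (bdry_pt \<omega>) \<le> (\<Sum>i\<in>UNIV. \<bar>\<omega> i\<bar>)"
  by (rule order_trans[OF norm_le_l1_cart]) (auto intro!: sum_mono simp: bdry_pt_def)

subsection \<open>The heat kernel on the boundary\<close>

text \<open>Rectangles determine a product measure, and on a rectangle both the density and the
  indicator factor into functions of single coordinates.\<close>

lemma PiM_normal_eq_density:
  fixes x :: "real ^ 'n::{finite,linorder}"
  assumes "a > 0"
  shows "Pi\<^sub>M I (\<lambda>i. density lborel (normal_density (x $ i) a)) =
    density (Pi\<^sub>M I (\<lambda>i. lborel)) (\<lambda>w. ennreal (\<Prod>i\<in>I. normal_density (x $ i) a (w i)))"
proof (rule sym, rule product_sigma_finite.PiM_eqI)
  show "product_sigma_finite (\<lambda>i. density lborel (normal_density (x $ i) a))"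
    using assms by (simp add: product_sigma_finite_def prob_space_normal_density prob_space_imp_sigma_finite)
  show "sets (density (Pi\<^sub>M I (\<lambda>i. lborel)) (\<lambda>w. ennreal (\<Prod>i\<in>I. normal_density (x $ i) a (w i)))) =
    sets (Pi\<^sub>M I (\<lambda>i. density lborel (normal_density (x $ i) a)))"
    by (simp cong: sets_PiM_cong)
  fix A assume A: "\<And>i. i \<in> I \<Longrightarrow> A i \<in> sets (density lborel (normal_density (x $ i) a))"
  then have A'[measurable]: "\<And>i. i \<in> I \<Longrightarrow> A i \<in> sets lborel" by simp
  have "emeasure (density (Pi\<^sub>M I (\<lambda>i. lborel)) (\<lambda>w. ennreal (\<Prod>i\<in>I. normal_density (x $ i) a (w i)))) (Pi\<^sub>E I A)
     = (\<integral>\<^sup>+w. ennreal (\<Prod>i\<in>I. normal_density (x $ i) a (w i)) * indicator (Pi\<^sub>E I A) w \<partial>Pi\<^sub>M I (\<lambda>i. lborel))"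
    by (rule emeasure_density)
       (auto intro!: sets_PiM_I_finite measurable_compose[OF _ measurable_ennreal] borel_measurable_prod
         intro: measurable_compose[OF measurable_component_singleton])
  also have "\<dots> = (\<integral>\<^sup>+w. (\<Prod>i\<in>I. ennreal (normal_density (x $ i) a (w i)) * indicator (A i) (w i)) \<partial>Pi\<^sub>M I (\<lambda>i. lborel))"
  proof (rule nn_integral_cong)
    fix w assume "w \<in> space (Pi\<^sub>M I (\<lambda>i. lborel :: real measure))"
    then have "(indicator (Pi\<^sub>E I A) w :: ennreal) = (\<Prod>i\<in>I. indicator (A i) (w i))"
      by (auto simp: indicator_def space_PiM PiE_def extensional_def Pi_def prod.If_cases
          intro: prod.neutral prod_zero split: if_splits)
    then show "ennreal (\<Prod>i\<in>I. normal_density (x $ i) a (w i)) * indicator (Pi\<^sub>E I A) w =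
      (\<Prod>i\<in>I. ennreal (normal_density (x $ i) a (w i)) * indicator (A i) (w i))"
      by (simp add: prod.distrib prod_ennreal)
  qed
  also have "\<dots> = (\<Prod>i\<in>I. \<integral>\<^sup>+y. ennreal (normal_density (x $ i) a y) * indicator (A i) y \<partial>lborel)"
    by (rule product_sigma_finite.product_nn_integral_prod)
       (auto simp: product_sigma_finite_def sigma_finite_lborel)
  also have "\<dots> = (\<Prod>i\<in>I. emeasure (density lborel (normal_density (x $ i) a)) (A i))"
    using A' by (intro prod.cong refl emeasure_density[symmetric]) auto
  finally show "emeasure (density (Pi\<^sub>M I (\<lambda>i. lborel)) (\<lambda>w. ennreal (\<Prod>i\<in>I. normal_density (x $ i) a (w i)))) (Pi\<^sub>E I A) =
    (\<Prod>i\<in>I. emeasure (density lborel (normal_density (x $ i) a)) (A i))" .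
qed simp

lemma distr_affine_std_normal:
  assumes "a > 0"
  shows "distr (density lborel std_normal_density) borel (\<lambda>y. m + a * y) = density lborel (normal_density m a)"
proof -
  interpret prob_space "density lborel (\<lambda>y. ennreal (std_normal_density y))"
    by (rule prob_space_normal_density) simp
  have "distributed (density lborel std_normal_density) lborel (\<lambda>y. y) std_normal_density"
    by (auto simp: distributed_def distr_id2)
  from normal_density_affine[OF this, of a m] assms show ?thesis
    by (auto simp: distributed_def cong: distr_cong)
qed

text \<open>The preimage of a rectangle under a coordinatewise map is a rectangle.
  \<open>last_idx\<close> is excluded because its coordinate is Rayleigh, not normal.\<close>

lemma distr_affine_coord:
  fixes x :: "real ^ 'n::{finite,linorder}"
  assumes "a > 0" and I: "last_idx \<notin> I"
  shows "distr (Pi\<^sub>M I coord_measure) (Pi\<^sub>M I (\<lambda>i. lborel)) (\<lambda>\<omega>. \<lambda>i\<in>I. x $ i + a * \<omega> i) =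
    Pi\<^sub>M I (\<lambda>i. density lborel (normal_density (x $ i) a))"
proof (rule product_sigma_finite.PiM_eqI)
  show "product_sigma_finite (\<lambda>i. density lborel (normal_density (x $ i) a))"
    using assms by (simp add: product_sigma_finite_def prob_space_normal_density prob_space_imp_sigma_finite)
  show "sets (distr (Pi\<^sub>M I coord_measure) (Pi\<^sub>M I (\<lambda>i. lborel)) (\<lambda>\<omega>. \<lambda>i\<in>I. x $ i + a * \<omega> i)) =
    sets (Pi\<^sub>M I (\<lambda>i. density lborel (normal_density (x $ i) a)))"
    by (simp cong: sets_PiM_cong)
  fix A assume "\<And>i. i \<in> I \<Longrightarrow> A i \<in> sets (density lborel (normal_density (x $ i) a))"
  then have A[measurable]: "\<And>i. i \<in> I \<Longrightarrow> A i \<in> sets borel" by simp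
  have "emeasure (distr (Pi\<^sub>M I coord_measure) (Pi\<^sub>M I (\<lambda>i. lborel)) (\<lambda>\<omega>. \<lambda>i\<in>I. x $ i + a * \<omega> i)) (Pi\<^sub>E I A)
     = emeasure (Pi\<^sub>M I coord_measure)
         ((\<lambda>\<omega>. \<lambda>i\<in>I. x $ i + a * \<omega> i) -` (Pi\<^sub>E I A) \<inter> space (Pi\<^sub>M I coord_measure))"
    by (rule emeasure_distr) (auto intro!: sets_PiM_I_finite measurable_restrict measurable_compose[OF measurable_component_singleton])
  also have "(\<lambda>\<omega>. \<lambda>i\<in>I. x $ i + a * \<omega> i) -` (Pi\<^sub>E I A) \<inter> space (Pi\<^sub>M I coord_measure) =
      Pi\<^sub>E I (\<lambda>i. (\<lambda>y. x $ i + a * y) -` A i)"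
    by (auto simp: space_PiM PiE_def Pi_def)
  also have "emeasure (Pi\<^sub>M I coord_measure) \<dots> =
      (\<Prod>i\<in>I. emeasure (coord_measure i) ((\<lambda>y. x $ i + a * y) -` A i))"
    by (rule coord.emeasure_PiM) (auto intro: measurable_sets_borel[OF _ A])
  also have "\<dots> = (\<Prod>i\<in>I. emeasure (density lborel (normal_density (x $ i) a)) (A i))"
  proof (intro prod.cong refl)
    fix i assume i: "i \<in> I"
    with I have "i \<noteq> last_idx" by auto
    then have "coord_measure i = density lborel std_normal_density"
      by (simp add: coord_measure_def coord_density_def)
    then show "emeasure (coord_measure i) ((\<lambda>y. x $ i + a * y) -` A i) =
        emeasure (density lborel (normal_density (x $ i) a)) (A i)"
      using A[OF i] by (simp flip: distr_affine_std_normal[OF assms(1)] add: emeasure_distr)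
  qed
  finally show "emeasure (distr (Pi\<^sub>M I coord_measure) (Pi\<^sub>M I (\<lambda>i. lborel)) (\<lambda>\<omega>. \<lambda>i\<in>I. x $ i + a * \<omega> i)) (Pi\<^sub>E I A) =
    (\<Prod>i\<in>I. emeasure (density lborel (normal_density (x $ i) a)) (A i))" .
qed simp

text \<open>\<open>bdry_pt\<close> ignores the last coordinate, so only the Gaussian marginal on
  \<open>I\<close> matters. It is transported by the same embedding into the hyperplane that defines
  \<open>bdry_lborel\<close>.\<close>

lemma distr_bdry_pt:
  fixes x :: "real ^ 'n::{finite,linorder}"
  assumes a: "a > 0" and x: "x \<in> half_space_bdry"
  defines "I \<equiv> UNIV - {last_idx :: 'n}"
  shows "distr sample borel (\<lambda>\<omega>. x + a *\<^sub>R bdry_pt \<omega>) =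
    distr (density (Pi\<^sub>M I (\<lambda>i. lborel)) (\<lambda>w. ennreal (\<Prod>i\<in>I. normal_density (x $ i) a (w i)))) borel
      (\<lambda>w. \<chi> i. if i = last_idx then 0 else w i)" (is "_ = distr ?D borel ?\<phi>")
proof -
  have \<phi>[measurable]: "?\<phi> \<in> borel_measurable (Pi\<^sub>M I (\<lambda>i. lborel))"
  proof (rule borel_measurable_vec_lambda)
    fix i :: 'n
    show "(\<lambda>w. if i = last_idx then 0 else w i) \<in> borel_measurable (Pi\<^sub>M I (\<lambda>i. lborel :: real measure))"
      using measurable_component_singleton[of i I "\<lambda>i. lborel :: real measure"]
      by (cases "i = last_idx") (simp_all add: I_def)
  qed
  have aff[measurable]: "(\<lambda>\<omega>. \<lambda>i\<in>I. x $ i + a * \<omega> i) \<in> measurable (Pi\<^sub>M I coord_measure) (Pi\<^sub>M I (\<lambda>i. lborel))"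
    by (auto intro!: measurable_restrict measurable_compose[OF measurable_component_singleton])
  have "distr ?D borel ?\<phi> =
      distr (distr (Pi\<^sub>M I coord_measure) (Pi\<^sub>M I (\<lambda>i. lborel)) (\<lambda>\<omega>. \<lambda>i\<in>I. x $ i + a * \<omega> i)) borel ?\<phi>"
    using distr_affine_coord[OF a, of I x] PiM_normal_eq_density[OF a, of I x] by (simp add: I_def)
  also have "\<dots> = distr (Pi\<^sub>M I coord_measure) borel (?\<phi> \<circ> (\<lambda>\<omega>. \<lambda>i\<in>I. x $ i + a * \<omega> i))"
    by (rule distr_distr) measurable
  also have "Pi\<^sub>M I coord_measure = distr sample (Pi\<^sub>M I coord_measure) (\<lambda>\<omega>. restrict \<omega> I)"
    unfolding sample_def by (rule coord.distr_restrict) auto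
  also have "distr \<dots> borel (?\<phi> \<circ> (\<lambda>\<omega>. \<lambda>i\<in>I. x $ i + a * \<omega> i)) =
      distr sample borel ((?\<phi> \<circ> (\<lambda>\<omega>. \<lambda>i\<in>I. x $ i + a * \<omega> i)) \<circ> (\<lambda>\<omega>. restrict \<omega> I))"
    by (rule distr_distr) (auto simp: sample_def intro!: measurable_comp[OF aff] measurable_restrict_subset)
  also have "(?\<phi> \<circ> (\<lambda>\<omega>. \<lambda>i\<in>I. x $ i + a * \<omega> i)) \<circ> (\<lambda>\<omega>. restrict \<omega> I) = (\<lambda>\<omega>. x + a *\<^sub>R bdry_pt \<omega>)"
    using x by (auto simp: fun_eq_iff vec_eq_iff I_def bdry_pt_def half_space_bdry_def)
  finally show ?thesis by simp
qed

text \<open>Each of the n - 1 Gaussian factors of variance 2 tau absorbs one of the n factors sqrt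
  (4 pi tau). One is left over and forms, together with 1 / tau, the singular weight in
  time.\<close>

lemma heat_kernel_eq_prod:
  fixes x y :: "real ^ 'n::{finite,linorder}"
  assumes tau: "\<tau> > 0" and x: "x \<in> half_space_bdry" and y: "y \<in> half_space_bdry"
  shows "exp (- (norm (x - y))\<^sup>2 / (4 * \<tau>)) / (\<tau> * (4 * pi * \<tau>) powr (real CARD('n) / 2)) =
    (\<Prod>i\<in>UNIV - {last_idx}. normal_density (x $ i) (sqrt (2 * \<tau>)) (y $ i)) / (\<tau> * sqrt (4 * pi * \<tau>))"
proof -
  let ?I = "UNIV - {last_idx :: 'n}"
  have card: "CARD('n) = Suc (card ?I)"
    by (simp add: card_Diff_singleton Suc_diff_Suc[symmetric])
  have "(4 * pi * \<tau>) powr (real CARD('n) / 2) = sqrt (4 * pi * \<tau>) ^ CARD('n)"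
    using tau by (simp add: powr_half_sqrt[symmetric] powr_powr powr_realpow[symmetric])
  then have pow: "(4 * pi * \<tau>) powr (real CARD('n) / 2) = sqrt (4 * pi * \<tau>) * sqrt (4 * pi * \<tau>) ^ card ?I"
    by (metis card power_Suc)
  have "(norm (x - y))\<^sup>2 = (\<Sum>i\<in>UNIV. (x $ i - y $ i)\<^sup>2)"
    by (simp add: norm_vec_def L2_set_def sum_nonneg)
  also have "\<dots> = (\<Sum>i\<in>?I. (y $ i - x $ i)\<^sup>2)"
    using x y by (subst sum.remove[of UNIV last_idx])
      (auto simp: half_space_bdry_def power2_commute)
  finally have norm: "(norm (x - y))\<^sup>2 = (\<Sum>i\<in>?I. (y $ i - x $ i)\<^sup>2)" .
  have "(\<Prod>i\<in>?I. normal_density (x $ i) (sqrt (2 * \<tau>)) (y $ i)) =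
      (\<Prod>i\<in>?I. (1 / sqrt (4 * pi * \<tau>)) * exp (- (y $ i - x $ i)\<^sup>2 / (4 * \<tau>)))"
    using tau by (simp add: normal_density_def mult_ac)
  also have "\<dots> = (1 / sqrt (4 * pi * \<tau>)) ^ card ?I * exp (- (norm (x - y))\<^sup>2 / (4 * \<tau>))"
    unfolding prod.distrib norm
    by (simp add: exp_sum sum_negf sum_divide_distrib flip: sum_negf)
  finally show ?thesis
    unfolding pow by (simp add: power_divide)
qed

text \<open>This is the substitution \<open>y = x + sqrt (2 * \<tau>) * Z\<close> with a standard normal \<open>Z\<close>.\<close>

lemma
  fixes h :: "real ^ 'n::{finite,linorder} \<Rightarrow> real"
  assumes tau: "\<tau> > 0" and x: "x \<in> half_space_bdry"
    and h[measurable]: "h \<in> borel_measurable borel"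
    and int: "integrable sample (\<lambda>\<omega>. h (x + sqrt (2 * \<tau>) *\<^sub>R bdry_pt \<omega>))"
  shows set_integrable_bdry_heat_kernel: "set_integrable bdry_lborel half_space_bdry
      (\<lambda>y. h y * (exp (- (norm (x - y))\<^sup>2 / (4 * \<tau>)) / (\<tau> * (4 * pi * \<tau>) powr (real CARD('n) / 2))))"
    and bdry_heat_kernel_integral: "(LINT y:half_space_bdry|bdry_lborel.
        h y * (exp (- (norm (x - y))\<^sup>2 / (4 * \<tau>)) / (\<tau> * (4 * pi * \<tau>) powr (real CARD('n) / 2)))) =
      (\<integral>\<omega>. h (x + sqrt (2 * \<tau>) *\<^sub>R bdry_pt \<omega>) \<partial>sample) / (\<tau> * sqrt (4 * pi * \<tau>))"
proof -
  let ?I = "UNIV - {last_idx :: 'n}"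
  let ?\<phi> = "\<lambda>w. \<chi> i. if i = last_idx then 0 else w i"
  let ?P = "Pi\<^sub>M ?I (\<lambda>i. lborel :: real measure)"
  let ?a = "sqrt (2 * \<tau>)"
  let ?d = "\<lambda>w. \<Prod>i\<in>?I. normal_density (x $ i) ?a (w i)"
  let ?k = "\<lambda>y. exp (- (norm (x - y))\<^sup>2 / (4 * \<tau>)) / (\<tau> * (4 * pi * \<tau>) powr (real CARD('n) / 2))"
  have a: "?a > 0" using tau by simp
  have \<phi>[measurable]: "?\<phi> \<in> borel_measurable ?P"
  proof (rule borel_measurable_vec_lambda)
    fix i :: 'n
    show "(\<lambda>w. if i = last_idx then 0 else w i) \<in> borel_measurable ?P"
      using measurable_component_singleton[of i ?I "\<lambda>i. lborel :: real measure"]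
      by (cases "i = last_idx") simp_all
  qed
  have d[measurable]: "?d \<in> borel_measurable ?P"
    by (auto intro!: borel_measurable_prod intro: measurable_compose[OF measurable_component_singleton])
  have B[measurable]: "(half_space_bdry :: (real ^ 'n::{finite,linorder}) set) \<in> sets borel"
    unfolding half_space_bdry_def by measurable
  have pt: "(\<lambda>\<omega>. x + ?a *\<^sub>R bdry_pt \<omega>) \<in> borel_measurable sample"
    by measurable
  let ?D = "density ?P (\<lambda>w. ennreal (?d w))"
  have nn: "AE w in ?P. 0 \<le> ?d w" by (auto intro!: prod_nonneg)
  have "integrable (distr sample borel (\<lambda>\<omega>. x + ?a *\<^sub>R bdry_pt \<omega>)) h"
    using int by (subst integrable_distr_eq[OF pt]) auto
  then have "integrable (distr ?D borel ?\<phi>) h"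
    unfolding distr_bdry_pt[OF a x] .
  then have "integrable ?D (\<lambda>w. h (?\<phi> w))"
    by (subst (asm) integrable_distr_eq) auto
  then have I1: "integrable ?P (\<lambda>w. ?d w * h (?\<phi> w))"
    by (subst (asm) integrable_density) (use nn in auto)
  have "(\<integral>\<omega>. h (x + ?a *\<^sub>R bdry_pt \<omega>) \<partial>sample) = (\<integral>y. h y \<partial>distr sample borel (\<lambda>\<omega>. x + ?a *\<^sub>R bdry_pt \<omega>))"
    by (subst integral_distr[OF pt]) auto
  also have "\<dots> = (\<integral>y. h y \<partial>distr ?D borel ?\<phi>)"
    unfolding distr_bdry_pt[OF a x] ..
  also have "\<dots> = (\<integral>w. h (?\<phi> w) \<partial>?D)"
    by (subst integral_distr) auto
  also have "\<dots> = (\<integral>w. ?d w * h (?\<phi> w) \<partial>?P)"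
    by (subst integral_density) (use nn in auto)
  finally have E: "(\<integral>\<omega>. h (x + ?a *\<^sub>R bdry_pt \<omega>) \<partial>sample) = (\<integral>w. ?d w * h (?\<phi> w) \<partial>?P)" .
  have ker: "indicator half_space_bdry (?\<phi> w) *\<^sub>R (h (?\<phi> w) * ?k (?\<phi> w)) =
      ?d w * h (?\<phi> w) / (\<tau> * sqrt (4 * pi * \<tau>))" for w
  proof -
    have mem: "?\<phi> w \<in> half_space_bdry" by (simp add: half_space_bdry_def)
    have "(\<Prod>i\<in>?I. normal_density (x $ i) ?a (?\<phi> w $ i)) = ?d w"
      by (intro prod.cong) auto
    then show ?thesis
      using heat_kernel_eq_prod[OF tau x mem] mem by simp
  qed
  have meas: "(\<lambda>y. indicator half_space_bdry y *\<^sub>R (h y * ?k y)) \<in> borel_measurable borel"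
    by measurable
  show "set_integrable bdry_lborel half_space_bdry (\<lambda>y. h y * ?k y)"
    unfolding set_integrable_def bdry_lborel_def integrable_distr_eq[OF \<phi> meas] ker
    using I1 by simp
  show "(LINT y:half_space_bdry|bdry_lborel. h y * ?k y) =
      (\<integral>\<omega>. h (x + sqrt (2 * \<tau>) *\<^sub>R bdry_pt \<omega>) \<partial>sample) / (\<tau> * sqrt (4 * pi * \<tau>))"
    unfolding set_lebesgue_integral_def bdry_lborel_def integral_distr[OF \<phi> meas] ker E
    by simp
qed

section \<open>The fundamental theorem of calculus under an expectation\<close>

text \<open>The majorant \<open>B\<close> does not depend on the parameter, so its product with the
  indicator of a bounded interval is integrable on the product space and both orders of integration
  agree.\<close>

lemma expectation_FTC:
  fixes \<Phi> \<Psi> :: "real \<Rightarrow> 'b \<Rightarrow> real"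
  assumes P: "prob_space P" and ab: "\<alpha> \<le> \<beta>"
    and deriv: "\<And>\<omega> \<sigma>. \<omega> \<in> space P \<Longrightarrow> \<sigma> \<in> {\<alpha>..\<beta>} \<Longrightarrow>
      ((\<lambda>\<sigma>. \<Phi> \<sigma> \<omega>) has_real_derivative \<Psi> \<sigma> \<omega>) (at \<sigma> within {\<alpha>..\<beta>})"
    and cont: "\<And>\<omega>. \<omega> \<in> space P \<Longrightarrow> continuous_on {\<alpha>..\<beta>} (\<lambda>\<sigma>. \<Psi> \<sigma> \<omega>)"
    and meas: "(\<lambda>(\<sigma>, \<omega>). indicator {\<alpha>..\<beta>} \<sigma> * \<Psi> \<sigma> \<omega>) \<in> borel_measurable (lborel \<Otimes>\<^sub>M P)"
    and bound: "\<And>\<omega> \<sigma>. \<omega> \<in> space P \<Longrightarrow> \<sigma> \<in> {\<alpha>..\<beta>} \<Longrightarrow> \<bar>\<Psi> \<sigma> \<omega>\<bar> \<le> B \<omega>"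
    and B: "integrable P B"
    and int: "integrable P (\<Phi> \<alpha>)" "integrable P (\<Phi> \<beta>)"
  shows "set_integrable lborel {\<alpha>..\<beta>} (\<lambda>\<sigma>. \<integral>\<omega>. \<Psi> \<sigma> \<omega> \<partial>P)" (is ?A)
    and "(LINT \<sigma>:{\<alpha>..\<beta>}|lborel. \<integral>\<omega>. \<Psi> \<sigma> \<omega> \<partial>P) = (\<integral>\<omega>. \<Phi> \<beta> \<omega> \<partial>P) - (\<integral>\<omega>. \<Phi> \<alpha> \<omega> \<partial>P)" (is ?B)
proof -
  interpret P: prob_space P by fact
  interpret PS: pair_sigma_finite lborel P ..
  have Bm[measurable]: "B \<in> borel_measurable P" using B by auto
  have ind: "integrable lborel (\<lambda>\<sigma>. indicator {\<alpha>..\<beta>} \<sigma> * c)" for c :: real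
    by (intro integrable_mult_left integrable_real_indicator) (auto simp: emeasure_lborel_Icc_eq)
  have "integrable (lborel \<Otimes>\<^sub>M P) (\<lambda>(\<sigma>, \<omega>). indicator {\<alpha>..\<beta>} \<sigma> * B \<omega>)"
    by (rule PS.Fubini_integrable) (use ind[of 1] in \<open>auto simp: abs_mult B\<close>)
  then have joint: "integrable (lborel \<Otimes>\<^sub>M P) (\<lambda>(\<sigma>, \<omega>). indicator {\<alpha>..\<beta>} \<sigma> * \<Psi> \<sigma> \<omega>)"
    by (rule Bochner_Integration.integrable_bound[OF _ meas])
       (auto intro!: AE_I2 order_trans[OF bound] simp: space_pair_measure indicator_def)
  show ?A
    using PS.integrable_fst'[OF joint] by (simp add: set_integrable_def)
  have "(LINT \<sigma>:{\<alpha>..\<beta>}|lborel. \<integral>\<omega>. \<Psi> \<sigma> \<omega> \<partial>P) = (\<integral>\<sigma>. (\<integral>\<omega>. indicator {\<alpha>..\<beta>} \<sigma> * \<Psi> \<sigma> \<omega> \<partial>P) \<partial>lborel)"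
    by (simp add: set_lebesgue_integral_def)
  also have "\<dots> = (\<integral>\<omega>. (\<integral>\<sigma>. indicator {\<alpha>..\<beta>} \<sigma> * \<Psi> \<sigma> \<omega> \<partial>lborel) \<partial>P)"
    using PS.Fubini_integral[OF joint] by simp
  also have "\<dots> = (\<integral>\<omega>. \<Phi> \<beta> \<omega> - \<Phi> \<alpha> \<omega> \<partial>P)"
  proof (rule Bochner_Integration.integral_cong[OF refl])
    fix \<omega> assume \<omega>: "\<omega> \<in> space P"
    show "(\<integral>\<sigma>. indicator {\<alpha>..\<beta>} \<sigma> * \<Psi> \<sigma> \<omega> \<partial>lborel) = \<Phi> \<beta> \<omega> - \<Phi> \<alpha> \<omega>"
      using integral_FTC_atLeastAtMost[OF ab _ cont[OF \<omega>], of "\<lambda>\<sigma>. \<Phi> \<sigma> \<omega>"] deriv[OF \<omega>]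
      by (simp add: has_real_derivative_iff_has_vector_derivative)
  qed
  also have "\<dots> = (\<integral>\<omega>. \<Phi> \<beta> \<omega> \<partial>P) - (\<integral>\<omega>. \<Phi> \<alpha> \<omega> \<partial>P)"
    using int by simp
  finally show ?B .
qed

subsection \<open>Integration by parts for heat solutions on a half-space\<close>

text \<open>One constant is both prefactor and rate, as in the growth hypothesis on u. Continuity is
  joint, so that compositions with random space-time points are measurable.\<close>

definition exp_bounded_cont :: "real \<Rightarrow> real \<Rightarrow> (real \<Rightarrow> real ^ 'n::{finite,linorder} \<Rightarrow> real) \<Rightarrow> bool" where
  "exp_bounded_cont T C f \<longleftrightarrow> continuous_on ({0..T} \<times> half_space) (\<lambda>(t, x). f t x) \<and>
    (\<forall>t\<in>{0..T}. \<forall>x\<in>half_space. \<bar>f t x\<bar> \<le> C * exp (C * norm x))"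

lemma closed_half_space: "closed (half_space :: (real ^ 'n::{finite,linorder}) set)"
  unfolding half_space_def by (intro closed_Collect_le continuous_intros)

lemma half_space_bdry_subset: "x \<in> half_space_bdry \<Longrightarrow> x \<in> half_space"
  by (simp add: half_space_bdry_def half_space_def)

text \<open>Nothing is known about f outside the closed set of times in [0, T] and points of
  \<open>half_space\<close>, so f is first cut off there. The cut-off is Borel, and the composition
  never leaves the set.\<close>

lemma measurable_exp_bounded_cont:
  assumes f: "exp_bounded_cont T C f"
    and [measurable]: "\<tau> \<in> borel_measurable N" "p \<in> borel_measurable N"
    and range: "\<And>z. z \<in> space N \<Longrightarrow> \<tau> z \<in> {0..T}" "\<And>z. z \<in> space N \<Longrightarrow> p z \<in> half_space"
  shows "(\<lambda>z. f (\<tau> z) (p z)) \<in> borel_measurable N"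
proof -
  have "(\<lambda>q. indicator ({0..T} \<times> half_space) q *\<^sub>R (case q of (t, x) \<Rightarrow> f t x)) \<in> borel_measurable borel"
    using f by (intro borel_measurable_continuous_on_indicator)
      (auto simp: exp_bounded_cont_def borel_closed closed_Times closed_half_space)
  then have "(\<lambda>z. indicator ({0..T} \<times> half_space) (\<tau> z, p z) *\<^sub>R (case (\<tau> z, p z) of (t, x) \<Rightarrow> f t x)) \<in> borel_measurable N"
    by (rule measurable_compose[rotated]) measurable
  then show ?thesis
    by (rule measurable_cong[THEN iffD1, rotated]) (use range in auto)
qed

lemma continuous_on_exp_bounded_cont:
  assumes f: "exp_bounded_cont T C f"
    and "continuous_on A \<tau>" "continuous_on A p"
    and range: "\<And>z. z \<in> A \<Longrightarrow> \<tau> z \<in> {0..T}" "\<And>z. z \<in> A \<Longrightarrow> p z \<in> half_space"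
  shows "continuous_on A (\<lambda>z. f (\<tau> z) (p z))"
proof -
  have "continuous_on A (\<lambda>z. (\<lambda>(t, x). f t x) (\<tau> z, p z))"
    by (rule continuous_on_compose2[of "{0..T} \<times> half_space"])
       (use assms in \<open>auto simp: exp_bounded_cont_def intro!: continuous_intros\<close>)
  then show ?thesis by simp
qed

lemma integrable_sample_bound:
  assumes "f \<in> borel_measurable sample" "\<And>\<omega>. \<bar>f \<omega>\<bar> \<le> K * weight L \<omega>"
  shows "integrable sample f"
proof (rule Bochner_Integration.integrable_bound)
  show "integrable sample (\<lambda>\<omega>. K * weight L \<omega>)"
    by (intro integrable_mult_right integrable_weight)
  show "AE \<omega> in sample. norm (f \<omega>) \<le> norm (K * weight L \<omega>)"
    using assms(2) by (auto intro!: AE_I2 intro: order_trans[OF _ abs_ge_self])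
qed fact

lemma pt_mem_half_space:
  assumes "p = half_pt \<or> p = bdry_pt" "x \<in> half_space_bdry" "a \<ge> 0"
  shows "x + a *\<^sub>R p \<omega> \<in> half_space"
  using assms by (auto simp: half_space_def half_space_bdry_def half_pt_def bdry_pt_def)

text \<open>The bound is uniform over all scales a up to L, so one integrable weight serves a whole
  range of scales.\<close>

lemma exp_bounded_cont_weight:
  assumes f: "exp_bounded_cont T C f" and C: "C \<ge> 0"
    and p: "p = half_pt \<or> p = bdry_pt" and x: "x \<in> half_space_bdry"
    and a: "0 \<le> a" "a \<le> L" and t: "t \<in> {0..T}"
  shows "\<bar>f t (x + a *\<^sub>R p \<omega>)\<bar> \<le> C * exp (C * norm x) * weight (C * L) \<omega>"
proof -
  let ?s = "\<Sum>i\<in>UNIV. \<bar>\<omega> i\<bar>"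
  have "norm (x + a *\<^sub>R p \<omega>) \<le> norm x + a * norm (p \<omega>)"
    using a norm_triangle_ineq[of x "a *\<^sub>R p \<omega>"] by simp
  also have "\<dots> \<le> norm x + L * ?s"
    using p a norm_half_pt_le[of \<omega>] norm_bdry_pt_le[of \<omega>] by (auto intro!: mult_mono)
  finally have "C * exp (C * norm (x + a *\<^sub>R p \<omega>)) \<le> C * exp (C * (norm x + L * ?s))"
    using C by (intro mult_left_mono) (auto intro: mult_left_mono)
  also have "\<dots> = C * exp (C * norm x) * weight (C * L) \<omega>"
    by (simp add: weight_eq_exp distrib_left exp_add mult_ac)
  finally show ?thesis
    using f t pt_mem_half_space[OF p x a(1), of \<omega>] unfolding exp_bounded_cont_def by fastforce
qed

lemma measurable_pt:
  "p = half_pt \<or> p = bdry_pt \<Longrightarrow> p \<in> borel_measurable sample"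
  using measurable_half_pt measurable_bdry_pt by auto

lemma measurable_pt_nth:
  assumes "p = half_pt \<or> p = bdry_pt"
  shows "(\<lambda>\<omega>. p \<omega> $ i) \<in> borel_measurable sample"
  by (rule measurable_compose[OF measurable_pt[OF assms]])
     (auto intro!: borel_measurable_continuous_onI continuous_intros)

lemma measurable_at_pt:
  assumes "exp_bounded_cont T C f" "p = half_pt \<or> p = bdry_pt" "x \<in> half_space_bdry" "0 \<le> a" "t \<in> {0..T}"
  shows "(\<lambda>\<omega>. f t (x + a *\<^sub>R p \<omega>)) \<in> borel_measurable sample"
proof -
  note [measurable] = measurable_pt[OF assms(2)]
  show ?thesis
    by (rule measurable_exp_bounded_cont[OF assms(1)]) (use assms pt_mem_half_space in auto)
qed

lemma integrable_at_pt:
  assumes "exp_bounded_cont T C f" "C \<ge> 0" "p = half_pt \<or> p = bdry_pt" "x \<in> half_space_bdry" "0 \<le> a" "t \<in> {0..T}"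
  shows "integrable sample (\<lambda>\<omega>. f t (x + a *\<^sub>R p \<omega>))"
  by (rule integrable_sample_bound[OF measurable_at_pt exp_bounded_cont_weight[of T C f p x a a]])
     (use assms in auto)

text \<open>A sample coordinate is at most \<open>weight 1\<close> in absolute value, so multiplying
  by it raises the rate of the weight by one.\<close>

lemma coord_times_weight_bound:
  assumes "\<bar>r\<bar> \<le> K * weight L \<omega>" "\<bar>s\<bar> \<le> \<bar>\<omega> i\<bar>"
  shows "\<bar>s * r\<bar> \<le> K * weight (L + 1) \<omega>"
proof -
  have "\<bar>s\<bar> * \<bar>r\<bar> \<le> weight 1 \<omega> * (K * weight L \<omega>)"
    using assms abs_coord_le_weight[of \<omega> i] weight_pos[of 1 \<omega>] by (intro mult_mono) auto
  also have "\<dots> = K * weight (L + 1) \<omega>"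
    by (simp add: weight_mult[symmetric] mult_ac)
  finally show ?thesis by (simp add: abs_mult)
qed

lemma abs_pt_nth_le: "p = half_pt \<or> p = bdry_pt \<Longrightarrow> \<bar>p \<omega> $ i\<bar> \<le> \<bar>\<omega> i\<bar>"
  by (auto simp: half_pt_def bdry_pt_def)

lemma integrable_coord_at_pt:
  assumes "exp_bounded_cont T C f" "C \<ge> 0" "p = half_pt \<or> p = bdry_pt" "x \<in> half_space_bdry" "0 \<le> a" "t \<in> {0..T}"
  shows "integrable sample (\<lambda>\<omega>. p \<omega> $ i * f t (x + a *\<^sub>R p \<omega>))"
proof (rule integrable_sample_bound)
  show "(\<lambda>\<omega>. p \<omega> $ i * f t (x + a *\<^sub>R p \<omega>)) \<in> borel_measurable sample"
    by (intro borel_measurable_times measurable_pt_nth measurable_at_pt[OF assms(1,3-6)] assms)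
  show "\<bar>p \<omega> $ i * f t (x + a *\<^sub>R p \<omega>)\<bar> \<le> C * exp (C * norm x) * weight (C * a + 1) \<omega>" for \<omega>
    by (rule coord_times_weight_bound[OF exp_bounded_cont_weight abs_pt_nth_le]) (use assms in auto)
qed

lemma exp_bounded_cont_along_axis:
  assumes f: "exp_bounded_cont T C f" and C: "C \<ge> 0" and a: "a \<ge> 0" and t: "t \<in> {0..T}"
    and z: "z + (a * y) *\<^sub>R axis i 1 \<in> half_space"
  shows "\<bar>f t (z + (a * y) *\<^sub>R axis i 1)\<bar> \<le> C * exp (C * norm z) * exp (C * a * \<bar>y\<bar>)"
proof -
  have "norm (z + (a * y) *\<^sub>R axis i 1) \<le> norm z + a * \<bar>y\<bar>"
    using norm_triangle_ineq[of z "(a * y) *\<^sub>R axis i 1"] a by (simp add: norm_axis_1 abs_mult)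
  then have "C * exp (C * norm (z + (a * y) *\<^sub>R axis i 1)) \<le> C * exp (C * (norm z + a * \<bar>y\<bar>))"
    using C by (intro mult_left_mono) (auto intro: mult_left_mono)
  also have "\<dots> = C * exp (C * norm z) * exp (C * a * \<bar>y\<bar>)"
    by (simp add: distrib_left exp_add mult_ac)
  finally show ?thesis
    using f t z unfolding exp_bounded_cont_def by fastforce
qed

text \<open>What the analytic argument uses of u: \<open>u1 i\<close> and \<open>u2 i\<close> stand
  for the first and the pure second partial derivatives. The heat equation is built into
  \<open>deriv_u\<close>, whose time component is already the Laplacian.\<close>

locale half_space_heat =
  fixes u :: "real \<Rightarrow> real ^ 'n::{finite,linorder} \<Rightarrow> real"
    and u1 u2 :: "'n::{finite,linorder} \<Rightarrow> real \<Rightarrow> real ^ 'n::{finite,linorder} \<Rightarrow> real"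
    and T C :: real
  assumes C: "C \<ge> 0"
    and u: "exp_bounded_cont T C u"
    and u1: "\<And>i. exp_bounded_cont T C (u1 i)"
    and u2: "\<And>i. exp_bounded_cont T C (u2 i)"
    and deriv_u: "\<And>t x. t \<in> {0..T} \<Longrightarrow> x \<in> half_space \<Longrightarrow>
      ((\<lambda>(t, x). u t x) has_derivative
        (\<lambda>(dt, dx). dt * (\<Sum>i\<in>UNIV. u2 i t x) + (\<Sum>i\<in>UNIV. dx $ i * u1 i t x)))
      (at (t, x) within {0..T} \<times> half_space)"
    and deriv_u1: "\<And>t x i. t \<in> {0..T} \<Longrightarrow> x \<in> half_space \<Longrightarrow>
      ((\<lambda>h. u1 i t (x + h *\<^sub>R axis i 1)) has_real_derivative u2 i t x)
      (at 0 within {h. x + h *\<^sub>R axis i 1 \<in> half_space})"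
    and initial: "\<And>x. x \<in> half_space \<Longrightarrow> u 0 x = 0"
begin

text \<open>The chain rule for curves in space-time. It is applied to motion at fixed time, to the
  parabolic curves (s, x + sqrt (2 (t - s)) p), to their reparametrization (t - b^2 / 2, x + b p),
  and to a point at rest.\<close>

lemma deriv_along_path:
  assumes c: "(c has_real_derivative c') (at r within A)" and d: "(d has_vector_derivative d') (at r within A)"
    and range: "\<And>r. r \<in> A \<Longrightarrow> c r \<in> {0..T}" "\<And>r. r \<in> A \<Longrightarrow> d r \<in> half_space" and r: "r \<in> A"
  shows "((\<lambda>r. u (c r) (d r)) has_real_derivative
    c' * (\<Sum>i\<in>UNIV. u2 i (c r) (d r)) + (\<Sum>i\<in>UNIV. d' $ i * u1 i (c r) (d r))) (at r within A)"
proof -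
  have cd: "((\<lambda>r. (c r, d r)) has_derivative (\<lambda>h. (h * c', h *\<^sub>R d'))) (at r within A)"
    using c d by (intro has_derivative_Pair)
      (auto simp: has_field_derivative_def has_vector_derivative_def mult_commute_abs)
  have "((\<lambda>r. (\<lambda>(t, x). u t x) (c r, d r)) has_derivative
      (\<lambda>h. (\<lambda>(dt, dx). dt * (\<Sum>i\<in>UNIV. u2 i (c r) (d r)) + (\<Sum>i\<in>UNIV. dx $ i * u1 i (c r) (d r))) (h * c', h *\<^sub>R d')))
      (at r within A)"
    by (rule has_derivative_in_compose[OF cd has_derivative_subset[OF deriv_u]]) (use range r in auto)
  then show ?thesis
    unfolding has_field_derivative_def prod.case
    by (rule has_derivative_eq_rhs) (auto simp: fun_eq_iff algebra_simps sum_distrib_left)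
qed

lemma deriv_u_axis:
  assumes "t \<in> {0..T}" and x: "x \<in> half_space"
  shows "((\<lambda>h. u t (x + h *\<^sub>R axis i 1)) has_real_derivative u1 i t x)
    (at 0 within {h. x + h *\<^sub>R axis i 1 \<in> half_space})"
proof -
  have "((\<lambda>h. u t (x + h *\<^sub>R axis i 1)) has_real_derivative
      0 * (\<Sum>j\<in>UNIV. u2 j t (x + 0 *\<^sub>R axis i 1)) + (\<Sum>j\<in>UNIV. axis i 1 $ j * u1 j t (x + 0 *\<^sub>R axis i 1)))
    (at 0 within {h. x + h *\<^sub>R axis i 1 \<in> half_space})"
    by (rule deriv_along_path) (use assms in \<open>auto intro!: derivative_eq_intros\<close>)
  moreover have "(\<Sum>j\<in>UNIV. axis i 1 $ j * u1 j t x) = u1 i t x"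
    by (subst sum.remove[of UNIV i]) (auto simp: axis_def intro!: sum.neutral)
  ultimately show ?thesis by simp
qed

end

text \<open>A one-sided derivative becomes two-sided because y is an interior parameter: of the
  whole line in a tangential direction, of the positive half-line in the normal one.\<close>

lemma deriv_along_scaled_axis:
  fixes f f' :: "real \<Rightarrow> real ^ 'n::{finite,linorder} \<Rightarrow> real"
  assumes deriv: "\<And>x. x \<in> half_space \<Longrightarrow>
      ((\<lambda>h. f t (x + h *\<^sub>R axis i 1)) has_real_derivative f' t x) (at 0 within {h. x + h *\<^sub>R axis i 1 \<in> half_space})"
    and z: "z \<in> half_space" and a: "a \<ge> 0" and y: "i \<noteq> last_idx \<or> y > 0"
  shows "((\<lambda>y. f t (z + (a * y) *\<^sub>R axis i 1)) has_real_derivative a * f' t (z + (a * y) *\<^sub>R axis i 1)) (at y)"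
proof -
  let ?A = "{h. z + h *\<^sub>R axis i 1 \<in> half_space}" and ?B = "if i = last_idx then {0<..} else UNIV :: real set"
  have B: "a * r \<in> ?A" if "r \<in> ?B" for r
    using z a that by (auto simp: half_space_def axis_def split: if_splits)
  have y': "y \<in> ?B" using y by auto
  have "((\<lambda>h. f t (z + h *\<^sub>R axis i 1)) has_real_derivative f' t (z + (a * y) *\<^sub>R axis i 1)) (at (a * y) within ?A)"
    by (rule has_field_derivative_shift_within)
       (use deriv[of "z + (a * y) *\<^sub>R axis i 1"] B[OF y'] in \<open>simp add: algebra_simps\<close>)
  then have "((\<lambda>h. f t (z + h *\<^sub>R axis i 1)) has_real_derivative f' t (z + (a * y) *\<^sub>R axis i 1))
      (at (a * y) within (\<lambda>r. a * r) ` ?B)"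
    by (rule DERIV_subset) (use B in blast)
  then have "((\<lambda>h. f t (z + h *\<^sub>R axis i 1)) \<circ> (\<lambda>r. a * r) has_real_derivative f' t (z + (a * y) *\<^sub>R axis i 1) * a) (at y within ?B)"
    by (rule DERIV_image_chain) (auto intro!: derivative_eq_intros)
  moreover have "at y within ?B = at y"
    using y' by (intro at_within_open) auto
  ultimately show ?thesis by (simp add: o_def mult.commute)
qed

context half_space_heat
begin

text \<open>With all coordinates but i frozen, the sample point runs along a line parallel to the
  boundary, and Stein's identity applies to \<open>u1 i\<close> on that line; the chain rule
  contributes the factor a.\<close>

lemma tangential_integration_by_parts:
  assumes i: "i \<noteq> last_idx" and p: "p = half_pt \<or> p = bdry_pt" and x: "x \<in> half_space_bdry"
    and a: "a \<ge> 0" and t: "t \<in> {0..T}"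
  shows "(\<integral>\<omega>. p \<omega> $ i * u1 i t (x + a *\<^sub>R p \<omega>) \<partial>sample) = a * (\<integral>\<omega>. u2 i t (x + a *\<^sub>R p \<omega>) \<partial>sample)"
proof -
  note int1 = integrable_coord_at_pt[OF u1 C p x a t, of i]
  note int2 = integrable_at_pt[OF u2 C p x a t, of i]
  let ?f = "\<lambda>\<omega>. p \<omega> $ i * u1 i t (x + a *\<^sub>R p \<omega>) - a * u2 i t (x + a *\<^sub>R p \<omega>)"
  have "(\<integral>y. ?f (fun_upd \<omega> i y) \<partial>coord_measure i) = 0" for \<omega>
  proof -
    define z where "z = x + a *\<^sub>R p (fun_upd \<omega> i 0)"
    have pt: "p (fun_upd \<omega> i y) $ i = y" for y
      using p i by (auto simp: half_pt_def bdry_pt_def)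
    have eq: "x + a *\<^sub>R p (fun_upd \<omega> i y) = z + (a * y) *\<^sub>R axis i 1" for y
      using p i by (auto simp: z_def half_pt_def bdry_pt_def vec_eq_iff axis_def algebra_simps split: if_splits)
    have z: "z + (a * y) *\<^sub>R axis i 1 \<in> half_space" for y
      using pt_mem_half_space[OF p x a, of "fun_upd \<omega> i y"] by (simp add: eq)
    have z0: "z \<in> half_space" using z[of 0] by simp
    \<comment> \<open>One constant has to bound both the function and its derivative, which carries
      the factor a.\<close>
    let ?K = "(1 + a) * (C * exp (C * norm z))"
    have bound: "\<bar>r\<bar> \<le> C * exp (C * norm z) * exp (C * a * \<bar>y\<bar>) \<Longrightarrow> \<bar>r\<bar> \<le> ?K * exp (C * a * \<bar>y\<bar>)"
        "\<bar>r\<bar> \<le> C * exp (C * norm z) * exp (C * a * \<bar>y\<bar>) \<Longrightarrow> \<bar>a * r\<bar> \<le> ?K * exp (C * a * \<bar>y\<bar>)" for r y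
    proof -
      assume r: "\<bar>r\<bar> \<le> C * exp (C * norm z) * exp (C * a * \<bar>y\<bar>)"
      have "\<bar>r\<bar> + a * \<bar>r\<bar> \<le> ?K * exp (C * a * \<bar>y\<bar>)"
        using mult_left_mono[OF r, of "1 + a"] a by (simp add: algebra_simps)
      moreover have "0 \<le> a * \<bar>r\<bar>" "\<bar>a * r\<bar> = a * \<bar>r\<bar>" using a by (simp_all add: abs_mult)
      ultimately show "\<bar>r\<bar> \<le> ?K * exp (C * a * \<bar>y\<bar>)" "\<bar>a * r\<bar> \<le> ?K * exp (C * a * \<bar>y\<bar>)"
        by linarith+
    qed
    have "(\<integral>y. (y * u1 i t (z + (a * y) *\<^sub>R axis i 1) - a * u2 i t (z + (a * y) *\<^sub>R axis i 1)) \<partial>coord_measure i) = 0"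
    proof (rule coord_integration_by_parts[OF i])
      show "((\<lambda>y. u1 i t (z + (a * y) *\<^sub>R axis i 1)) has_real_derivative a * u2 i t (z + (a * y) *\<^sub>R axis i 1)) (at y)" for y
        by (rule deriv_along_scaled_axis[where f = "u1 i" and f' = "u2 i"]) (use deriv_u1[OF t] z0 a i in auto)
      show "continuous_on UNIV (\<lambda>y. a * u2 i t (z + (a * y) *\<^sub>R axis i 1))"
        by (intro continuous_intros continuous_on_exp_bounded_cont[OF u2]) (use t z in auto)
      show "\<bar>u1 i t (z + (a * y) *\<^sub>R axis i 1)\<bar> \<le> ?K * exp (C * a * \<bar>y\<bar>)" for y
        by (intro bound(1) exp_bounded_cont_along_axis[OF u1 C a t z])
      show "\<bar>a * u2 i t (z + (a * y) *\<^sub>R axis i 1)\<bar> \<le> ?K * exp (C * a * \<bar>y\<bar>)" for y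
        by (intro bound(2) exp_bounded_cont_along_axis[OF u2 C a t z])
    qed
    then show ?thesis by (simp add: eq pt)
  qed
  then have "(\<integral>\<omega>. ?f \<omega> \<partial>sample) = 0"
    by (subst integral_sample_coord[of _ i]) (use int1 int2 in auto)
  then show ?thesis using int1 int2 by simp
qed

text \<open>The Rayleigh formula for v(y) = u(t, z + a y e_n): the derivatives of v bring the
  factors a and a^2, and v(0) is the value at the boundary point z.\<close>

lemma normal_integration_by_parts:
  assumes x: "x \<in> half_space_bdry" and a: "a \<ge> 0" and t: "t \<in> {0..T}"
  defines "n \<equiv> last_idx"
  shows "a * (\<integral>\<omega>. half_pt \<omega> $ n * u1 n t (x + a *\<^sub>R half_pt \<omega>) \<partial>sample)
      - a\<^sup>2 * (\<integral>\<omega>. u2 n t (x + a *\<^sub>R half_pt \<omega>) \<partial>sample) - (\<integral>\<omega>. u t (x + a *\<^sub>R half_pt \<omega>) \<partial>sample)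
    = - (\<integral>\<omega>. u t (x + a *\<^sub>R bdry_pt \<omega>) \<partial>sample)"
proof -
  have h: "half_pt = half_pt \<or> half_pt = bdry_pt" and b: "bdry_pt = half_pt \<or> bdry_pt = bdry_pt" by auto
  note int0 = integrable_at_pt[OF u C h x a t]
  note int1 = integrable_coord_at_pt[OF u1 C h x a t, of n n]
  note int2 = integrable_at_pt[OF u2 C h x a t, of n]
  let ?f = "\<lambda>\<omega>. half_pt \<omega> $ n * (a * u1 n t (x + a *\<^sub>R half_pt \<omega>)) - a\<^sup>2 * u2 n t (x + a *\<^sub>R half_pt \<omega>) - u t (x + a *\<^sub>R half_pt \<omega>)"
  have "(\<integral>y. ?f (fun_upd \<omega> n y) \<partial>coord_measure n) = - u t (x + a *\<^sub>R bdry_pt \<omega>)" for \<omega>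
  proof -
    define z where "z = x + a *\<^sub>R bdry_pt \<omega>"
    have pt: "half_pt (fun_upd \<omega> n y) $ n = \<bar>y\<bar>" for y
      by (auto simp: half_pt_def n_def)
    have eq: "x + a *\<^sub>R half_pt (fun_upd \<omega> n y) = z + (a * \<bar>y\<bar>) *\<^sub>R axis n 1" for y
      by (auto simp: z_def half_pt_def bdry_pt_def vec_eq_iff axis_def n_def)
    have z: "z + (a * y) *\<^sub>R axis n 1 \<in> half_space" if "y \<ge> 0" for y
      using pt_mem_half_space[OF h x a, of "fun_upd \<omega> n y"] that by (simp add: eq)
    have z0: "z \<in> half_space" using z[of 0] by simp
    let ?K = "(1 + a + a * a) * (C * exp (C * norm z))"
    have bound: "\<bar>r\<bar> \<le> ?K * exp (C * a * \<bar>y\<bar>)" "\<bar>a * r\<bar> \<le> ?K * exp (C * a * \<bar>y\<bar>)"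
        "\<bar>a * (a * r)\<bar> \<le> ?K * exp (C * a * \<bar>y\<bar>)"
      if r: "\<bar>r\<bar> \<le> C * exp (C * norm z) * exp (C * a * \<bar>y\<bar>)" for r y
    proof -
      have "\<bar>r\<bar> + a * \<bar>r\<bar> + a * (a * \<bar>r\<bar>) \<le> ?K * exp (C * a * \<bar>y\<bar>)"
        using mult_left_mono[OF r, of "1 + a + a * a"] a by (simp add: algebra_simps)
      moreover have "0 \<le> a * \<bar>r\<bar>" "0 \<le> a * (a * \<bar>r\<bar>)" using a by simp_all
      moreover have "\<bar>a * r\<bar> = a * \<bar>r\<bar>" "\<bar>a * (a * r)\<bar> = a * (a * \<bar>r\<bar>)"
        using a by (simp_all add: abs_mult)
      ultimately show "\<bar>r\<bar> \<le> ?K * exp (C * a * \<bar>y\<bar>)" "\<bar>a * r\<bar> \<le> ?K * exp (C * a * \<bar>y\<bar>)"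
          "\<bar>a * (a * r)\<bar> \<le> ?K * exp (C * a * \<bar>y\<bar>)"
        by linarith+
    qed
    let ?v = "\<lambda>y. u t (z + (a * y) *\<^sub>R axis n 1)"
    let ?v1 = "\<lambda>y. a * u1 n t (z + (a * y) *\<^sub>R axis n 1)"
    let ?v2 = "\<lambda>y. a * (a * u2 n t (z + (a * y) *\<^sub>R axis n 1))"
    have "(\<integral>y. (\<bar>y\<bar> * ?v1 \<bar>y\<bar> - ?v2 \<bar>y\<bar> - ?v \<bar>y\<bar>) \<partial>coord_measure last_idx) = - ?v 0"
    proof (rule last_coord_integration_by_parts)
      show "(?v has_real_derivative ?v1 y) (at y)" if "y > 0" for y
        by (rule deriv_along_scaled_axis) (use deriv_u_axis[OF t] z0 a that in auto)
      show "(?v1 has_real_derivative ?v2 y) (at y)" if "y > 0" for y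
        by (rule DERIV_cmult, rule deriv_along_scaled_axis[where f = "u1 n" and f' = "u2 n"])
           (use deriv_u1[OF t] z0 a that in auto)
      show "continuous_on {0..} ?v"
        by (intro continuous_intros continuous_on_exp_bounded_cont[OF u]) (use t z in auto)
      show "continuous_on {0..} ?v1"
        by (intro continuous_intros continuous_on_exp_bounded_cont[OF u1]) (use t z in auto)
      show "continuous_on {0..} ?v2"
        by (intro continuous_intros continuous_on_exp_bounded_cont[OF u2]) (use t z in auto)
      fix y :: real assume y: "y \<ge> 0"
      show "\<bar>?v y\<bar> \<le> ?K * exp (C * a * \<bar>y\<bar>)"
        by (intro bound(1) exp_bounded_cont_along_axis[OF u C a t z[OF y]])
      show "\<bar>?v1 y\<bar> \<le> ?K * exp (C * a * \<bar>y\<bar>)"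
        by (intro bound(2) exp_bounded_cont_along_axis[OF u1 C a t z[OF y]])
      show "\<bar>?v2 y\<bar> \<le> ?K * exp (C * a * \<bar>y\<bar>)"
        by (intro bound(3) exp_bounded_cont_along_axis[OF u2 C a t z[OF y]])
    qed
    then show ?thesis
      unfolding pt eq power2_eq_square by (simp add: z_def n_def mult.assoc)
  qed
  then have "(\<integral>\<omega>. ?f \<omega> \<partial>sample) =
      (\<integral>\<omega>. - u t (x + a *\<^sub>R bdry_pt \<omega>) \<partial>Pi\<^sub>M (UNIV - {n}) coord_measure)"
    by (subst integral_sample_coord[of _ n])
       (use int0 int1 int2 in \<open>auto simp: mult.left_commute\<close>)
  also have "\<dots> = - (\<integral>\<omega>. u t (x + a *\<^sub>R bdry_pt \<omega>) \<partial>sample)"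
  proof -
    \<comment> \<open>The boundary value is constant in coordinate n, so averaging that coordinate
      under a probability measure completes the integral to one over \<open>sample\<close>.\<close>
    have "bdry_pt (fun_upd \<omega> n y) = bdry_pt \<omega>" for \<omega> :: "'n \<Rightarrow> real" and y
      by (auto simp: bdry_pt_def vec_eq_iff n_def)
    then show ?thesis
      using prob_space.prob_space[OF prob_space_coord_measure[of n]]
      by (subst integral_sample_coord[of _ n, OF integrable_at_pt[OF u C b x a t]]) simp
  qed
  finally show ?thesis
    using int0 int1 int2 by (simp add: mult.left_commute)
qed


text \<open>The ranges are demanded for every real parameter, so it is applied to clamped times and
  radii; indicators then restrict to the interval where clamping changes nothing.\<close>

lemma measurable_pair_at_pt:
  assumes f: "exp_bounded_cont T C f" and p: "p = half_pt \<or> p = bdry_pt" and x: "x \<in> half_space_bdry"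
    and [measurable]: "c \<in> borel_measurable borel" "r \<in> borel_measurable borel"
    and range: "\<And>\<sigma>. c \<sigma> \<in> {0..T}" "\<And>\<sigma>. 0 \<le> r \<sigma>"
  shows "(\<lambda>(\<sigma>, \<omega>). f (c \<sigma>) (x + r \<sigma> *\<^sub>R p \<omega>)) \<in> borel_measurable (lborel \<Otimes>\<^sub>M sample)"
proof -
  note [measurable] = measurable_pt[OF p]
  have "(\<lambda>z. f (c (fst z)) (x + r (fst z) *\<^sub>R p (snd z))) \<in> borel_measurable (lborel \<Otimes>\<^sub>M sample)"
    by (rule measurable_exp_bounded_cont[OF f]) (use range pt_mem_half_space[OF p x] in auto)
  then show ?thesis by (simp add: case_prod_unfold)
qed

lemma measurable_pair_coord:
  assumes "p = half_pt \<or> p = bdry_pt"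
  shows "(\<lambda>(\<sigma>, \<omega>). p \<omega> $ i) \<in> borel_measurable (lborel \<Otimes>\<^sub>M sample)"
  using measurable_compose[OF measurable_snd measurable_pt_nth[OF assms]]
  by (simp add: case_prod_unfold)

text \<open>By tangential integration by parts, the derivative in b of E u(sigma, x + b (Z, 0)) is b
  times a sum of expected second derivatives. It is thus bounded by D a on [0, a], and integration
  gives D a^2.\<close>

lemma bdry_mean_bound:
  assumes x: "x \<in> half_space_bdry" and L: "0 \<le> L"
  shows "\<exists>D. \<forall>\<sigma>\<in>{0..T}. \<forall>a\<in>{0..L}.
    \<bar>(\<integral>\<omega>. u \<sigma> (x + a *\<^sub>R bdry_pt \<omega>) \<partial>sample) - u \<sigma> x\<bar> \<le> D * a\<^sup>2"
proof -
  interpret S: prob_space "sample :: ('n \<Rightarrow> real) measure" by (rule prob_space_sample)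
  have bdry: "bdry_pt = half_pt \<or> bdry_pt = bdry_pt" by simp
  define K where "K = C * exp (C * norm x)"
  define M where "M = K * (\<integral>\<omega>. weight (C * L) (\<omega> :: 'n \<Rightarrow> real) \<partial>sample)"
  \<comment> \<open>\<open>M\<close> bounds each expected second derivative uniformly in time and
    scale; the sum has at most n of them.\<close>
  define D where "D = real CARD('n) * M"
  have K0: "K \<ge> 0" using C by (simp add: K_def)
  have M0: "M \<ge> 0" unfolding M_def using K0
    by (intro mult_nonneg_nonneg Bochner_Integration.integral_nonneg) (auto intro: less_imp_le weight_pos)
  have "\<bar>(\<integral>\<omega>. u \<sigma> (x + a *\<^sub>R bdry_pt \<omega>) \<partial>sample) - u \<sigma> x\<bar> \<le> D * a\<^sup>2"
    if \<sigma>: "\<sigma> \<in> {0..T}" and a: "a \<in> {0..L}" for \<sigma> a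
  proof -
    let ?\<Phi> = "\<lambda>b \<omega>. u \<sigma> (x + b *\<^sub>R bdry_pt \<omega>)"
    let ?\<Psi> = "\<lambda>b \<omega>. \<Sum>i\<in>UNIV. bdry_pt \<omega> $ i * u1 i \<sigma> (x + b *\<^sub>R bdry_pt \<omega>)"
    have ptL: "\<bar>u1 i \<sigma> (x + b *\<^sub>R bdry_pt \<omega>)\<bar> \<le> K * weight (C * L) \<omega>"
        "\<bar>u2 i \<sigma> (x + b *\<^sub>R bdry_pt \<omega>)\<bar> \<le> K * weight (C * L) \<omega>" if "b \<in> {0..a}" for b i \<omega>
      using that a \<sigma> unfolding K_def
      by (auto intro!: exp_bounded_cont_weight[OF u1 C bdry x] exp_bounded_cont_weight[OF u2 C bdry x])
    have deriv: "((\<lambda>b. ?\<Phi> b \<omega>) has_real_derivative ?\<Psi> b \<omega>) (at b within {0..a})" if "b \<in> {0..a}" for b \<omega>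
    proof -
      have "((\<lambda>b. ?\<Phi> b \<omega>) has_real_derivative
          0 * (\<Sum>i\<in>UNIV. u2 i \<sigma> (x + b *\<^sub>R bdry_pt \<omega>)) + ?\<Psi> b \<omega>) (at b within {0..a})"
        by (rule deriv_along_path)
           (use \<sigma> that pt_mem_half_space[OF bdry x] in \<open>auto intro!: derivative_eq_intros\<close>)
      then show ?thesis by simp
    qed
    have cont: "continuous_on {0..a} (\<lambda>b. ?\<Psi> b \<omega>)" for \<omega>
      by (intro continuous_intros continuous_on_exp_bounded_cont[OF u1])
         (use \<sigma> pt_mem_half_space[OF bdry x] in auto)
    \<comment> \<open>Writing \<open>max 0 b\<close> keeps the point in the half-space for every
      real b; the indicator hides the change.\<close>
    have "(\<lambda>(b, \<omega>). indicator {0..a} b * (\<Sum>i\<in>UNIV. bdry_pt \<omega> $ i * u1 i \<sigma> (x + max 0 b *\<^sub>R bdry_pt \<omega>)))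
        \<in> borel_measurable (lborel \<Otimes>\<^sub>M sample)"
      using measurable_pair_coord[OF bdry] measurable_pair_at_pt[OF u1 bdry x, of "\<lambda>_. \<sigma>" "max 0"] \<sigma>
      by (auto simp: case_prod_unfold intro!: borel_measurable_times borel_measurable_sum)
    then have meas: "(\<lambda>(b, \<omega>). indicator {0..a} b * ?\<Psi> b \<omega>) \<in> borel_measurable (lborel \<Otimes>\<^sub>M sample)"
      by (rule measurable_cong[THEN iffD1, rotated]) (auto simp: indicator_def max_def)
    have bound: "\<bar>?\<Psi> b \<omega>\<bar> \<le> real CARD('n) * (K * weight (C * L + 1) \<omega>)" if "b \<in> {0..a}" for b \<omega>
    proof -
      have "\<bar>?\<Psi> b \<omega>\<bar> \<le> (\<Sum>i\<in>(UNIV::'n set). K * weight (C * L + 1) \<omega>)"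
        by (rule order_trans[OF sum_abs], rule sum_mono,
            rule coord_times_weight_bound[OF ptL(1)[OF that] abs_pt_nth_le[OF bdry]])
      then show ?thesis by simp
    qed
    have int: "integrable sample (?\<Phi> 0)" "integrable sample (?\<Phi> a)"
      using a \<sigma> by (auto intro!: integrable_at_pt[OF u C bdry x])
    have B: "integrable sample (\<lambda>\<omega>. real CARD('n) * (K * weight (C * L + 1) \<omega>))"
      by (intro integrable_mult_right integrable_weight)
    have a0: "0 \<le> a" using a by simp
    note FTC = expectation_FTC[OF prob_space_sample a0, of ?\<Phi> ?\<Psi>, OF deriv cont meas bound B int]
    have E: "(\<integral>\<omega>. ?\<Psi> b \<omega> \<partial>sample) = (\<Sum>i\<in>UNIV. if i = last_idx then 0 else b * (\<integral>\<omega>. u2 i \<sigma> (x + b *\<^sub>R bdry_pt \<omega>) \<partial>sample))"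
      if "b \<in> {0..a}" for b
    proof -
      have "(\<integral>\<omega>. ?\<Psi> b \<omega> \<partial>sample) = (\<Sum>i\<in>UNIV. \<integral>\<omega>. bdry_pt \<omega> $ i * u1 i \<sigma> (x + b *\<^sub>R bdry_pt \<omega>) \<partial>sample)"
        by (rule Bochner_Integration.integral_sum) (use integrable_coord_at_pt[OF u1 C bdry x] that \<sigma> in auto)
      also have "\<dots> = (\<Sum>i\<in>UNIV. if i = last_idx then 0 else b * (\<integral>\<omega>. u2 i \<sigma> (x + b *\<^sub>R bdry_pt \<omega>) \<partial>sample))"
      proof (intro sum.cong refl)
        fix i :: 'n
        show "(\<integral>\<omega>. bdry_pt \<omega> $ i * u1 i \<sigma> (x + b *\<^sub>R bdry_pt \<omega>) \<partial>sample) =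
            (if i = last_idx then 0 else b * (\<integral>\<omega>. u2 i \<sigma> (x + b *\<^sub>R bdry_pt \<omega>) \<partial>sample))"
        proof (cases "i = last_idx")
          case True
          then show ?thesis by (simp add: bdry_pt_def)
        next
          case False
          then show ?thesis
            using tangential_integration_by_parts[OF False bdry x _ \<sigma>, of b] that by simp
        qed
      qed
      finally show ?thesis .
    qed
    have E_bound: "\<bar>\<integral>\<omega>. ?\<Psi> b \<omega> \<partial>sample\<bar> \<le> D * a" if b: "b \<in> {0..a}" for b
    proof -
      have "\<bar>if i = last_idx then 0 else b * (\<integral>\<omega>. u2 i \<sigma> (x + b *\<^sub>R bdry_pt \<omega>) \<partial>sample)\<bar> \<le> a * M" for i
      proof -
        have "\<bar>\<integral>\<omega>. u2 i \<sigma> (x + b *\<^sub>R bdry_pt \<omega>) \<partial>sample\<bar> \<le> (\<integral>\<omega>. \<bar>u2 i \<sigma> (x + b *\<^sub>R bdry_pt \<omega>)\<bar> \<partial>sample)"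
          by (rule integral_abs_bound)
        also have "\<dots> \<le> (\<integral>\<omega>. K * weight (C * L) (\<omega> :: 'n \<Rightarrow> real) \<partial>sample)"
        proof (rule Bochner_Integration.integral_mono)
          show "integrable sample (\<lambda>\<omega>. \<bar>u2 i \<sigma> (x + b *\<^sub>R bdry_pt \<omega>)\<bar>)"
            using integrable_at_pt[OF u2 C bdry x _ \<sigma>, of b i] b by auto
          show "integrable sample (\<lambda>\<omega>. K * weight (C * L) (\<omega> :: 'n \<Rightarrow> real))"
            by (intro integrable_mult_right integrable_weight)
        qed (rule ptL(2)[OF b])
        also have "\<dots> = M" by (simp add: M_def)
        finally have "b * \<bar>\<integral>\<omega>. u2 i \<sigma> (x + b *\<^sub>R bdry_pt \<omega>) \<partial>sample\<bar> \<le> a * M"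
          using b M0 by (intro mult_mono) auto
        then show ?thesis using b a0 M0 by (simp add: abs_mult)
      qed
      then have "\<bar>\<integral>\<omega>. ?\<Psi> b \<omega> \<partial>sample\<bar> \<le> (\<Sum>i\<in>(UNIV::'n set). a * M)"
        unfolding E[OF b] by (intro order_trans[OF sum_abs] sum_mono)
      then show ?thesis by (simp add: D_def mult_ac)
    qed
    have "\<bar>(\<integral>\<omega>. ?\<Phi> a \<omega> \<partial>sample) - (\<integral>\<omega>. ?\<Phi> 0 \<omega> \<partial>sample)\<bar> = \<bar>LINT b:{0..a}|lborel. \<integral>\<omega>. ?\<Psi> b \<omega> \<partial>sample\<bar>"
      using FTC(2) by simp
    also have "\<dots> \<le> (\<integral>b. \<bar>indicator {0..a} b *\<^sub>R (\<integral>\<omega>. ?\<Psi> b \<omega> \<partial>sample)\<bar> \<partial>lborel)"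
      unfolding set_lebesgue_integral_def by (rule integral_abs_bound)
    also have "\<dots> \<le> (\<integral>b. indicator {0..a} b * (D * a) \<partial>lborel)"
      using FTC(1) E_bound a0 unfolding set_integrable_def
      by (intro Bochner_Integration.integral_mono integrable_abs integrable_mult_left integrable_real_indicator)
         (auto simp: indicator_def emeasure_lborel_Icc_eq)
    also have "\<dots> = D * a\<^sup>2" using a0 by (simp add: power2_eq_square)
    finally show ?thesis using S.prob_space by simp
  qed
  then show ?thesis by blast
qed

end

subsection \<open>Time evolution of the half-space mean\<close>

context half_space_heat
begin

lemma integral_half_pt_last: "(\<integral>\<omega>. half_pt \<omega> $ last_idx \<partial>(sample :: ('n \<Rightarrow> real) measure)) = sqrt (pi / 2)"
proof -
  interpret I: prob_space "Pi\<^sub>M (UNIV - {last_idx :: 'n}) coord_measure"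
    by (rule prob_space_PiM) (rule prob_space_coord_measure)
  have "integrable sample (\<lambda>\<omega> :: 'n \<Rightarrow> real. half_pt \<omega> $ last_idx)"
    by (rule integrable_sample_bound[where K = 1 and L = 1])
       (use measurable_pt_nth abs_coord_le_weight in \<open>auto simp: half_pt_def\<close>)
  then show ?thesis
    using I.prob_space by (subst integral_sample_coord[of _ last_idx]) (auto simp: half_pt_def integral_abs_last_coord)
qed

lemma integral_half_pt_tangential:
  assumes "i \<noteq> last_idx"
  shows "(\<integral>\<omega>. half_pt \<omega> $ i \<partial>(sample :: ('n \<Rightarrow> real) measure)) = 0"
proof -
  have "integrable sample (\<lambda>\<omega> :: 'n \<Rightarrow> real. half_pt \<omega> $ i)"
    by (rule integrable_sample_bound[where K = 1 and L = 1])
       (use measurable_pt_nth abs_coord_le_weight assms in \<open>auto simp: half_pt_def\<close>)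
  \<comment> \<open>Stein's identity for the constant function 1 says that the mean is zero.\<close>
  moreover have "(\<integral>y. (y * 1 - 0) \<partial>coord_measure i) = 0"
    by (rule coord_integration_by_parts[OF assms, where C = 1 and K = 0]) auto
  ultimately show ?thesis
    using assms by (subst integral_sample_coord[of _ i]) (auto simp: half_pt_def)
qed

text \<open>Since r r' = -1, the heat equation gives -(r Y . grad u - r^2 Laplacian u - u) / r^3 as
  the derivative of u / r along the curve. In expectation the tangential directions cancel, while
  the normal direction and the term u leave the boundary value. As s < t, r is bounded away from 0
  on [0, s]; the contribution of time 0 vanishes by the initial condition.\<close>

lemma half_space_mean_identity:
  assumes x: "x \<in> half_space_bdry" and t: "t \<le> T" and s: "0 \<le> s" "s < t"
  defines "r \<equiv> \<lambda>\<sigma>. sqrt (2 * (t - \<sigma>))"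
  shows "set_integrable lborel {0..s} (\<lambda>\<sigma>. (\<integral>\<omega>. u \<sigma> (x + r \<sigma> *\<^sub>R bdry_pt \<omega>) \<partial>sample) / r \<sigma> ^ 3)" (is ?A)
    and "(LINT \<sigma>:{0..s}|lborel. (\<integral>\<omega>. u \<sigma> (x + r \<sigma> *\<^sub>R bdry_pt \<omega>) \<partial>sample) / r \<sigma> ^ 3) =
      (\<integral>\<omega>. u s (x + r s *\<^sub>R half_pt \<omega>) \<partial>sample) / r s" (is ?B)
proof -
  have half: "half_pt = half_pt \<or> half_pt = bdry_pt" by simp
  define K where "K = C * exp (C * norm x)"
  define R where "R = r 0"
  define N where "N = real CARD('n)"
  have K0: "K \<ge> 0" using C by (simp add: K_def)
  have r0: "r \<sigma> > 0" and r_le: "r \<sigma> \<le> R" and r_ge: "r s \<le> r \<sigma>" and \<sigma>T: "\<sigma> \<in> {0..T}"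
    if "\<sigma> \<in> {0..s}" for \<sigma>
    using that s t by (auto simp: r_def R_def)
  have R0: "R > 0" using s by (simp add: R_def r_def)
  have rs: "r s > 0" using r0 s by simp
  have r': "(r has_real_derivative - 1 / r \<sigma>) (at \<sigma> within {0..s})" if "\<sigma> \<in> {0..s}" for \<sigma>
  proof -
    have "((\<lambda>\<sigma>. sqrt (2 * (t - \<sigma>))) has_real_derivative (inverse (sqrt (2 * (t - \<sigma>))) / 2) * (- 2)) (at \<sigma> within {0..s})"
      using r0[OF that] by (auto simp: r_def intro!: derivative_eq_intros)
    then show ?thesis by (simp add: r_def inverse_eq_divide)
  qed
  have r_cont: "continuous_on A r" for A
    unfolding r_def by (intro continuous_intros)
  let ?p = "\<lambda>\<sigma> \<omega>. x + r \<sigma> *\<^sub>R half_pt \<omega>"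
  let ?\<Phi> = "\<lambda>\<sigma> \<omega>. u \<sigma> (?p \<sigma> \<omega>) / r \<sigma>"
  let ?\<Psi> = "\<lambda>\<sigma> \<omega>. - (r \<sigma> * (\<Sum>i\<in>UNIV. half_pt \<omega> $ i * u1 i \<sigma> (?p \<sigma> \<omega>))
      - (r \<sigma>)\<^sup>2 * (\<Sum>i\<in>UNIV. u2 i \<sigma> (?p \<sigma> \<omega>)) - u \<sigma> (?p \<sigma> \<omega>)) / r \<sigma> ^ 3"
  have mem: "?p \<sigma> \<omega> \<in> half_space" if "\<sigma> \<in> {0..s}" for \<sigma> \<omega>
    using pt_mem_half_space[OF half x less_imp_le[OF r0[OF that]]] .
  have deriv: "((\<lambda>\<sigma>. ?\<Phi> \<sigma> \<omega>) has_real_derivative ?\<Psi> \<sigma> \<omega>) (at \<sigma> within {0..s})" if \<sigma>: "\<sigma> \<in> {0..s}" for \<sigma> \<omega>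
  proof -
    define d where "d = (- 1 / r \<sigma>) *\<^sub>R half_pt \<omega>"
    have p': "((\<lambda>\<sigma>. ?p \<sigma> \<omega>) has_vector_derivative d) (at \<sigma> within {0..s})"
      unfolding d_def using r'[OF \<sigma>] by (auto intro!: derivative_eq_intros)
    have "((\<lambda>\<sigma>. u \<sigma> (?p \<sigma> \<omega>)) has_real_derivative
        1 * (\<Sum>i\<in>UNIV. u2 i \<sigma> (?p \<sigma> \<omega>)) + (\<Sum>i\<in>UNIV. d $ i * u1 i \<sigma> (?p \<sigma> \<omega>))) (at \<sigma> within {0..s})"
      by (rule deriv_along_path[OF DERIV_ident p']) (use \<sigma>T mem \<sigma> in auto)
    from DERIV_divide[OF this r'[OF \<sigma>]] r0[OF \<sigma>]
    have "((\<lambda>\<sigma>. ?\<Phi> \<sigma> \<omega>) has_real_derivative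
        (((\<Sum>i\<in>UNIV. u2 i \<sigma> (?p \<sigma> \<omega>)) + (\<Sum>i\<in>UNIV. d $ i * u1 i \<sigma> (?p \<sigma> \<omega>))) * r \<sigma> - u \<sigma> (?p \<sigma> \<omega>) * (- 1 / r \<sigma>)) / (r \<sigma> * r \<sigma>))
        (at \<sigma> within {0..s})" by simp
    moreover have "(\<Sum>i\<in>UNIV. d $ i * u1 i \<sigma> (?p \<sigma> \<omega>)) = - (\<Sum>i\<in>UNIV. half_pt \<omega> $ i * u1 i \<sigma> (?p \<sigma> \<omega>)) / r \<sigma>"
      by (simp add: d_def sum_negf sum_divide_distrib)
    moreover have "((S2 + - S1 / r \<sigma>) * r \<sigma> - U * (- 1 / r \<sigma>)) / (r \<sigma> * r \<sigma>) =
        - (r \<sigma> * S1 - (r \<sigma>)\<^sup>2 * S2 - U) / r \<sigma> ^ 3" for S1 S2 U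
      using r0[OF \<sigma>] by (simp add: field_simps power2_eq_square power3_eq_cube)
    ultimately show ?thesis by simp
  qed
  have cont: "continuous_on {0..s} (\<lambda>\<sigma>. ?\<Psi> \<sigma> \<omega>)" for \<omega>
    by (intro continuous_intros r_cont continuous_on_exp_bounded_cont[OF u1] continuous_on_exp_bounded_cont[OF u2]
          continuous_on_exp_bounded_cont[OF u]) (use \<sigma>T mem r0 in fastforce)+
  have meas: "(\<lambda>(\<sigma>, \<omega>). indicator {0..s} \<sigma> * ?\<Psi> \<sigma> \<omega>) \<in> borel_measurable (lborel \<Otimes>\<^sub>M sample)"
  proof -
    \<comment> \<open>Time is clamped to [0, s], where the integrand is unchanged, so that joint
      measurability can be shown for all parameters.\<close>
    define c where "c = (\<lambda>\<sigma>. max 0 (min s \<sigma>))"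
    have [measurable]: "c \<in> borel_measurable borel" "r \<in> borel_measurable borel"
      unfolding c_def r_def by measurable
    have c: "c \<sigma> \<in> {0..T}" "0 \<le> r (c \<sigma>)" for \<sigma>
      using s t by (auto simp: c_def r_def)
    have m: "(\<lambda>z. f (c (fst z)) (x + r (c (fst z)) *\<^sub>R half_pt (snd z))) \<in> borel_measurable (lborel \<Otimes>\<^sub>M sample)"
      if "exp_bounded_cont T C f" for f
      using measurable_pair_at_pt[OF that half x, of c "\<lambda>\<sigma>. r (c \<sigma>)"] c by (simp add: case_prod_unfold)
    note [measurable] = m[OF u] m[OF u1] m[OF u2] measurable_pair_coord[OF half, unfolded case_prod_unfold]
    have "(\<lambda>z. indicator {0..s} (fst z) * ?\<Psi> (c (fst z)) (snd z)) \<in> borel_measurable (lborel \<Otimes>\<^sub>M sample)"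
      by measurable
    then show ?thesis
      by (rule measurable_cong[THEN iffD1, rotated]) (auto simp: indicator_def c_def)
  qed
  \<comment> \<open>The three summands bound the gradient, Laplacian and zero order terms of
    \<open>?\<Psi>\<close>, using r <= R in the numerator and r >= r(s) in the denominator. The
    extra 1 in the rate pays for the coordinate factor in the gradient term.\<close>
  define B where "B = (\<lambda>\<omega> :: 'n \<Rightarrow> real. (R * N + R\<^sup>2 * N + 1) * K / r s ^ 3 * weight (C * R + 1) \<omega>)"
  have bound: "\<bar>?\<Psi> \<sigma> \<omega>\<bar> \<le> B \<omega>" if \<sigma>: "\<sigma> \<in> {0..s}" for \<sigma> \<omega>
  proof -
    let ?W = "K * weight (C * R + 1) \<omega>"
    have W0: "0 \<le> ?W" using K0 weight_pos[of "C * R + 1" \<omega>] by simp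
    have b: "\<bar>f \<sigma> (?p \<sigma> \<omega>)\<bar> \<le> K * weight (C * R) \<omega>" if "exp_bounded_cont T C f" for f
      unfolding K_def by (rule exp_bounded_cont_weight[OF that C half x]) (use r0[OF \<sigma>] r_le[OF \<sigma>] \<sigma>T[OF \<sigma>] in auto)
    have w: "K * weight (C * R) \<omega> \<le> ?W"
      using K0 by (intro mult_left_mono weight_mono) auto
    have "\<bar>\<Sum>i\<in>UNIV. half_pt \<omega> $ i * u1 i \<sigma> (?p \<sigma> \<omega>)\<bar> \<le> (\<Sum>i\<in>(UNIV::'n set). ?W)"
      by (rule order_trans[OF sum_abs], rule sum_mono,
          rule coord_times_weight_bound[OF b[OF u1] abs_pt_nth_le[OF half]])
    then have "\<bar>r \<sigma> * (\<Sum>i\<in>UNIV. half_pt \<omega> $ i * u1 i \<sigma> (?p \<sigma> \<omega>))\<bar> \<le> R * (N * ?W)"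
      unfolding abs_mult using r0[OF \<sigma>] r_le[OF \<sigma>] by (intro mult_mono) (auto simp: N_def)
    moreover have "\<bar>\<Sum>i\<in>UNIV. u2 i \<sigma> (?p \<sigma> \<omega>)\<bar> \<le> (\<Sum>i\<in>(UNIV::'n set). ?W)"
      by (rule order_trans[OF sum_abs], rule sum_mono, rule order_trans[OF b[OF u2] w])
    then have "\<bar>(r \<sigma>)\<^sup>2 * (\<Sum>i\<in>UNIV. u2 i \<sigma> (?p \<sigma> \<omega>))\<bar> \<le> R\<^sup>2 * (N * ?W)"
      unfolding abs_mult using r0[OF \<sigma>] r_le[OF \<sigma>] by (intro mult_mono) (auto simp: N_def intro!: power_mono)
    moreover have "\<bar>u \<sigma> (?p \<sigma> \<omega>)\<bar> \<le> ?W"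
      by (rule order_trans[OF b[OF u] w])
    ultimately have num: "\<bar>- (r \<sigma> * (\<Sum>i\<in>UNIV. half_pt \<omega> $ i * u1 i \<sigma> (?p \<sigma> \<omega>))
      - (r \<sigma>)\<^sup>2 * (\<Sum>i\<in>UNIV. u2 i \<sigma> (?p \<sigma> \<omega>)) - u \<sigma> (?p \<sigma> \<omega>))\<bar> \<le> R * (N * ?W) + R\<^sup>2 * (N * ?W) + ?W"
      by linarith
    have "\<bar>?\<Psi> \<sigma> \<omega>\<bar> \<le> (R * (N * ?W) + R\<^sup>2 * (N * ?W) + ?W) / r s ^ 3"
      unfolding abs_divide using rs r_ge[OF \<sigma>] r0[OF \<sigma>] num
      by (intro frac_le) (auto intro!: power_mono)
    also have "\<dots> = B \<omega>" by (simp add: B_def algebra_simps add_divide_distrib)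
    finally show ?thesis .
  qed
  have B: "integrable sample B"
    unfolding B_def by (intro integrable_mult_right integrable_weight)
  have int: "integrable sample (?\<Phi> \<sigma>)" if "\<sigma> \<in> {0..s}" for \<sigma>
    using integrable_at_pt[OF u C half x less_imp_le[OF r0[OF that]] \<sigma>T[OF that]] by simp
  have s0: "0 \<in> {0..s}" "s \<in> {0..s}" using s by auto
  note FTC = expectation_FTC[OF prob_space_sample s(1), of ?\<Phi> ?\<Psi>, OF deriv cont meas bound B int[OF s0(1)] int[OF s0(2)]]
  have E: "(\<integral>\<omega>. ?\<Psi> \<sigma> \<omega> \<partial>sample) = (\<integral>\<omega>. u \<sigma> (x + r \<sigma> *\<^sub>R bdry_pt \<omega>) \<partial>sample) / r \<sigma> ^ 3" if \<sigma>: "\<sigma> \<in> {0..s}" for \<sigma>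
  proof -
    have ra: "0 \<le> r \<sigma>" using r0[OF \<sigma>] by simp
    note i0 = integrable_at_pt[OF u C half x ra \<sigma>T[OF \<sigma>]]
    note i1 = integrable_coord_at_pt[OF u1 C half x ra \<sigma>T[OF \<sigma>]]
    note i2 = integrable_at_pt[OF u2 C half x ra \<sigma>T[OF \<sigma>]]
    let ?e1 = "\<lambda>i. \<integral>\<omega>. half_pt \<omega> $ i * u1 i \<sigma> (?p \<sigma> \<omega>) \<partial>sample"
    let ?e2 = "\<lambda>i. \<integral>\<omega>. u2 i \<sigma> (?p \<sigma> \<omega>) \<partial>sample"
    have "(\<integral>\<omega>. ?\<Psi> \<sigma> \<omega> \<partial>sample) =
      - (r \<sigma> * (\<Sum>i\<in>UNIV. ?e1 i) - (r \<sigma>)\<^sup>2 * (\<Sum>i\<in>UNIV. ?e2 i) - (\<integral>\<omega>. u \<sigma> (?p \<sigma> \<omega>) \<partial>sample)) / r \<sigma> ^ 3"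
      using i0 i1 i2 by simp
    \<comment> \<open>Tangential integration by parts removes every direction except the normal
      one.\<close>
    also have "r \<sigma> * (\<Sum>i\<in>UNIV. ?e1 i) - (r \<sigma>)\<^sup>2 * (\<Sum>i\<in>UNIV. ?e2 i) = r \<sigma> * ?e1 last_idx - (r \<sigma>)\<^sup>2 * ?e2 last_idx"
    proof -
      have "(\<Sum>i\<in>UNIV. ?e1 i) - r \<sigma> * (\<Sum>i\<in>UNIV. ?e2 i) = (\<Sum>i\<in>UNIV. ?e1 i - r \<sigma> * ?e2 i)"
        by (simp add: sum_subtractf sum_distrib_left)
      also have "\<dots> = ?e1 last_idx - r \<sigma> * ?e2 last_idx"
        using tangential_integration_by_parts[OF _ half x ra \<sigma>T[OF \<sigma>]]
        by (subst sum.remove[of UNIV last_idx]) auto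
      finally have "r \<sigma> * ((\<Sum>i\<in>UNIV. ?e1 i) - r \<sigma> * (\<Sum>i\<in>UNIV. ?e2 i)) = r \<sigma> * (?e1 last_idx - r \<sigma> * ?e2 last_idx)"
        by simp
      then show ?thesis by (simp add: algebra_simps power2_eq_square)
    qed
    also have "r \<sigma> * ?e1 last_idx - (r \<sigma>)\<^sup>2 * ?e2 last_idx - (\<integral>\<omega>. u \<sigma> (?p \<sigma> \<omega>) \<partial>sample) =
        - (\<integral>\<omega>. u \<sigma> (x + r \<sigma> *\<^sub>R bdry_pt \<omega>) \<partial>sample)"
      by (rule normal_integration_by_parts[OF x ra \<sigma>T[OF \<sigma>]])
    finally show ?thesis by simp
  qed
  show ?A
    by (rule set_integrable_cong[THEN iffD1, OF refl refl E FTC(1)])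
  have "(LINT \<sigma>:{0..s}|lborel. (\<integral>\<omega>. u \<sigma> (x + r \<sigma> *\<^sub>R bdry_pt \<omega>) \<partial>sample) / r \<sigma> ^ 3) = 
      (LINT \<sigma>:{0..s}|lborel. \<integral>\<omega>. ?\<Psi> \<sigma> \<omega> \<partial>sample)"
    by (rule set_lebesgue_integral_cong, simp, intro allI impI, rule E[symmetric])
  also have "\<dots> = (\<integral>\<omega>. u s (x + r s *\<^sub>R half_pt \<omega>) \<partial>sample) / r s - (\<integral>\<omega>. u 0 (x + r 0 *\<^sub>R half_pt \<omega>) \<partial>sample) / r 0"
    using FTC(2) by (simp only: integral_divide_zero)
  also have "(\<integral>\<omega>. u 0 (x + r 0 *\<^sub>R half_pt \<omega>) \<partial>sample) = 0"
    using initial[OF mem[OF s0(1)]] by simp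
  finally show ?B by simp
qed

end

subsection \<open>The flux of a heat solution\<close>

lemma set_integrable_inverse_sqrt:
  assumes "t > 0"
  shows "set_integrable lborel {0..t} (\<lambda>\<sigma>. 1 / sqrt (t - \<sigma>))"
proof -
  let ?F = "\<lambda>\<sigma>. - 2 * sqrt (t - \<sigma>)"
  \<comment> \<open>The interval of the improper integral is open; starting it at -1 puts 0
    inside.\<close>
  have "set_integrable lborel (einterval (ereal (-1)) (ereal t)) (\<lambda>\<sigma>. 1 / sqrt (t - \<sigma>))"
  proof (rule interval_integral_FTC_nonneg(1)[where F = ?F])
    show "DERIV ?F \<sigma> :> 1 / sqrt (t - \<sigma>)" if "ereal \<sigma> < ereal t" for \<sigma>
      using that by (auto intro!: derivative_eq_intros simp: field_simps)
    show "isCont (\<lambda>\<sigma>. 1 / sqrt (t - \<sigma>)) \<sigma>" if "ereal \<sigma> < ereal t" for \<sigma>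
      using that by (auto intro!: continuous_intros)
    show "((?F \<circ> real_of_ereal) \<longlongrightarrow> - 2 * sqrt (t - (-1))) (at_right (ereal (-1)))"
      unfolding ereal_tendsto_simps by (intro tendsto_intros)
    show "((?F \<circ> real_of_ereal) \<longlongrightarrow> - 2 * sqrt (t - t)) (at_left (ereal t))"
      unfolding ereal_tendsto_simps by (intro tendsto_intros)
  qed (use assms in auto)
  then have "set_integrable lborel {0..<t} (\<lambda>\<sigma>. 1 / sqrt (t - \<sigma>))"
    by (rule set_integrable_subset) auto
  \<comment> \<open>At the endpoint t the integrand is 1 / sqrt 0 = 0, so closing the interval
    changes nothing.\<close>
  moreover have "(\<lambda>\<sigma>. indicator {0..<t} \<sigma> *\<^sub>R (1 / sqrt (t - \<sigma>))) = (\<lambda>\<sigma>. indicator {0..t} \<sigma> *\<^sub>R (1 / sqrt (t - \<sigma>)))"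
    by (auto simp: fun_eq_iff indicator_def)
  ultimately show ?thesis unfolding set_integrable_def by simp
qed

text \<open>Dominated convergence with |f| as majorant. At the point t itself the indicators of
  \<open>{0..s k}\<close> may all be 0; \<open>f t = 0\<close> makes the limit right there
  too.\<close>

lemma set_integral_tendsto_upper:
  fixes f :: "real \<Rightarrow> real"
  assumes f: "set_integrable lborel {0..t} f" "f t = 0"
    and s: "\<And>k :: nat. s k \<le> t" "s \<longlonglongrightarrow> t"
  shows "(\<lambda>k. LINT \<sigma>:{0..s k}|lborel. f \<sigma>) \<longlonglongrightarrow> (LINT \<sigma>:{0..t}|lborel. f \<sigma>)"
  unfolding set_lebesgue_integral_def
proof (rule integral_dominated_convergence)
  show "integrable lborel (\<lambda>\<sigma>. \<bar>indicator {0..t} \<sigma> *\<^sub>R f \<sigma>\<bar>)"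
    using f(1) unfolding set_integrable_def by (rule integrable_abs)
  show "(\<lambda>\<sigma>. indicator {0..t} \<sigma> *\<^sub>R f \<sigma>) \<in> borel_measurable lborel"
    using f(1) unfolding set_integrable_def by (rule borel_measurable_integrable)
  show "(\<lambda>\<sigma>. indicator {0..s k} \<sigma> *\<^sub>R f \<sigma>) \<in> borel_measurable lborel" for k
  proof -
    have "set_integrable lborel {0..s k} f"
      using f(1) by (rule set_integrable_subset) (use s(1)[of k] in auto)
    then show ?thesis unfolding set_integrable_def by (rule borel_measurable_integrable)
  qed
  show "AE \<sigma> in lborel. (\<lambda>k. indicator {0..s k} \<sigma> *\<^sub>R f \<sigma>) \<longlonglongrightarrow> indicator {0..t} \<sigma> *\<^sub>R f \<sigma>"
  proof (rule AE_I2)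
    fix \<sigma> :: real
    consider "\<sigma> < t" | "\<sigma> = t" | "\<sigma> > t" by linarith
    then show "(\<lambda>k. indicator {0..s k} \<sigma> *\<^sub>R f \<sigma>) \<longlonglongrightarrow> indicator {0..t} \<sigma> *\<^sub>R f \<sigma>"
    proof cases
      case 1
      have "\<forall>\<^sub>F k in sequentially. indicator {0..s k} \<sigma> *\<^sub>R f \<sigma> = indicator {0..t} \<sigma> *\<^sub>R f \<sigma>"
        using order_tendstoD(1)[OF s(2) 1] by eventually_elim (use 1 in \<open>auto simp: indicator_def\<close>)
      then show ?thesis by (rule tendsto_eventually)
    next
      case 2
      then show ?thesis using f(2) by simp
    next
      case 3
      then have "\<not> \<sigma> \<le> s k" for k using s(1)[of k] by linarith
      then show ?thesis using 3 by (simp add: indicator_def)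
    qed
  qed
  show "AE \<sigma> in lborel. norm (indicator {0..s k} \<sigma> *\<^sub>R f \<sigma>) \<le> \<bar>indicator {0..t} \<sigma> *\<^sub>R f \<sigma>\<bar>" for k
    using s(1)[of k] by (auto intro!: AE_I2 simp: indicator_def)
qed

context half_space_heat
begin

text \<open>Along (t - b^2 / 2, x + b Y) the time component has zero derivative at b = 0, so the
  pathwise difference quotients tend to Y . grad u(t, x). In expectation only the normal term
  survives, with the Rayleigh mean as its factor. The mean value inequality supplies the
  majorant.\<close>

lemma half_space_mean_derivative:
  assumes x: "x \<in> half_space_bdry" and t: "0 < t" "t \<le> T"
    and a: "\<And>k :: nat. 0 < a k" "\<And>k. a k \<le> sqrt (2 * t)" "a \<longlonglongrightarrow> 0"
  shows "(\<lambda>k. ((\<integral>\<omega>. u (t - (a k)\<^sup>2 / 2) (x + a k *\<^sub>R half_pt \<omega>) \<partial>sample) - u t x) / a k)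
    \<longlonglongrightarrow> sqrt (pi / 2) * u1 last_idx t x"
proof -
  interpret S: prob_space "sample :: ('n \<Rightarrow> real) measure" by (rule prob_space_sample)
  have half: "half_pt = half_pt \<or> half_pt = bdry_pt" by simp
  define R where "R = sqrt (2 * t)"
  define K where "K = C * exp (C * norm x)"
  define N where "N = real CARD('n)"
  have K0: "K \<ge> 0" using C by (simp add: K_def)
  have R0: "R > 0" using t by (simp add: R_def)
  have time: "t - b\<^sup>2 / 2 \<in> {0..T}" if "b \<in> {0..R}" for b
  proof -
    have "b\<^sup>2 \<le> R\<^sup>2" using that by (intro power_mono) auto
    then have "b\<^sup>2 \<le> 2 * t" using t by (simp add: R_def)
    moreover have "0 \<le> b\<^sup>2" by simp
    ultimately show ?thesis using t unfolding atLeastAtMost_iff by linarith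
  qed
  have aR: "a k \<in> {0..R}" for k using a(1,2)[of k] by (auto simp: R_def)
  let ?p = "\<lambda>b \<omega>. x + b *\<^sub>R half_pt \<omega>"
  let ?\<psi> = "\<lambda>\<omega> b. u (t - b\<^sup>2 / 2) (?p b \<omega>)"
  let ?\<psi>' = "\<lambda>\<omega> b. - b * (\<Sum>i\<in>UNIV. u2 i (t - b\<^sup>2 / 2) (?p b \<omega>)) +
    (\<Sum>i\<in>UNIV. half_pt \<omega> $ i * u1 i (t - b\<^sup>2 / 2) (?p b \<omega>))"
  have deriv: "(?\<psi> \<omega> has_real_derivative ?\<psi>' \<omega> b) (at b within {0..R})" if b: "b \<in> {0..R}" for b \<omega>
    by (rule deriv_along_path)
       (use time b pt_mem_half_space[OF half x] in \<open>auto intro!: derivative_eq_intros\<close>)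
  define B where "B = (\<lambda>\<omega> :: 'n \<Rightarrow> real. (R * N + N) * K * weight (C * R + 1) \<omega>)"
  have bound: "\<bar>?\<psi>' \<omega> b\<bar> \<le> B \<omega>" if b: "b \<in> {0..R}" for b \<omega>
  proof -
    let ?W = "K * weight (C * R + 1) \<omega>"
    have bd: "\<bar>f (t - b\<^sup>2 / 2) (?p b \<omega>)\<bar> \<le> K * weight (C * R) \<omega>" if "exp_bounded_cont T C f" for f
      unfolding K_def by (rule exp_bounded_cont_weight[OF that C half x _ _ time[OF b]]) (use b in auto)
    have w: "K * weight (C * R) \<omega> \<le> ?W"
      using K0 by (intro mult_left_mono weight_mono) auto
    have "\<bar>\<Sum>i\<in>UNIV. half_pt \<omega> $ i * u1 i (t - b\<^sup>2 / 2) (?p b \<omega>)\<bar> \<le> (\<Sum>i\<in>(UNIV::'n set). ?W)"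
      by (rule order_trans[OF sum_abs], rule sum_mono,
          rule coord_times_weight_bound[OF bd[OF u1] abs_pt_nth_le[OF half]])
    moreover have "\<bar>\<Sum>i\<in>UNIV. u2 i (t - b\<^sup>2 / 2) (?p b \<omega>)\<bar> \<le> (\<Sum>i\<in>(UNIV::'n set). ?W)"
      by (rule order_trans[OF sum_abs], rule sum_mono, rule order_trans[OF bd[OF u2] w])
    then have "\<bar>- b * (\<Sum>i\<in>UNIV. u2 i (t - b\<^sup>2 / 2) (?p b \<omega>))\<bar> \<le> R * (N * ?W)"
      unfolding abs_mult using b by (intro mult_mono) (auto simp: N_def)
    ultimately have "\<bar>?\<psi>' \<omega> b\<bar> \<le> R * (N * ?W) + N * ?W"
      by (simp add: N_def)
    then show ?thesis by (simp add: B_def algebra_simps)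
  qed
  have B: "integrable sample B"
    unfolding B_def by (intro integrable_mult_right integrable_weight)
  let ?L = "\<lambda>\<omega>. \<Sum>i\<in>UNIV. half_pt \<omega> $ i * u1 i t x"
  have int: "integrable sample (\<lambda>\<omega>. u (t - (a k)\<^sup>2 / 2) (?p (a k) \<omega>))" for k
    by (rule integrable_at_pt[OF u C half x _ time]) (use aR in auto)
  have "(\<lambda>k. \<integral>\<omega>. (?\<psi> \<omega> (a k) - u t x) / a k \<partial>sample) \<longlonglongrightarrow> (\<integral>\<omega>. ?L \<omega> \<partial>sample)"
  proof (rule integral_dominated_convergence[where w = B])
    show "?L \<in> borel_measurable sample"
      by (intro borel_measurable_sum borel_measurable_times measurable_pt_nth[OF half]) auto
    show "(\<lambda>\<omega>. (?\<psi> \<omega> (a k) - u t x) / a k) \<in> borel_measurable sample" for k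
      using borel_measurable_integrable[OF int[of k]] by measurable
    show "AE \<omega> in sample. (\<lambda>k. (?\<psi> \<omega> (a k) - u t x) / a k) \<longlonglongrightarrow> ?L \<omega>"
    proof (rule AE_I2)
      fix \<omega> :: "'n \<Rightarrow> real"
      have "((\<lambda>b. (?\<psi> \<omega> b - ?\<psi> \<omega> 0) / (b - 0)) \<longlongrightarrow> ?\<psi>' \<omega> 0) (at 0 within {0..R})"
        using deriv[of 0 \<omega>] R0 unfolding has_field_derivative_iff by auto
      moreover have "filterlim a (at 0 within {0..R}) sequentially"
        unfolding filterlim_at using a(1,3) aR by (auto intro!: always_eventually simp: less_imp_neq[symmetric])
      ultimately have "(\<lambda>k. (?\<psi> \<omega> (a k) - ?\<psi> \<omega> 0) / (a k - 0)) \<longlonglongrightarrow> ?\<psi>' \<omega> 0"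
        by (rule filterlim_compose)
      then show "(\<lambda>k. (?\<psi> \<omega> (a k) - u t x) / a k) \<longlonglongrightarrow> ?L \<omega>" by simp
    qed
    show "AE \<omega> in sample. norm ((?\<psi> \<omega> (a k) - u t x) / a k) \<le> B \<omega>" for k
    proof (rule AE_I2)
      fix \<omega> :: "'n \<Rightarrow> real"
      have "norm (?\<psi> \<omega> (a k) - ?\<psi> \<omega> 0) \<le> B \<omega> * norm (a k - 0)"
        by (rule field_differentiable_bound[OF _ deriv]) (use bound aR R0 in auto)
      then show "norm ((?\<psi> \<omega> (a k) - u t x) / a k) \<le> B \<omega>"
        using a(1)[of k] by (simp add: pos_divide_le_eq)
    qed
  qed (rule B)
  moreover have "(\<integral>\<omega>. (?\<psi> \<omega> (a k) - u t x) / a k \<partial>sample) = ((\<integral>\<omega>. ?\<psi> \<omega> (a k) \<partial>sample) - u t x) / a k" for k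
    using int[of k] S.prob_space by simp
  moreover have "(\<integral>\<omega>. ?L \<omega> \<partial>sample) = sqrt (pi / 2) * u1 last_idx t x"
  proof -
    have "\<bar>half_pt \<omega> $ i\<bar> \<le> 1 * weight 1 \<omega>" for \<omega> :: "'n \<Rightarrow> real" and i
      using order_trans[OF abs_pt_nth_le[OF half, of \<omega> i] abs_coord_le_weight[of \<omega> i]] by simp
    then have "integrable sample (\<lambda>\<omega> :: 'n \<Rightarrow> real. half_pt \<omega> $ i)" for i
      by (intro integrable_sample_bound[where K = 1 and L = 1] measurable_pt_nth[OF half])
    then have "(\<integral>\<omega>. ?L \<omega> \<partial>sample) = (\<Sum>i\<in>UNIV. (\<integral>\<omega>. half_pt \<omega> $ i \<partial>(sample :: ('n \<Rightarrow> real) measure)) * u1 i t x)"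
      by simp
    also have "\<dots> = sqrt (pi / 2) * u1 last_idx t x"
      using integral_half_pt_last integral_half_pt_tangential
      by (subst sum.remove[of UNIV last_idx]) auto
    finally show ?thesis .
  qed
  ultimately show ?thesis by (simp only:)
qed

lemma bdry_kernel_mean:
  assumes x: "x \<in> half_space_bdry" and \<sigma>: "\<sigma> \<in> {0..T}" "\<sigma> < t"
  shows "set_integrable bdry_lborel half_space_bdry (\<lambda>y. (u \<sigma> y - u \<sigma> x) *
      (exp (- (norm (x - y))\<^sup>2 / (4 * (t - \<sigma>))) / ((t - \<sigma>) * (4 * pi * (t - \<sigma>)) powr (real CARD('n) / 2))))" (is ?A)
    and "(LINT y:half_space_bdry|bdry_lborel. (u \<sigma> y - u \<sigma> x) *
      (exp (- (norm (x - y))\<^sup>2 / (4 * (t - \<sigma>))) / ((t - \<sigma>) * (4 * pi * (t - \<sigma>)) powr (real CARD('n) / 2)))) =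
      ((\<integral>\<omega>. u \<sigma> (x + sqrt (2 * (t - \<sigma>)) *\<^sub>R bdry_pt \<omega>) \<partial>sample) - u \<sigma> x) / ((t - \<sigma>) * sqrt (4 * pi * (t - \<sigma>)))" (is ?B)
proof -
  interpret S: prob_space "sample :: ('n \<Rightarrow> real) measure" by (rule prob_space_sample)
  have bdry: "bdry_pt = half_pt \<or> bdry_pt = bdry_pt" by simp
  \<comment> \<open>The substitution lemma asks for a globally Borel function, while u is controlled
    on the half-space only. Composing with the projection \<open>P\<close> onto the boundary
    hyperplane provides one without changing any value on the hyperplane.\<close>
  define P where "P = (\<lambda>y :: real ^ 'n::{finite,linorder}. \<chi> i. if i = last_idx then 0 else y $ i)"
  define h where "h = (\<lambda>y. u \<sigma> (P y) - u \<sigma> x)"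
  have P: "P y = y" if "y \<in> half_space_bdry" for y
    using that by (auto simp: P_def half_space_bdry_def vec_eq_iff)
  have P_meas: "P \<in> borel_measurable borel"
    unfolding P_def
  proof (rule borel_measurable_vec_lambda)
    show "(\<lambda>y :: real ^ 'n::{finite,linorder}. if i = last_idx then 0 else y $ i) \<in> borel_measurable borel" for i
      by (cases "i = last_idx") (auto intro!: borel_measurable_continuous_onI continuous_intros)
  qed
  have "(\<lambda>y. u \<sigma> (P y)) \<in> borel_measurable borel"
    by (rule measurable_exp_bounded_cont[OF u _ P_meas])
       (use \<sigma> in \<open>auto simp: P_def half_space_def\<close>)
  then have h: "h \<in> borel_measurable borel" unfolding h_def by measurable
  have pt: "x + b *\<^sub>R bdry_pt \<omega> \<in> half_space_bdry" for b and \<omega> :: "'n \<Rightarrow> real"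
    using x by (simp add: half_space_bdry_def bdry_pt_def)
  have hpt: "h (x + b *\<^sub>R bdry_pt \<omega>) = u \<sigma> (x + b *\<^sub>R bdry_pt \<omega>) - u \<sigma> x" for b \<omega>
    by (simp add: h_def P[OF pt])
  have int: "integrable sample (\<lambda>\<omega>. u \<sigma> (x + sqrt (2 * (t - \<sigma>)) *\<^sub>R bdry_pt \<omega>))"
    by (rule integrable_at_pt[OF u C bdry x _ \<sigma>(1)]) (use \<sigma> in auto)
  have int_h: "integrable sample (\<lambda>\<omega>. h (x + sqrt (2 * (t - \<sigma>)) *\<^sub>R bdry_pt \<omega>))"
    unfolding hpt using int by auto
  have pos: "t - \<sigma> > 0" using \<sigma> by simp
  have eq: "(u \<sigma> y - u \<sigma> x) * c = h y * c" if "y \<in> half_space_bdry" for y c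
    by (simp add: h_def P[OF that])
  show ?A
    by (rule set_integrable_cong[THEN iffD1, OF refl refl eq[symmetric] set_integrable_bdry_heat_kernel[OF pos x h int_h]])
  have "(LINT y:half_space_bdry|bdry_lborel. (u \<sigma> y - u \<sigma> x) *
      (exp (- (norm (x - y))\<^sup>2 / (4 * (t - \<sigma>))) / ((t - \<sigma>) * (4 * pi * (t - \<sigma>)) powr (real CARD('n) / 2)))) =
    (LINT y:half_space_bdry|bdry_lborel. h y *
      (exp (- (norm (x - y))\<^sup>2 / (4 * (t - \<sigma>))) / ((t - \<sigma>) * (4 * pi * (t - \<sigma>)) powr (real CARD('n) / 2))))"
    unfolding set_lebesgue_integral_def
    by (intro Bochner_Integration.integral_cong refl) (auto simp: indicator_def h_def P)
  also have "\<dots> = (\<integral>\<omega>. h (x + sqrt (2 * (t - \<sigma>)) *\<^sub>R bdry_pt \<omega>) \<partial>sample) / ((t - \<sigma>) * sqrt (4 * pi * (t - \<sigma>)))"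
    by (rule bdry_heat_kernel_integral[OF pos x h int_h])
  finally show ?B
    unfolding hpt using int S.prob_space by simp
qed

text \<open>Expresses the weight left over from the heat kernel through the scale r. At sigma = t
  both sides are 0 by division by zero.\<close>

lemma kernel_factor_eq:
  assumes "\<sigma> \<le> t"
  shows "1 / ((t - \<sigma>) * sqrt (4 * pi * (t - \<sigma>))) = sqrt (2 / pi) / sqrt (2 * (t - \<sigma>)) ^ 3"
proof -
  have "sqrt (2 * (t - \<sigma>)) ^ 3 = 2 * (t - \<sigma>) * sqrt (2 * (t - \<sigma>))"
    using assms by (simp add: power3_eq_cube)
  moreover have "sqrt (4 * pi * (t - \<sigma>)) = sqrt (2 * pi) * sqrt (2 * (t - \<sigma>))"
    by (simp flip: real_sqrt_mult)
  moreover have "sqrt (2 / pi) * sqrt (2 * pi) = 2"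
    by (simp flip: real_sqrt_mult)
  then have "sqrt (2 / pi) = 2 / sqrt (2 * pi)"
    by (simp add: field_simps)
  moreover have "1 / (\<tau> * (A * q)) = 2 / A / (2 * \<tau> * q)" for \<tau> A q :: real
    by simp
  ultimately show ?thesis by (simp only:)
qed

text \<open>\<open>w\<close> is the time weight left over in \<open>heat_kernel_eq_prod\<close>, and
  it equals the weight (t - s)^(-3/2) / sqrt (4 pi) of the first integral. With the same weight in
  both integrals, the terms u(s, x) cancel in their difference.\<close>

lemma flux_formula:
  assumes x: "x \<in> half_space_bdry" and t: "0 < t" "t \<le> T"
  defines "w \<equiv> \<lambda>\<sigma>. 1 / ((t - \<sigma>) * sqrt (4 * pi * (t - \<sigma>)))"
    and "m \<equiv> \<lambda>\<sigma>. \<integral>\<omega>. u \<sigma> (x + sqrt (2 * (t - \<sigma>)) *\<^sub>R bdry_pt \<omega>) \<partial>sample"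
  shows "set_integrable lborel {0..t} (\<lambda>\<sigma>. (u t x - u \<sigma> x) * w \<sigma>)" (is "set_integrable _ _ ?H")
    and "set_integrable lborel {0..t} (\<lambda>\<sigma>. (m \<sigma> - u \<sigma> x) * w \<sigma>)" (is "set_integrable _ _ ?J")
    and "- u1 last_idx t x = u t x / sqrt (pi * t) + (LINT \<sigma>:{0..t}|lborel. (u t x - u \<sigma> x) * w \<sigma>)
      - (LINT \<sigma>:{0..t}|lborel. (m \<sigma> - u \<sigma> x) * w \<sigma>)"
proof -
  have bdry: "bdry_pt = half_pt \<or> bdry_pt = bdry_pt" by simp
  define r where "r = (\<lambda>\<sigma>. sqrt (2 * (t - \<sigma>)))"
  define \<kappa> where "\<kappa> = sqrt (2 / pi)"
  have xh: "x \<in> half_space" by (rule half_space_bdry_subset[OF x])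
  have w_eq: "w \<sigma> = \<kappa> / r \<sigma> ^ 3" if "\<sigma> \<le> t" for \<sigma>
    using kernel_factor_eq[OF that] by (simp add: w_def r_def \<kappa>_def)
  have w_nonneg: "w \<sigma> \<ge> 0" if "\<sigma> \<le> t" for \<sigma>
    using that by (simp add: w_def)
  have w_meas: "w \<in> borel_measurable borel"
    unfolding w_def by measurable
  have w_sqrt: "(t - \<sigma>) * w \<sigma> \<le> 1 / sqrt (t - \<sigma>)" if "\<sigma> \<le> t" for \<sigma>
  proof (cases "\<sigma> = t")
    case False
    then have p: "t - \<sigma> > 0" using that by simp
    have "(t - \<sigma>) * w \<sigma> = 1 / sqrt (4 * pi * (t - \<sigma>))" using p by (simp add: w_def)
    also have "\<dots> \<le> 1 / sqrt (t - \<sigma>)"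
    proof (rule divide_left_mono)
      have "1 * (t - \<sigma>) \<le> (4 * pi) * (t - \<sigma>)"
        using p pi_gt3 by (intro mult_right_mono) auto
      then show "sqrt (t - \<sigma>) \<le> sqrt (4 * pi * (t - \<sigma>))" by simp
    qed (use p in auto)
    finally show ?thesis .
  qed simp
  define c where "c = (\<lambda>\<sigma>. max 0 (min t \<sigma>))"
  have c_meas[measurable]: "c \<in> borel_measurable borel" unfolding c_def by measurable
  have c: "c \<sigma> \<in> {0..T}" for \<sigma> using t by (auto simp: c_def)
  have c_id: "c \<sigma> = \<sigma>" if "\<sigma> \<in> {0..t}" for \<sigma> using that by (auto simp: c_def)
  have ux_meas: "(\<lambda>\<sigma>. u (c \<sigma>) x) \<in> borel_measurable borel"
    by (rule measurable_exp_bounded_cont[OF u c_meas]) (use c xh in auto)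
  have m_meas: "(\<lambda>\<sigma>. m (c \<sigma>)) \<in> borel_measurable borel"
  proof -
    interpret S: prob_space "sample :: ('n \<Rightarrow> real) measure" by (rule prob_space_sample)
    have "(\<lambda>(\<sigma>, \<omega>). u (c \<sigma>) (x + sqrt (2 * (t - c \<sigma>)) *\<^sub>R bdry_pt \<omega>)) \<in> borel_measurable (lborel \<Otimes>\<^sub>M sample)"
      by (rule measurable_pair_at_pt[OF u bdry x]) (use c t in \<open>auto simp: c_def\<close>)
    then have "(\<lambda>\<sigma>. \<integral>\<omega>. u (c \<sigma>) (x + sqrt (2 * (t - c \<sigma>)) *\<^sub>R bdry_pt \<omega>) \<partial>sample) \<in> borel_measurable lborel"
      by (rule S.borel_measurable_lebesgue_integral)
    then show ?thesis by (simp add: m_def)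
  qed
  \<comment> \<open>A numerator of order t - sigma reduces the weight of order (t - sigma)^(-3/2) to
    an integrable (t - sigma)^(-1/2).\<close>
  have dominated: "set_integrable lborel {0..t} (\<lambda>\<sigma>. f \<sigma> * w \<sigma>)"
    if f: "(\<lambda>\<sigma>. f (c \<sigma>)) \<in> borel_measurable borel" and bound: "\<And>\<sigma>. \<sigma> \<in> {0..t} \<Longrightarrow> \<bar>f \<sigma>\<bar> \<le> D * (t - \<sigma>)" for f D
    unfolding set_integrable_def
  proof (rule Bochner_Integration.integrable_bound)
    show "integrable lborel (\<lambda>\<sigma>. D * (indicator {0..t} \<sigma> *\<^sub>R (1 / sqrt (t - \<sigma>))))"
      using set_integrable_inverse_sqrt[OF t(1)] unfolding set_integrable_def by (rule integrable_mult_right)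
    have "(\<lambda>\<sigma>. indicator {0..t} \<sigma> *\<^sub>R (f (c \<sigma>) * w \<sigma>)) \<in> borel_measurable borel"
      by (intro borel_measurable_scaleR borel_measurable_times borel_measurable_indicator f w_meas) simp
    then have "(\<lambda>\<sigma>. indicator {0..t} \<sigma> *\<^sub>R (f (c \<sigma>) * w \<sigma>)) \<in> borel_measurable lborel"
      by simp
    then show "(\<lambda>\<sigma>. indicator {0..t} \<sigma> *\<^sub>R (f \<sigma> * w \<sigma>)) \<in> borel_measurable lborel"
      by (rule measurable_cong[THEN iffD1, rotated]) (auto simp: indicator_def c_id)
    show "AE \<sigma> in lborel. norm (indicator {0..t} \<sigma> *\<^sub>R (f \<sigma> * w \<sigma>)) \<le> norm (D * (indicator {0..t} \<sigma> *\<^sub>R (1 / sqrt (t - \<sigma>))))"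
    proof (rule AE_I2)
      fix \<sigma>
      show "norm (indicator {0..t} \<sigma> *\<^sub>R (f \<sigma> * w \<sigma>)) \<le> norm (D * (indicator {0..t} \<sigma> *\<^sub>R (1 / sqrt (t - \<sigma>))))"
      proof (cases "\<sigma> \<in> {0..t}")
        case True
        have D0: "0 \<le> D" using bound[of 0] t by (smt (verit) atLeastAtMost_iff mult_neg_pos)
        have "\<bar>f \<sigma>\<bar> * w \<sigma> \<le> D * (t - \<sigma>) * w \<sigma>"
          using True by (intro mult_right_mono bound w_nonneg) auto
        also have "\<dots> \<le> D * (1 / sqrt (t - \<sigma>))"
          unfolding mult.assoc using True D0 by (intro mult_left_mono w_sqrt) auto
        finally show ?thesis using True D0 w_nonneg[of \<sigma>] by (simp add: abs_mult)
      qed simp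
    qed
  qed
  \<comment> \<open>By the heat equation the time derivative of u at x is a sum of n second
    derivatives, each bounded by the growth estimate at x.\<close>
  define D1 where "D1 = real CARD('n) * (C * exp (C * norm x))"
  have lip: "\<bar>u t x - u \<sigma> x\<bar> \<le> D1 * (t - \<sigma>)" if \<sigma>: "\<sigma> \<in> {0..t}" for \<sigma>
  proof -
    have "norm (u t x - u \<sigma> x) \<le> D1 * norm (t - \<sigma>)"
    proof (rule field_differentiable_bound[where S = "{0..t}"])
      fix z assume z: "z \<in> {0..t}"
      have "((\<lambda>z. u z x) has_real_derivative 1 * (\<Sum>i\<in>UNIV. u2 i z x) + (\<Sum>i\<in>UNIV. 0 $ i * u1 i z x)) (at z within {0..t})"
        by (rule deriv_along_path) (use z t xh in \<open>auto intro!: derivative_eq_intros\<close>)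
      then show "((\<lambda>z. u z x) has_real_derivative (\<Sum>i\<in>UNIV. u2 i z x)) (at z within {0..t})"
        by simp
      have "\<bar>\<Sum>i\<in>UNIV. u2 i z x\<bar> \<le> (\<Sum>i\<in>(UNIV::'n set). C * exp (C * norm x))"
        by (rule order_trans[OF sum_abs], rule sum_mono) (use u2 z t xh in \<open>auto simp: exp_bounded_cont_def\<close>)
      then show "norm (\<Sum>i\<in>UNIV. u2 i z x) \<le> D1" by (simp add: D1_def)
    qed (use \<sigma> t in auto)
    then show ?thesis using \<sigma> by simp
  qed
  show H: "set_integrable lborel {0..t} ?H"
    by (rule dominated[OF _ lip]) (intro borel_measurable_diff borel_measurable_const ux_meas)
  have R: "0 \<le> sqrt (2 * t)" using t by simp
  obtain D2 where D2: "\<forall>\<sigma>\<in>{0..T}. \<forall>a\<in>{0..sqrt (2 * t)}.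
      \<bar>(\<integral>\<omega>. u \<sigma> (x + a *\<^sub>R bdry_pt \<omega>) \<partial>sample) - u \<sigma> x\<bar> \<le> D2 * a\<^sup>2"
    using bdry_mean_bound[OF x R] by blast
  \<comment> \<open>The scale a = sqrt (2 (t - sigma)) has a^2 = 2 (t - sigma), hence the factor
    2.\<close>
  have mean: "\<bar>m \<sigma> - u \<sigma> x\<bar> \<le> (2 * D2) * (t - \<sigma>)" if "\<sigma> \<in> {0..t}" for \<sigma>
    using D2[rule_format, of \<sigma> "sqrt (2 * (t - \<sigma>))"] that t by (auto simp: m_def algebra_simps)
  show J: "set_integrable lborel {0..t} ?J"
    by (rule dominated[OF _ mean]) (intro borel_measurable_diff m_meas ux_meas)
  \<comment> \<open>The difference of the integrands is kappa (m - u(t, x)) / r^3. The part with m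
    is evaluated by \<open>half_space_mean_identity\<close>, the constant part by the antiderivative
    kappa / r.\<close>
  have split: "(LINT \<sigma>:{0..s}|lborel. ?J \<sigma>) - (LINT \<sigma>:{0..s}|lborel. ?H \<sigma>) =
      \<kappa> * (((\<integral>\<omega>. u s (x + r s *\<^sub>R half_pt \<omega>) \<partial>sample) - u t x) / r s) + u t x / sqrt (pi * t)"
    if s: "0 \<le> s" "s < t" for s
  proof -
    have Js: "set_integrable lborel {0..s} ?J" and Hs: "set_integrable lborel {0..s} ?H"
      using set_integrable_subset[OF J, of "{0..s}"] set_integrable_subset[OF H, of "{0..s}"] s by auto
    have r0: "r \<sigma> > 0" if "\<sigma> \<in> {0..s}" for \<sigma> using that s by (simp add: r_def)
    have "((\<lambda>\<sigma>. \<kappa> / r \<sigma>) has_vector_derivative \<kappa> / r \<sigma> ^ 3) (at \<sigma> within {0..s})" if \<sigma>: "\<sigma> \<in> {0..s}" for \<sigma>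
    proof -
      have "(r has_real_derivative - 1 / r \<sigma>) (at \<sigma> within {0..s})"
        using r0[OF \<sigma>] unfolding r_def by (auto intro!: derivative_eq_intros simp: inverse_eq_divide)
      from DERIV_divide[OF DERIV_const[of \<kappa>] this] r0[OF \<sigma>]
      show ?thesis
        unfolding has_real_derivative_iff_has_vector_derivative[symmetric]
        by (simp add: power3_eq_cube mult.assoc)
    qed
    moreover have "continuous_on {0..s} (\<lambda>\<sigma>. \<kappa> / r \<sigma> ^ 3)"
      using r0 unfolding r_def by (intro continuous_intros) fastforce
    ultimately have W: "(LINT \<sigma>:{0..s}|lborel. \<kappa> / r \<sigma> ^ 3) = \<kappa> / r s - \<kappa> / r 0"
      "set_integrable lborel {0..s} (\<lambda>\<sigma>. \<kappa> / r \<sigma> ^ 3)"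
      using integral_FTC_atLeastAtMost[OF s(1), of "\<lambda>\<sigma>. \<kappa> / r \<sigma>" "\<lambda>\<sigma>. \<kappa> / r \<sigma> ^ 3"]
      by (auto simp: set_lebesgue_integral_def intro: borel_integrable_atLeastAtMost')
    have M: "set_integrable lborel {0..s} (\<lambda>\<sigma>. m \<sigma> / r \<sigma> ^ 3)"
      "(LINT \<sigma>:{0..s}|lborel. m \<sigma> / r \<sigma> ^ 3) = (\<integral>\<omega>. u s (x + r s *\<^sub>R half_pt \<omega>) \<partial>sample) / r s"
      using half_space_mean_identity[OF x t(2) s] by (simp_all only: m_def r_def)
    have eq: "?J \<sigma> - ?H \<sigma> = \<kappa> * (m \<sigma> / r \<sigma> ^ 3) - u t x * (\<kappa> / r \<sigma> ^ 3)" if "\<sigma> \<in> {0..s}" for \<sigma>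
      using w_eq[of \<sigma>] that s by (simp add: algebra_simps diff_divide_distrib)
    have "(LINT \<sigma>:{0..s}|lborel. ?J \<sigma>) - (LINT \<sigma>:{0..s}|lborel. ?H \<sigma>) = (LINT \<sigma>:{0..s}|lborel. ?J \<sigma> - ?H \<sigma>)"
      using set_integral_diff(2)[OF Js Hs] by simp
    also have "\<dots> = (LINT \<sigma>:{0..s}|lborel. \<kappa> * (m \<sigma> / r \<sigma> ^ 3) - u t x * (\<kappa> / r \<sigma> ^ 3))"
      by (rule set_lebesgue_integral_cong, simp, intro allI impI, rule eq)
    also have "\<dots> = \<kappa> * (LINT \<sigma>:{0..s}|lborel. m \<sigma> / r \<sigma> ^ 3) - u t x * (LINT \<sigma>:{0..s}|lborel. \<kappa> / r \<sigma> ^ 3)"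
      using set_integral_diff(2)[OF set_integrable_mult_right[OF M(1), of \<kappa>]
          set_integrable_mult_right[OF W(2), of "u t x"]]
      by (simp only: set_integral_mult_right)
    also have "\<dots> = \<kappa> * ((\<integral>\<omega>. u s (x + r s *\<^sub>R half_pt \<omega>) \<partial>sample) / r s) - u t x * (\<kappa> / r s - \<kappa> / r 0)"
      unfolding M(2) W(1) ..
    also have "\<dots> = \<kappa> * (((\<integral>\<omega>. u s (x + r s *\<^sub>R half_pt \<omega>) \<partial>sample) - u t x) / r s) + u t x * (\<kappa> / r 0)"
      by (simp add: algebra_simps diff_divide_distrib)
    also have "\<kappa> / r 0 = 1 / sqrt (pi * t)"
      by (simp add: \<kappa>_def r_def real_sqrt_divide real_sqrt_mult)
    finally show ?thesis by simp
  qed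
  define s where "s = (\<lambda>k :: nat. t - t / (real k + 1))"
  have s: "0 \<le> s k" "s k < t" for k
    using t by (auto simp: s_def field_simps)
  have s_lim: "s \<longlonglongrightarrow> t"
  proof -
    have "(\<lambda>k :: nat. t / (real k + 1)) \<longlonglongrightarrow> 0"
      using tendsto_mult_right_zero[OF LIMSEQ_inverse_real_of_nat, of t] by (simp add: divide_inverse add.commute)
    from tendsto_diff[OF tendsto_const[of t] this] show ?thesis by (simp add: s_def)
  qed
  have rk: "0 < r (s k)" "r (s k) \<le> sqrt (2 * t)" "t - (r (s k))\<^sup>2 / 2 = s k" for k
    using s[of k] by (auto simp: r_def diff_divide_distrib)
  have r_lim: "(\<lambda>k. r (s k)) \<longlonglongrightarrow> 0"
    using tendsto_real_sqrt[OF tendsto_mult[OF tendsto_const[of 2] tendsto_diff[OF tendsto_const[of t] s_lim]]]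
    by (simp add: r_def)
  have "(\<lambda>k. ((\<integral>\<omega>. u (s k) (x + r (s k) *\<^sub>R half_pt \<omega>) \<partial>sample) - u t x) / r (s k)) \<longlonglongrightarrow> sqrt (pi / 2) * u1 last_idx t x"
    using half_space_mean_derivative[OF x t rk(1,2) r_lim] unfolding rk(3) .
  from tendsto_add[OF tendsto_mult[OF tendsto_const[of \<kappa>] this] tendsto_const[of "u t x / sqrt (pi * t)"]]
  have "(\<lambda>k. (LINT \<sigma>:{0..s k}|lborel. ?J \<sigma>) - (LINT \<sigma>:{0..s k}|lborel. ?H \<sigma>))
      \<longlonglongrightarrow> \<kappa> * (sqrt (pi / 2) * u1 last_idx t x) + u t x / sqrt (pi * t)"
    unfolding split[OF s] .
  \<comment> \<open>\<open>w t\<close> is 0 by division by zero, which gives the vanishing at the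
    endpoint that \<open>set_integral_tendsto_upper\<close> asks for.\<close>
  moreover have "(\<lambda>k. (LINT \<sigma>:{0..s k}|lborel. ?J \<sigma>) - (LINT \<sigma>:{0..s k}|lborel. ?H \<sigma>))
      \<longlonglongrightarrow> (LINT \<sigma>:{0..t}|lborel. ?J \<sigma>) - (LINT \<sigma>:{0..t}|lborel. ?H \<sigma>)"
    by (intro tendsto_diff set_integral_tendsto_upper J H s_lim) (use s in \<open>auto simp: less_imp_le w_def\<close>)
  ultimately have "\<kappa> * (sqrt (pi / 2) * u1 last_idx t x) + u t x / sqrt (pi * t) =
      (LINT \<sigma>:{0..t}|lborel. ?J \<sigma>) - (LINT \<sigma>:{0..t}|lborel. ?H \<sigma>)"
    by (rule LIMSEQ_unique)
  moreover have "\<kappa> * sqrt (pi / 2) = 1"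
    by (simp add: \<kappa>_def flip: real_sqrt_mult)
  then have "\<kappa> * (sqrt (pi / 2) * u1 last_idx t x) = u1 last_idx t x"
    by (simp flip: mult.assoc)
  ultimately show "- u1 last_idx t x = u t x / sqrt (pi * t) + (LINT \<sigma>:{0..t}|lborel. ?H \<sigma>)
      - (LINT \<sigma>:{0..t}|lborel. ?J \<sigma>)"
    by simp
qed

end

subsection \<open>Smooth heat solutions\<close>

lemma has_vector_derivative_within_cong:
  assumes "\<And>h. h \<in> A \<Longrightarrow> f h = g h" "x \<in> A"
  shows "(f has_vector_derivative D) (at x within A) \<longleftrightarrow> (g has_vector_derivative D) (at x within A)"
  using assms by (metis has_vector_derivative_transform)

lemma dir_deriv_within_cong:
  assumes "\<And>y. y \<in> S \<Longrightarrow> f y = g y" "x \<in> S"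
  shows "dir_deriv_within S e f x = dir_deriv_within S e g x"
    and "dir_differentiable_within S e f x \<longleftrightarrow> dir_differentiable_within S e g x"
proof -
  have *: "((\<lambda>h. f (x + h *\<^sub>R e)) has_vector_derivative D) (at 0 within {h. x + h *\<^sub>R e \<in> S}) \<longleftrightarrow>
      ((\<lambda>h. g (x + h *\<^sub>R e)) has_vector_derivative D) (at 0 within {h. x + h *\<^sub>R e \<in> S})" for D
    by (rule has_vector_derivative_within_cong) (use assms in auto)
  show "dir_deriv_within S e f x = dir_deriv_within S e g x"
    unfolding dir_deriv_within_def vector_derivative_def * ..
  show "dir_differentiable_within S e f x \<longleftrightarrow> dir_differentiable_within S e g x"
    unfolding dir_differentiable_within_def using *
    by (metis vector_derivative_works differentiableI_vector)
qed

text \<open>\<open>partial i (v t)\<close> and the directional derivative on the product set are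
  identified only at points of that set, so smoothness must be seen to ignore values outside
  it.\<close>

lemma Ck_on_cong: "(\<And>y. y \<in> S \<Longrightarrow> f y = g y) \<Longrightarrow> Ck_on k S f \<longleftrightarrow> Ck_on k S g"
proof (induction k arbitrary: f g)
  case 0
  then show ?case by (simp cong: continuous_on_cong)
next
  case (Suc k)
  have "Ck_on k S (dir_deriv_within S e f) \<longleftrightarrow> Ck_on k S (dir_deriv_within S e g)" for e
    by (rule Suc.IH) (rule dir_deriv_within_cong(1)[OF Suc.prems])
  moreover have "dir_differentiable_within S e f x \<longleftrightarrow> dir_differentiable_within S e g x" if "x \<in> S" for x e
    by (rule dir_deriv_within_cong(2)[OF Suc.prems that])
  moreover have "continuous_on S f \<longleftrightarrow> continuous_on S g"
    by (rule continuous_on_cong[OF refl Suc.prems])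
  ultimately show ?case by simp
qed

lemma smooth_on_imp_continuous_on: "smooth_on S f \<Longrightarrow> continuous_on S f"
  unfolding smooth_on_def using Ck_on.simps(1) by blast

lemma has_real_derivative_dir_deriv_within:
  assumes "smooth_on S f" "e \<in> Basis" "x \<in> S"
  shows "((\<lambda>h. f (x + h *\<^sub>R e)) has_real_derivative dir_deriv_within S e f x) (at 0 within {h. x + h *\<^sub>R e \<in> S})"
proof -
  have "Ck_on (Suc 0) S f" using assms(1) by (simp only: smooth_on_def)
  then have "dir_differentiable_within S e f x" using assms(2,3) by simp
  then show ?thesis
    unfolding dir_differentiable_within_def dir_deriv_within_def
      has_real_derivative_iff_has_vector_derivative vector_derivative_works .
qed

lemma smooth_on_dir_deriv_within:
  assumes "smooth_on S f" "e \<in> Basis"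
  shows "smooth_on S (dir_deriv_within S e f)"
  unfolding smooth_on_def
proof
  fix k
  have "Ck_on (Suc k) S f" using assms(1) by (simp only: smooth_on_def)
  then show "Ck_on k S (dir_deriv_within S e f)" using assms(2) by simp
qed

lemma Basis_axis_mem: "(0, axis i 1) \<in> (Basis :: (real \<times> (real ^ 'n)) set)"
  by (auto simp: Basis_prod_def Basis_vec_def)

lemma dir_deriv_within_partial:
  fixes v :: "real \<Rightarrow> real ^ 'n::{finite,linorder} \<Rightarrow> real"
  assumes "t \<in> {0..T}"
  shows "dir_deriv_within ({0..T} \<times> half_space) (0, axis i 1) (\<lambda>(t, x). v t x) (t, x) = partial i (v t) x"
  using assms by (simp add: dir_deriv_within_def partial_def)

lemma smooth_on_partial:
  fixes v :: "real \<Rightarrow> real ^ 'n::{finite,linorder} \<Rightarrow> real"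
  assumes "smooth_on ({0..T} \<times> half_space) (\<lambda>(t, x). v t x)"
  shows "smooth_on ({0..T} \<times> half_space) (\<lambda>(t, x). partial i (v t) x)"
  using smooth_on_dir_deriv_within[OF assms Basis_axis_mem[of i]] unfolding smooth_on_def
  by (subst Ck_on_cong[where g = "dir_deriv_within ({0..T} \<times> half_space) (0, axis i 1) (\<lambda>(t, x). v t x)"])
     (auto simp: dir_deriv_within_partial)

lemma has_real_derivative_partial:
  fixes v :: "real \<Rightarrow> real ^ 'n::{finite,linorder} \<Rightarrow> real"
  assumes "smooth_on ({0..T} \<times> half_space) (\<lambda>(t, x). v t x)" "t \<in> {0..T}" "x \<in> half_space"
  shows "((\<lambda>h. v t (x + h *\<^sub>R axis i 1)) has_real_derivative partial i (v t) x)
    (at 0 within {h. x + h *\<^sub>R axis i 1 \<in> half_space})"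
  using has_real_derivative_dir_deriv_within[OF assms(1) Basis_axis_mem[of i], of "(t, x)"] assms(2,3)
  by (simp add: dir_deriv_within_partial[OF assms(2)])

text \<open>All factors other than the i-th are zeroth iterates, hence identities. This extracts
  bounds for pure derivatives from the growth hypothesis.\<close>

lemma multi_partial_single:
  "multi_partial (\<lambda>j. if j = i then k else 0) f = (partial i ^^ k) f"
proof -
  have "distinct xs \<Longrightarrow> foldr (\<lambda>j. partial j ^^ (if j = i then k else 0)) xs f =
      (if i \<in> set xs then (partial i ^^ k) f else f)" for xs
    by (induction xs) auto
  from this[of "sorted_list_of_set UNIV"] show ?thesis
    by (simp add: multi_partial_def)
qed

lemma convex_half_space: "convex (half_space :: (real ^ 'n::{finite,linorder}) set)"
  unfolding half_space_def convex_def by auto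

text \<open>\<open>smooth_on\<close> supplies continuous partial derivatives, one-sided at t = 0, at
  t = T and on the boundary. \<open>has_derivative_of_continuous_partials\<close> turns them into a
  total derivative on the closed domain, and the heat equation rewrites its time component.\<close>

lemma has_derivative_heat_solution:
  fixes u :: "real \<Rightarrow> real ^ 'n::{finite,linorder} \<Rightarrow> real"
  assumes T: "T > 0"
    and smooth: "smooth_on ({0..T} \<times> half_space) (\<lambda>(t, x). u t x)"
    and heat: "\<And>t x. t \<in> {0..T} \<Longrightarrow> x \<in> half_space \<Longrightarrow>
      vector_derivative (\<lambda>s. u s x) (at t within {0..T}) = laplacian (u t) x"
    and tx: "t \<in> {0..T}" "x \<in> half_space"
  shows "((\<lambda>(t, x). u t x) has_derivative
    (\<lambda>(dt, dx). dt * (\<Sum>i\<in>UNIV. partial i (partial i (u t)) x) + (\<Sum>i\<in>UNIV. dx $ i * partial i (u t) x)))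
    (at (t, x) within {0..T} \<times> half_space)"
proof -
  let ?S = "{0..T} \<times> (half_space :: (real ^ 'n::{finite,linorder}) set)" and ?f = "\<lambda>(t, x). u t x"
  have e: "(1, 0) \<in> (Basis :: (real \<times> (real ^ 'n::{finite,linorder})) set)"
    by (auto simp: Basis_prod_def)
  have time: "dir_deriv_within ?S (1, 0) ?f (t, x) = laplacian (u t) x"
  proof -
    have "((\<lambda>h. u (t + h) x) has_real_derivative dir_deriv_within ?S (1, 0) ?f (t, x)) (at 0 within {h. t + h \<in> {0..T}})"
      using has_real_derivative_dir_deriv_within[OF smooth e, of "(t, x)"] tx by simp
    then have "((\<lambda>s. u s x) has_real_derivative dir_deriv_within ?S (1, 0) ?f (t, x)) (at t within {0..T})"
      by (rule has_field_derivative_shift_within)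
    \<comment> \<open>On a nondegenerate interval one-sided derivatives are unique, so the
      derivative coming from smoothness is the one in the heat equation.\<close>
    then have "vector_derivative (\<lambda>s. u s x) (at t within {0..T}) = dir_deriv_within ?S (1, 0) ?f (t, x)"
      using T tx unfolding has_real_derivative_iff_has_vector_derivative
      by (intro vector_derivative_within_closed_interval) auto
    then show ?thesis using heat[OF tx] by simp
  qed
  have "(?f has_derivative (\<lambda>h. \<Sum>b\<in>Basis. (h \<bullet> b) * dir_deriv_within ?S b ?f (t, x))) (at (t, x) within ?S)"
  proof (rule has_derivative_of_continuous_partials)
    show "convex ?S" by (intro convex_Times convex_half_space) auto
    show "y + ((z - y) \<bullet> b) *\<^sub>R b \<in> ?S" if yz: "y \<in> ?S" "z \<in> ?S" and b: "b \<in> Basis" for y z b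
    proof -
      consider "b = (1, 0)" | i where "b = (0, axis i 1)"
        using b by (auto simp: Basis_prod_def Basis_vec_def)
      then show ?thesis
      proof cases
        case 1
        then show ?thesis using yz by (cases y; cases z) auto
      next
        case 2
        then show ?thesis using yz
          by (cases y; cases z) (simp_all add: half_space_def inner_axis, simp add: axis_def)
      qed
    qed
    show "((\<lambda>h. ?f (z + h *\<^sub>R b)) has_real_derivative dir_deriv_within ?S b ?f z) (at 0 within {h. z + h *\<^sub>R b \<in> ?S})"
      if "b \<in> Basis" "z \<in> ?S" for b z
      by (rule has_real_derivative_dir_deriv_within[OF smooth that])
    show "continuous_on ?S (dir_deriv_within ?S b ?f)" if "b \<in> Basis" for b
      by (rule smooth_on_imp_continuous_on[OF smooth_on_dir_deriv_within[OF smooth that]])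
  qed (use tx in auto)
  moreover have "(\<Sum>b\<in>Basis. (h \<bullet> b) * dir_deriv_within ?S b ?f (t, x)) =
      (case h of (dt, dx) \<Rightarrow> dt * (\<Sum>i\<in>UNIV. partial i (partial i (u t)) x) + (\<Sum>i\<in>UNIV. dx $ i * partial i (u t) x))" for h
  proof -
    obtain dt dx where h: "h = (dt, dx)" by (cases h)
    have B: "(Basis :: (real \<times> (real ^ 'n::{finite,linorder})) set) = insert (1, 0) (range (\<lambda>i. (0, axis i 1)))"
      by (auto simp: Basis_prod_def Basis_vec_def)
    have inj: "inj (\<lambda>i :: 'n::{finite,linorder}. (0 :: real, axis i (1 :: real)))"
      by (auto simp: inj_on_def axis_eq_axis)
    have notin: "(1, 0) \<notin> range (\<lambda>i :: 'n::{finite,linorder}. (0 :: real, axis i (1 :: real)))"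
      by auto
    have "(\<Sum>b\<in>Basis. (h \<bullet> b) * dir_deriv_within ?S b ?f (t, x)) =
        dt * dir_deriv_within ?S (1, 0) ?f (t, x) +
        (\<Sum>i\<in>UNIV. dx $ i * dir_deriv_within ?S (0, axis i 1) ?f (t, x))"
      unfolding B by (subst sum.insert) (use notin in \<open>auto simp: h sum.reindex[OF inj] inner_axis\<close>)
    then show ?thesis
      unfolding time dir_deriv_within_partial[OF tx(1)] by (simp add: h laplacian_def)
  qed
  ultimately show ?thesis by simp
qed

lemma exp_growth_const_mono:
  fixes a :: real
  assumes "\<bar>a\<bar> \<le> D * exp (D * r)" "0 \<le> D" "D \<le> C" "0 \<le> r"
  shows "\<bar>a\<bar> \<le> C * exp (C * r)"
proof -
  have "D * exp (D * r) \<le> C * exp (C * r)"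
    using assms by (intro mult_mono) (auto intro: mult_right_mono)
  with assms(1) show ?thesis by linarith
qed

section \<open>The flux formula for smooth solutions\<close>

text \<open>Integrability is claimed along with the equation because the Lebesgue integral of a
  non-integrable function is 0 by convention; the equation alone would not express that the
  integrals converge.\<close>

theorem mainTheorem2:
  fixes u g q :: "real \<Rightarrow> real ^ 'n::{finite,linorder} \<Rightarrow> real"
    and Tmax :: real
  assumes Tmax: "Tmax > 0"
    and smooth: "smooth_on ({0..Tmax} \<times> half_space) (\<lambda>(t, x). u t x)"
    and heat: "\<And>t x. t \<in> {0..Tmax} \<Longrightarrow> x \<in> half_space \<Longrightarrow>
      vector_derivative (\<lambda>s. u s x) (at t within {0..Tmax}) = laplacian (u t) x"
    and initial: "\<And>x. x \<in> half_space \<Longrightarrow> u 0 x = 0"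
    and growth: "\<And>\<gamma> :: 'n::{finite,linorder} \<Rightarrow> nat. \<exists>C>0. \<forall>t\<in>{0..Tmax}. \<forall>x\<in>half_space.
      \<bar>multi_partial \<gamma> (u t) x\<bar> \<le> C * exp (C * norm x)"
    and g: "\<And>t x. t \<in> {0..Tmax} \<Longrightarrow> x \<in> half_space_bdry \<Longrightarrow> g t x = u t x"
    and q: "\<And>t x. t \<in> {0..Tmax} \<Longrightarrow> x \<in> half_space_bdry \<Longrightarrow> q t x = - partial last_idx (u t) x"
  shows "\<forall>t\<in>{0<..Tmax}. \<forall>x\<in>half_space_bdry.
    set_integrable lborel {0..t}
      (\<lambda>s. (g t x - g s x) / (sqrt (4 * pi) * (t - s) powr (3 / 2))) \<and>
    (\<forall>s\<in>{0..<t}. set_integrable bdry_lborel half_space_bdry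
      (\<lambda>y. (g s y - g s x) * (exp (- (norm (x - y))\<^sup>2 / (4 * (t - s))) /
              ((t - s) * (4 * pi * (t - s)) powr (real CARD('n) / 2))))) \<and>
    set_integrable lborel {0..t}
      (\<lambda>s. LINT y:half_space_bdry|bdry_lborel.
        (g s y - g s x) * (exp (- (norm (x - y))\<^sup>2 / (4 * (t - s))) /
          ((t - s) * (4 * pi * (t - s)) powr (real CARD('n) / 2)))) \<and>
    q t x = g t x / sqrt (pi * t)
      + (LINT s:{0..t}|lborel. (g t x - g s x) / (sqrt (4 * pi) * (t - s) powr (3 / 2)))
      - (LINT s:{0..t}|lborel. LINT y:half_space_bdry|bdry_lborel.
          (g s y - g s x) * (exp (- (norm (x - y))\<^sup>2 / (4 * (t - s))) /
            ((t - s) * (4 * pi * (t - s)) powr (real CARD('n) / 2))))"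
proof (intro ballI)
  fix t :: real and x :: "real ^ 'n::{finite,linorder}"
  assume t: "t \<in> {0<..Tmax}" and x: "x \<in> half_space_bdry"
  define u1 where "u1 = (\<lambda>i t. partial i (u t))"
  define u2 where "u2 = (\<lambda>i t. partial i (u1 i t))"
  let ?S = "{0..Tmax} \<times> (half_space :: (real ^ 'n::{finite,linorder}) set)"
  have smooth1: "smooth_on ?S (\<lambda>(t, x). u1 i t x)" for i
    unfolding u1_def by (rule smooth_on_partial[OF smooth])
  have smooth2: "smooth_on ?S (\<lambda>(t, x). u2 i t x)" for i
    unfolding u2_def by (rule smooth_on_partial[OF smooth1])
  have "\<forall>i k. \<exists>D>0. \<forall>t\<in>{0..Tmax}. \<forall>x\<in>half_space. \<bar>(partial i ^^ k) (u t) x\<bar> \<le> D * exp (D * norm x)"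
    using growth[of "\<lambda>j. if j = i then k else 0" for i k] unfolding multi_partial_single by blast
  then obtain D where "\<forall>i k. 0 < D i k \<and> (\<forall>t\<in>{0..Tmax}. \<forall>x\<in>half_space.
      \<bar>(partial i ^^ k) (u t) x\<bar> \<le> D i k * exp (D i k * norm x))"
    unfolding choice_iff by blast
  then have D0: "\<And>i k. 0 < D i k" and
    D: "\<And>i k t x. t \<in> {0..Tmax} \<Longrightarrow> x \<in> half_space \<Longrightarrow>
      \<bar>(partial i ^^ k) (u t) x\<bar> \<le> D i k * exp (D i k * norm x)"
    by blast+
  \<comment> \<open>The locale works with one constant for u and all its first and pure second
    derivatives; a finite sum of positive constants dominates each of them.\<close>
  define C where "C = (\<Sum>i\<in>UNIV. \<Sum>k\<le>2. D i k)"
  have D_le: "D i k \<le> C" if "k \<le> 2" for i k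
  proof -
    have "D i k \<le> (\<Sum>k\<le>2. D i k)"
      using that D0 by (intro member_le_sum) (auto intro: less_imp_le)
    also have "\<dots> \<le> C"
      unfolding C_def by (intro member_le_sum sum_nonneg less_imp_le[OF D0]) auto
    finally show ?thesis .
  qed
  have growth': "\<bar>(partial i ^^ k) (u t) x\<bar> \<le> C * exp (C * norm x)"
    if "t \<in> {0..Tmax}" "x \<in> half_space" "k \<le> 2" for i k t x
    by (rule exp_growth_const_mono[OF D[OF that(1,2)] less_imp_le[OF D0] D_le[OF that(3)] norm_ge_zero])
  interpret half_space_heat u u1 u2 Tmax C
  proof
    show "C \<ge> 0"
      unfolding C_def by (intro sum_nonneg less_imp_le[OF D0])
    show "exp_bounded_cont Tmax C u"
      unfolding exp_bounded_cont_def
      using smooth_on_imp_continuous_on[OF smooth] growth'[where k = 0] by auto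
    show "exp_bounded_cont Tmax C (u1 i)" for i
      unfolding exp_bounded_cont_def
      using smooth_on_imp_continuous_on[OF smooth1] growth'[where k = 1 and i = i] by (auto simp: u1_def)
    show "exp_bounded_cont Tmax C (u2 i)" for i
      unfolding exp_bounded_cont_def
      using smooth_on_imp_continuous_on[OF smooth2] growth'[where k = 2 and i = i]
      by (auto simp: u1_def u2_def numeral_2_eq_2)
    show "((\<lambda>(t, x). u t x) has_derivative
        (\<lambda>(dt, dx). dt * (\<Sum>i\<in>UNIV. u2 i t x) + (\<Sum>i\<in>UNIV. dx $ i * u1 i t x))) (at (t, x) within ?S)"
      if "t \<in> {0..Tmax}" "x \<in> half_space" for t x
      unfolding u1_def u2_def by (rule has_derivative_heat_solution[OF Tmax smooth heat that])
    show "((\<lambda>h. u1 i t (x + h *\<^sub>R axis i 1)) has_real_derivative u2 i t x)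
        (at 0 within {h. x + h *\<^sub>R axis i 1 \<in> half_space})"
      if "t \<in> {0..Tmax}" "x \<in> half_space" for t x i
      unfolding u2_def by (rule has_real_derivative_partial[OF smooth1 that])
    show "u 0 x = 0" if "x \<in> half_space" for x by (rule initial[OF that])
  qed
  have t': "0 < t" "t \<le> Tmax" using t by auto
  let ?ker = "\<lambda>s y. exp (- (norm (x - y))\<^sup>2 / (4 * (t - s))) / ((t - s) * (4 * pi * (t - s)) powr (real CARD('n) / 2))"
  let ?w = "\<lambda>s. 1 / ((t - s) * sqrt (4 * pi * (t - s)))"
  let ?m = "\<lambda>s. \<integral>\<omega>. u s (x + sqrt (2 * (t - s)) *\<^sub>R bdry_pt \<omega>) \<partial>sample"
  note flux = flux_formula[OF x t']
  have H: "(g t x - g s x) / (sqrt (4 * pi) * (t - s) powr (3 / 2)) = (u t x - u s x) * ?w s" if s: "s \<in> {0..t}" for s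
  proof -
    have "(t - s) powr (3 / 2) = (t - s) * sqrt (t - s)"
    proof (cases "s = t")
      case False
      then have "t - s > 0" using s by simp
      then have "(t - s) powr (1 + 1 / 2) = (t - s) * sqrt (t - s)"
        by (subst powr_add) (simp add: powr_half_sqrt)
      then show ?thesis by simp
    qed simp
    moreover have "g t x = u t x" "g s x = u s x" using s t' x by (auto intro!: g)
    ultimately show ?thesis by (simp add: real_sqrt_mult)
  qed
  have gu: "(g s y - g s x) * ?ker s y = (u s y - u s x) * ?ker s y" if "s \<in> {0..t}" "y \<in> half_space_bdry" for s y
    using that t' x by (simp add: g)
  have J: "(LINT y:half_space_bdry|bdry_lborel. (g s y - g s x) * ?ker s y) = (?m s - u s x) * ?w s" if s: "s \<in> {0..t}" for s
  proof (cases "s = t")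
    \<comment> \<open>At s = t the kernel is 0 by division by zero, and so is the weight on the
      right.\<close>
    case True
    then show ?thesis by (simp add: set_lebesgue_integral_def)
  next
    case False
    have "(LINT y:half_space_bdry|bdry_lborel. (g s y - g s x) * ?ker s y) =
        (LINT y:half_space_bdry|bdry_lborel. (u s y - u s x) * ?ker s y)"
      unfolding set_lebesgue_integral_def
      by (intro Bochner_Integration.integral_cong refl) (use gu[OF s] in \<open>auto simp: indicator_def\<close>)
    also have "\<dots> = (?m s - u s x) * ?w s"
      using bdry_kernel_mean(2)[OF x, of s t] s t' False by simp
    finally show ?thesis .
  qed
  have Hint: "set_integrable lborel {0..t} (\<lambda>s. (g t x - g s x) / (sqrt (4 * pi) * (t - s) powr (3 / 2)))"
    by (rule set_integrable_cong[THEN iffD1, OF refl refl H[symmetric] flux(1)])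
  have Jint: "set_integrable lborel {0..t} (\<lambda>s. LINT y:half_space_bdry|bdry_lborel. (g s y - g s x) * ?ker s y)"
    by (rule set_integrable_cong[THEN iffD1, OF refl refl J[symmetric] flux(2)])
  have kernel: "set_integrable bdry_lborel half_space_bdry (\<lambda>y. (g s y - g s x) * ?ker s y)" if s: "s \<in> {0..<t}" for s
  proof (rule set_integrable_cong[THEN iffD1, OF refl refl gu[symmetric]])
    show "set_integrable bdry_lborel half_space_bdry (\<lambda>y. (u s y - u s x) * ?ker s y)"
      by (rule bdry_kernel_mean(1)[OF x]) (use s t' in auto)
  qed (use s in auto)
  have "(LINT s:{0..t}|lborel. (g t x - g s x) / (sqrt (4 * pi) * (t - s) powr (3 / 2))) =
      (LINT s:{0..t}|lborel. (u t x - u s x) * ?w s)"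
    by (rule set_lebesgue_integral_cong, simp, intro allI impI, rule H)
  moreover have "(LINT s:{0..t}|lborel. LINT y:half_space_bdry|bdry_lborel. (g s y - g s x) * ?ker s y) =
      (LINT s:{0..t}|lborel. (?m s - u s x) * ?w s)"
    by (rule set_lebesgue_integral_cong, simp, intro allI impI, rule J)
  moreover have "q t x = - u1 last_idx t x" using q[of t x] t' x by (simp add: u1_def)
  moreover have "g t x = u t x" using g[of t x] t' x by simp
  ultimately have "q t x = g t x / sqrt (pi * t)
      + (LINT s:{0..t}|lborel. (g t x - g s x) / (sqrt (4 * pi) * (t - s) powr (3 / 2)))
      - (LINT s:{0..t}|lborel. LINT y:half_space_bdry|bdry_lborel. (g s y - g s x) * ?ker s y)"
    using flux(3) by (simp only:)
  with Hint Jint kernel show "set_integrable lborel {0..t}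
      (\<lambda>s. (g t x - g s x) / (sqrt (4 * pi) * (t - s) powr (3 / 2))) \<and>
    (\<forall>s\<in>{0..<t}. set_integrable bdry_lborel half_space_bdry (\<lambda>y. (g s y - g s x) * ?ker s y)) \<and>
    set_integrable lborel {0..t}
      (\<lambda>s. LINT y:half_space_bdry|bdry_lborel. (g s y - g s x) * ?ker s y) \<and>
    q t x = g t x / sqrt (pi * t)
      + (LINT s:{0..t}|lborel. (g t x - g s x) / (sqrt (4 * pi) * (t - s) powr (3 / 2)))
      - (LINT s:{0..t}|lborel. LINT y:half_space_bdry|bdry_lborel. (g s y - g s x) * ?ker s y)"
    by blast
qed

end
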